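(* There exists a maximally homogeneous symmetric inverse limit semigroup, and it is unique up to isomorphism; that is, any two maximally homogeneous symmetric inverse limit semigroups are isomorphic.
   Context: $\mathcal{I}_n$ is the symmetric inverse semigroup of all partial bijections from $\{1,\dots,n\}$ to itself under composition of partial maps. Inverse semigroups are regarded as algebras in the signature $\{\cdot,{}^{-1}\}$; an inverse subsemigroup is a subsemigroup closed under inverses, and embeddings are injective homomorphisms. A symmetric inverse limit semigroup ($\mathcal{I}_n$-limit inverse semigroup) is a direct limit of a chain of embeddings $\mathcal{I}_{i_1}\to\mathcal{I}_{i_2}\to\mathcal{I}_{i_3}\to\cdots$ with $i_1<i_2<i_3<\cdots$. An inverse semigroup is locally finite if its finitely generated inverse subsemigroups are finite, and universal if every finite inverse semigroup embeds in it; every symmetric inverse limit semigroup is countable, locally finite and universal. A finite inverse semigroup $A_0$ is an amalgamation base for the class of finite inverse semigroups if for all finite inverse semigroups $A_1,A_2$ and embeddings $f_1:A_0\to A_1$, $f_2:A_0\to A_2$ there exist a finite inverse semigroup $B$ and embeddings $g_1:A_1\to B$, $g_2:A_2\to B$ with $f_1g_1=f_2g_2$ (maps composed left to right). $\mathcal{A}$ denotes the class of all such amalgamation bases. (It is known that a finite inverse semigroup belongs to $\mathcal{A}$ if and only if it is $\mathcal{J}$-linear, i.e. its principal two-sided ideals form a chain under inclusion.) For an inverse semigroup $S$ and a finite inverse semigroup $T$, $\mathrm{Aut}(S)$ acts homogeneously on copies of $T$ if for all inverse subsemigroups $T_1,T_2\le S$ with $T_1\cong T\cong T_2$, every isomorphism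 $T_1\to T_2$ extends to an automorphism of $S$. A universal locally finite inverse semigroup $S$ is maximally homogeneous (or $\mathcal{A}$-homogeneous) if $\mathrm{Aut}(S)$ acts homogeneously on copies of $T$ for every $T\in\mathcal{A}$. *)

theory Defs
  imports Main "HOL-Algebra.Congruence"
begin

record 'a inv_alg = "'a partial_object" +
  mul :: "'a \<Rightarrow> 'a \<Rightarrow> 'a"  (infixl \<open>\<cdot>\<index>\<close> 70)
  sinv :: "'a \<Rightarrow> 'a"

locale inverse_semigroup =
  fixes S :: "'a inv_alg" (structure)
  assumes nonempty: "carrier S \<noteq> {}"
    and mul_closed: "\<lbrakk>x \<in> carrier S; y \<in> carrier S\<rbrakk> \<Longrightarrow> x \<cdot> y \<in> carrier S"
    and sinv_closed: "x \<in> carrier S \<Longrightarrow> sinv S x \<in> carrier S"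
    and mul_assoc: "\<lbrakk>x \<in> carrier S; y \<in> carrier S; z \<in> carrier S\<rbrakk>
      \<Longrightarrow> (x \<cdot> y) \<cdot> z = x \<cdot> (y \<cdot> z)"
    and mul_sinv_mul: "x \<in> carrier S \<Longrightarrow> x \<cdot> sinv S x \<cdot> x = x"
    and sinv_mul_sinv: "x \<in> carrier S \<Longrightarrow> sinv S x \<cdot> x \<cdot> sinv S x = sinv S x"
    and sinv_unique: "\<lbrakk>x \<in> carrier S; y \<in> carrier S; x \<cdot> y \<cdot> x = x; y \<cdot> x \<cdot> y = y\<rbrakk>
      \<Longrightarrow> y = sinv S x"

definition finite_inverse_semigroup :: "'a inv_alg \<Rightarrow> bool" where
  "finite_inverse_semigroup S \<longleftrightarrow> inverse_semigroup S \<and> finite (carrier S)"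

definition inverse_subsemigroup :: "'a set \<Rightarrow> 'a inv_alg \<Rightarrow> bool" where
  "inverse_subsemigroup H S \<longleftrightarrow> H \<noteq> {} \<and> H \<subseteq> carrier S \<and>
     (\<forall>x\<in>H. \<forall>y\<in>H. x \<cdot>\<^bsub>S\<^esub> y \<in> H) \<and> (\<forall>x\<in>H. sinv S x \<in> H)"

definition generated :: "'a inv_alg \<Rightarrow> 'a set \<Rightarrow> 'a set" where
  "generated S X = \<Inter>{H. inverse_subsemigroup H S \<and> X \<subseteq> H}"

definition homs :: "'a inv_alg \<Rightarrow> 'b inv_alg \<Rightarrow> ('a \<Rightarrow> 'b) set" where
  "homs S T = {h. h ` carrier S \<subseteq> carrier T \<and>
     (\<forall>x\<in>carrier S. \<forall>y\<in>carrier S. h (x \<cdot>\<^bsub>S\<^esub> y) = h x \<cdot>\<^bsub>T\<^esub> h y) \<and>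
     (\<forall>x\<in>carrier S. h (sinv S x) = sinv T (h x))}"

definition embeddings :: "'a inv_alg \<Rightarrow> 'b inv_alg \<Rightarrow> ('a \<Rightarrow> 'b) set" where
  "embeddings S T = {h \<in> homs S T. inj_on h (carrier S)}"

definition isos :: "'a inv_alg \<Rightarrow> 'b inv_alg \<Rightarrow> ('a \<Rightarrow> 'b) set" where
  "isos S T = {h \<in> homs S T. bij_betw h (carrier S) (carrier T)}"

definition isomorphic :: "'a inv_alg \<Rightarrow> 'b inv_alg \<Rightarrow> bool"  (infix \<open>\<simeq>\<close> 50) where
  "S \<simeq> T \<longleftrightarrow> isos S T \<noteq> {}"

text \<open>
  Partial bijections of \<open>{1..n}\<close> are represented by their graphs, so that left-to-right
  composition is \<^const>\<open>relcomp\<close> and the inverse is \<^const>\<open>converse\<close>.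
\<close>

definition sym_inv :: "nat \<Rightarrow> (nat \<times> nat) set inv_alg" where
  "sym_inv n = \<lparr>carrier = {r. r \<subseteq> {1..n} \<times> {1..n} \<and> single_valued r \<and> single_valued (r\<inverse>)},
     mul = (O), sinv = converse\<rparr>"

text \<open>
  The direct limit of a chain \<open>A 0 \<rightarrow> A 1 \<rightarrow> A 2 \<rightarrow> \<dots>\<close> with maps \<open>e k : A k \<rightarrow> A (Suc k)\<close> is the
  disjoint union of the \<open>A k\<close> modulo eventual equality. For \<open>k \<le> m\<close> the connecting map
  \<open>A k \<rightarrow> A m\<close> is \<open>fold e [k..<m]\<close>.
\<close>

definition limit_rel ::
    "(nat \<Rightarrow> 'a inv_alg) \<Rightarrow> (nat \<Rightarrow> 'a \<Rightarrow> 'a) \<Rightarrow> ((nat \<times> 'a) \<times> (nat \<times> 'a)) set" where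
  "limit_rel A e = {((k, x), (l, y)). x \<in> carrier (A k) \<and> y \<in> carrier (A l) \<and>
     (\<exists>m\<ge>max k l. fold e [k..<m] x = fold e [l..<m] y)}"

definition direct_limit ::
    "(nat \<Rightarrow> 'a inv_alg) \<Rightarrow> (nat \<Rightarrow> 'a \<Rightarrow> 'a) \<Rightarrow> (nat \<times> 'a) set inv_alg" where
  "direct_limit A e =
    \<lparr>carrier = (SIGMA k:UNIV. carrier (A k)) // limit_rel A e,
     mul = (\<lambda>X Y. \<Union>(k, x)\<in>X. \<Union>(l, y)\<in>Y.
       limit_rel A e `` {(max k l, fold e [k..<max k l] x \<cdot>\<^bsub>A (max k l)\<^esub> fold e [l..<max k l] y)}),
     sinv = (\<lambda>X. \<Union>(k, x)\<in>X. limit_rel A e `` {(k, sinv (A k) x)})\<rparr>"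

definition symmetric_inverse_limit :: "'a inv_alg \<Rightarrow> bool" where
  "symmetric_inverse_limit S \<longleftrightarrow> inverse_semigroup S \<and>
     (\<exists>(i :: nat \<Rightarrow> nat) e. 1 \<le> i 0 \<and> strict_mono i \<and>
        (\<forall>k. e k \<in> embeddings (sym_inv (i k)) (sym_inv (i (Suc k)))) \<and>
        S \<simeq> direct_limit (\<lambda>k. sym_inv (i k)) e)"

definition locally_finite :: "'a inv_alg \<Rightarrow> bool" where
  "locally_finite S \<longleftrightarrow>
     (\<forall>X. X \<noteq> {} \<and> finite X \<and> X \<subseteq> carrier S \<longrightarrow> finite (generated S X))"

text \<open>
  In the remaining definitions the quantifiers over all finite inverse semigroups range over
  those whose elements are natural numbers. As every finite inverse semigroup is isomorphic to
  such a one, this loses no generality.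
\<close>

definition universal :: "'a inv_alg \<Rightarrow> bool" where
  "universal S \<longleftrightarrow>
     (\<forall>T :: nat inv_alg. finite_inverse_semigroup T \<longrightarrow> embeddings T S \<noteq> {})"

definition amalgamation_base :: "'a inv_alg \<Rightarrow> bool" where
  "amalgamation_base A0 \<longleftrightarrow> finite_inverse_semigroup A0 \<and>
     (\<forall>(A1 :: nat inv_alg) (A2 :: nat inv_alg).
        finite_inverse_semigroup A1 \<longrightarrow> finite_inverse_semigroup A2 \<longrightarrow>
        (\<forall>f1\<in>embeddings A0 A1. \<forall>f2\<in>embeddings A0 A2.
           \<exists>B :: nat inv_alg. finite_inverse_semigroup B \<and>
             (\<exists>g1\<in>embeddings A1 B. \<exists>g2\<in>embeddings A2 B.
                \<forall>x\<in>carrier A0. g1 (f1 x) = g2 (f2 x))))"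

definition acts_homogeneously :: "'a inv_alg \<Rightarrow> 'b inv_alg \<Rightarrow> bool" where
  "acts_homogeneously S T \<longleftrightarrow>
     (\<forall>T1 T2. inverse_subsemigroup T1 S \<longrightarrow> inverse_subsemigroup T2 S \<longrightarrow>
        S\<lparr>carrier := T1\<rparr> \<simeq> T \<longrightarrow> T \<simeq> S\<lparr>carrier := T2\<rparr> \<longrightarrow>
        (\<forall>\<phi>\<in>isos (S\<lparr>carrier := T1\<rparr>) (S\<lparr>carrier := T2\<rparr>).
           \<exists>\<alpha>\<in>isos S S. \<forall>x\<in>T1. \<alpha> x = \<phi> x))"

definition maximally_homogeneous :: "'a inv_alg \<Rightarrow> bool" where
  "maximally_homogeneous S \<longleftrightarrow> inverse_semigroup S \<and> universal S \<and> locally_finite S \<and>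
     (\<forall>T :: nat inv_alg. amalgamation_base T \<longrightarrow> acts_homogeneously S T)"

end

(* Every finite inverse semigroup acts faithfully by partial bijections on a finite set, and such an
   action is determined, up to points on which nothing is defined, by its marks: the numbers of common
   fixed points of the subgroups. Two actions of sym_inv n, induced by embeddings in sym_inv a and in
   sym_inv b, become isomorphic after both are suitably enlarged: adding coset actions of sym_inv a and
   of sym_inv b, one equalizes the marks, beginning with the subgroups of small rank and, within a
   rank, of large order. Hence sym_inv n is an amalgamation base. Uniqueness follows by
   back-and-forth along the two chains. For existence, amalgamate at each stage so that the next stage
   solves all extension problems over bases inside the present one; back-and-forth then turns
   the solutions into automorphisms of the limit. *)

theory Submission
  imports Defs "HOL-Library.FuncSet" "HOL-Library.Countable_Set"
begin

text \<open>An action can be enlarged but not cut down. Marks on one level are therefore raised to a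
  common value \<open>D * M\<close>: the action already present is taken \<open>D\<close> times, and
  coset actions supply the missing \<open>D * (M - mark)\<close> fixed points, \<open>D\<close>
  being chosen so that the numbers of copies are integers. The added actions must be actions of
  \<open>sym_inv a\<close>, not merely of \<open>sym_inv n\<close>, since the enlarged map has to
  remain an embedding of \<open>sym_inv a\<close>. This has two consequences. Subgroups of
  \<open>sym_inv n\<close> can become conjugate in \<open>sym_inv a\<close>, so all coset actions of
  one level are handled together. And the table of marks of \<open>sym_inv a\<close> has to be
  triangular for an order read off in \<open>sym_inv n\<close>; it is, because embeddings preserve
  the orders of subgroups and the comparison of ranks. Finally, stabilizers are in general only
  inverse subsemigroups; each has the same fixed points as the group formed by its elements of least
  rank, so equal marks at subgroups suffice.\<close>

context inverse_semigroup
begin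

section \<open>Idempotents and inverses in an abstract inverse semigroup\<close>

lemma sinv_sinv: "x \<in> carrier S \<Longrightarrow> sinv S (sinv S x) = x"
  by (metis mul_sinv_mul sinv_closed sinv_mul_sinv sinv_unique)

lemma sinv_idem: "\<lbrakk>e \<in> carrier S; e \<cdot> e = e\<rbrakk> \<Longrightarrow> sinv S e = e"
  by (metis sinv_unique)

text \<open>If \<open>x\<close> is the inverse of \<open>e \<cdot> f\<close>, then so is
  \<open>f \<cdot> x \<cdot> e\<close>; by uniqueness the two agree, and this makes \<open>x\<close>
  idempotent. An idempotent is its own inverse, whence \<open>e \<cdot> f = x\<close>.\<close>

lemma idem_mul_idem:
  assumes "e \<in> carrier S" "e \<cdot> e = e" "f \<in> carrier S" "f \<cdot> f = f"
  shows "(e \<cdot> f) \<cdot> (e \<cdot> f) = e \<cdot> f"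
proof -
  define x where "x = sinv S (e \<cdot> f)"
  have ef: "e \<cdot> f \<in> carrier S" and x: "x \<in> carrier S"
    using assms by (auto simp: x_def mul_closed sinv_closed)
  have xef: "x \<cdot> (e \<cdot> f) \<cdot> x = x" and efx: "(e \<cdot> f) \<cdot> x \<cdot> (e \<cdot> f) = e \<cdot> f"
    using ef by (auto simp: x_def mul_sinv_mul sinv_mul_sinv)
  have ee: "e \<cdot> (e \<cdot> z) = e \<cdot> z" and ff: "f \<cdot> (f \<cdot> z) = f \<cdot> z" if "z \<in> carrier S" for z
    using assms that by (metis mul_assoc)+
  have xef': "x \<cdot> (e \<cdot> (f \<cdot> (x \<cdot> z))) = x \<cdot> z" if "z \<in> carrier S" for z
    using arg_cong[OF xef, of "\<lambda>w. w \<cdot> z"] assms x that by (simp add: mul_assoc mul_closed)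
  have "f \<cdot> x \<cdot> e = x"
    unfolding x_def
  proof (rule sinv_unique[OF ef])
    show "f \<cdot> sinv S (e \<cdot> f) \<cdot> e \<in> carrier S"
      using assms x by (simp add: mul_closed flip: x_def)
    show "e \<cdot> f \<cdot> (f \<cdot> sinv S (e \<cdot> f) \<cdot> e) \<cdot> (e \<cdot> f) = e \<cdot> f"
      using efx assms x by (simp add: mul_closed mul_assoc ee ff flip: x_def)
    show "f \<cdot> sinv S (e \<cdot> f) \<cdot> e \<cdot> (e \<cdot> f) \<cdot> (f \<cdot> sinv S (e \<cdot> f) \<cdot> e) = f \<cdot> sinv S (e \<cdot> f) \<cdot> e"
      using assms x by (simp add: mul_closed mul_assoc ee ff xef' flip: x_def)
  qed
  then have "x \<cdot> x = f \<cdot> x \<cdot> e \<cdot> (f \<cdot> x \<cdot> e)" by simp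
  also have "\<dots> = f \<cdot> x \<cdot> e"
    using assms x by (simp add: mul_closed mul_assoc xef')
  finally have xx: "x \<cdot> x = x" using \<open>f \<cdot> x \<cdot> e = x\<close> by simp
  then have "e \<cdot> f = x"
    using sinv_idem[OF x xx] sinv_sinv[OF ef] by (simp add: x_def)
  then show ?thesis using xx by simp
qed

text \<open>Both products are idempotent, which makes \<open>f \<cdot> e\<close> an inverse of
  \<open>e \<cdot> f\<close>, while \<open>e \<cdot> f\<close> is its own inverse.\<close>

lemma idem_commute:
  assumes "e \<in> carrier S" "e \<cdot> e = e" "f \<in> carrier S" "f \<cdot> f = f"
  shows "e \<cdot> f = f \<cdot> e"
proof -
  have ef: "e \<cdot> f \<in> carrier S" "f \<cdot> e \<in> carrier S"
    using assms by (auto simp: mul_closed)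
  have i: "(e \<cdot> f) \<cdot> (e \<cdot> f) = e \<cdot> f" "(f \<cdot> e) \<cdot> (f \<cdot> e) = f \<cdot> e"
    using assms idem_mul_idem by auto
  have ee: "e \<cdot> (e \<cdot> z) = e \<cdot> z" and ff: "f \<cdot> (f \<cdot> z) = f \<cdot> z" if "z \<in> carrier S" for z
    using assms that by (metis mul_assoc)+
  have "f \<cdot> e = sinv S (e \<cdot> f)"
    using i ef assms by (intro sinv_unique) (simp_all add: mul_assoc mul_closed ee ff)
  then show ?thesis using sinv_idem[OF ef(1) i(1)] by simp
qed

lemma mul_sinv_idem: "x \<in> carrier S \<Longrightarrow> x \<cdot> sinv S x \<cdot> (x \<cdot> sinv S x) = x \<cdot> sinv S x"
  by (metis mul_assoc mul_closed mul_sinv_mul sinv_closed)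

lemma sinv_mul_idem: "x \<in> carrier S \<Longrightarrow> sinv S x \<cdot> x \<cdot> (sinv S x \<cdot> x) = sinv S x \<cdot> x"
  by (metis mul_assoc mul_closed mul_sinv_mul sinv_closed)

lemma sinv_mul_commute:
  assumes "x \<in> carrier S" "y \<in> carrier S"
  shows "sinv S x \<cdot> x \<cdot> (y \<cdot> sinv S y) = y \<cdot> sinv S y \<cdot> (sinv S x \<cdot> x)"
  using assms by (intro idem_commute) (auto simp: mul_closed sinv_closed mul_sinv_idem sinv_mul_idem)

lemma sinv_mul:
  assumes "x \<in> carrier S" "y \<in> carrier S"
  shows "sinv S (x \<cdot> y) = sinv S y \<cdot> sinv S x"
proof (rule sinv_unique[symmetric])
  note c = assms mul_closed sinv_closed
  have comm: "sinv S x \<cdot> x \<cdot> (y \<cdot> sinv S y) = y \<cdot> sinv S y \<cdot> (sinv S x \<cdot> x)"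
    using assms by (rule sinv_mul_commute)
  have "x \<cdot> y \<cdot> (sinv S y \<cdot> sinv S x) \<cdot> (x \<cdot> y) = x \<cdot> (y \<cdot> sinv S y \<cdot> (sinv S x \<cdot> x)) \<cdot> y"
    by (simp add: c mul_assoc)
  also have "\<dots> = (x \<cdot> sinv S x \<cdot> x) \<cdot> (y \<cdot> sinv S y \<cdot> y)"
    unfolding comm[symmetric] by (simp add: c mul_assoc)
  finally show "x \<cdot> y \<cdot> (sinv S y \<cdot> sinv S x) \<cdot> (x \<cdot> y) = x \<cdot> y"
    by (simp add: c mul_sinv_mul)
  have "sinv S y \<cdot> sinv S x \<cdot> (x \<cdot> y) \<cdot> (sinv S y \<cdot> sinv S x)
      = sinv S y \<cdot> (sinv S x \<cdot> x \<cdot> (y \<cdot> sinv S y)) \<cdot> sinv S x"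
    by (simp add: c mul_assoc)
  also have "\<dots> = (sinv S y \<cdot> y \<cdot> sinv S y) \<cdot> (sinv S x \<cdot> x \<cdot> sinv S x)"
    unfolding comm by (simp add: c mul_assoc)
  finally show "sinv S y \<cdot> sinv S x \<cdot> (x \<cdot> y) \<cdot> (sinv S y \<cdot> sinv S x) = sinv S y \<cdot> sinv S x"
    by (simp add: c sinv_mul_sinv)
qed (use assms in \<open>auto simp: mul_closed sinv_closed\<close>)

end

text \<open>An action on an arbitrary point set, so that cosets, tagged points of disjoint unions
  and elements of \<open>A\<close> itself can serve as points; \<open>rep_transfer\<close> numbers
  them afterwards.\<close>

definition rep :: "'a inv_alg \<Rightarrow> 'b set \<Rightarrow> ('a \<Rightarrow> ('b \<times> 'b) set) \<Rightarrow> bool" where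
  "rep A P \<tau> \<longleftrightarrow> (\<forall>x\<in>carrier A. \<tau> x \<subseteq> P \<times> P \<and> single_valued (\<tau> x) \<and> single_valued ((\<tau> x)\<inverse>) \<and>
     (\<forall>y\<in>carrier A. \<tau> (x \<cdot>\<^bsub>A\<^esub> y) = \<tau> x O \<tau> y) \<and> \<tau> (sinv A x) = (\<tau> x)\<inverse>)"

section \<open>Finite symmetric inverse semigroups\<close>

lemma sym_inv_sel [simp]:
  "mul (sym_inv n) = (O)" "sinv (sym_inv n) = converse"
  by (auto simp: sym_inv_def)

lemma carrier_sym_inv:
  "r \<in> carrier (sym_inv n) \<longleftrightarrow> r \<subseteq> {1..n} \<times> {1..n} \<and> single_valued r \<and> single_valued (r\<inverse>)"
  by (simp add: sym_inv_def)

lemma finite_carrier_sym_inv [simp]: "finite (carrier (sym_inv n))"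
proof (rule finite_subset)
  show "carrier (sym_inv n) \<subseteq> Pow ({1..n} \<times> {1..n})" using carrier_sym_inv by blast
qed simp

lemma inverse_semigroup_sym_inv [simp]: "inverse_semigroup (sym_inv n)"
proof
  show "carrier (sym_inv n) \<noteq> {}"
    using carrier_sym_inv[of "{}" n] by auto
next
  fix x y assume "x \<in> carrier (sym_inv n)" "y \<in> carrier (sym_inv n)"
  then show "x \<cdot>\<^bsub>sym_inv n\<^esub> y \<in> carrier (sym_inv n)"
    by (auto simp: carrier_sym_inv single_valued_relcomp converse_relcomp)
next
  fix x y
  assume x: "x \<in> carrier (sym_inv n)" and y: "y \<in> carrier (sym_inv n)"
    and xyx: "x \<cdot>\<^bsub>sym_inv n\<^esub> y \<cdot>\<^bsub>sym_inv n\<^esub> x = x" and yxy: "y \<cdot>\<^bsub>sym_inv n\<^esub> x \<cdot>\<^bsub>sym_inv n\<^esub> y = y"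
  \<comment> \<open>A pair of \<open>r\<close> is also reached by a path \<open>a\<close>,
    \<open>c\<close>, \<open>d\<close>, \<open>b\<close>; single-valuedness of \<open>r\<close> and
    of its converse gives \<open>c = b\<close> and \<open>d = a\<close>.\<close>
  have *: "r \<subseteq> s\<inverse>" if "r O s O r = r" "single_valued r" "single_valued (r\<inverse>)"
    for r s :: "(nat \<times> nat) set"
  proof (rule subrelI)
    fix a b assume ab: "(a, b) \<in> r"
    then have "(a, b) \<in> r O s O r" using that by simp
    then obtain c d where "(a, c) \<in> r" "(c, d) \<in> s" "(d, b) \<in> r" by auto
    then show "(a, b) \<in> s\<inverse>" using ab that by (metis converse_iff single_valuedD)
  qed
  have "y \<subseteq> x\<inverse>" using *[of y x] x y yxy by (auto simp: carrier_sym_inv O_assoc)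
  moreover have "x \<subseteq> y\<inverse>" using *[of x y] x y xyx by (auto simp: carrier_sym_inv O_assoc)
  ultimately show "y = sinv (sym_inv n) x" by auto
next
  fix x assume "x \<in> carrier (sym_inv n)"
  then show "sinv (sym_inv n) x \<in> carrier (sym_inv n)" by (fastforce simp: carrier_sym_inv)
qed (auto simp: carrier_sym_inv single_valued_def)

lemma finite_inverse_semigroup_sym_inv [simp]: "finite_inverse_semigroup (sym_inv n)"
  by (simp add: finite_inverse_semigroup_def)

lemma sym_inv_closed:
  "\<lbrakk>x \<in> carrier (sym_inv n); y \<in> carrier (sym_inv n)\<rbrakk> \<Longrightarrow> x O y \<in> carrier (sym_inv n)"
  "x \<in> carrier (sym_inv n) \<Longrightarrow> x\<inverse> \<in> carrier (sym_inv n)"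
  using inverse_semigroup.mul_closed[OF inverse_semigroup_sym_inv, of x n y]
    inverse_semigroup.sinv_closed[OF inverse_semigroup_sym_inv, of x n] by auto

lemma homs_sym_inv: "\<rho> \<in> homs A (sym_inv m) \<longleftrightarrow> rep A {1..m} \<rho>"
  by (auto simp: homs_def rep_def image_subset_iff carrier_sym_inv)

lemma sym_inv_mono: "m \<le> n \<Longrightarrow> carrier (sym_inv m) \<subseteq> carrier (sym_inv n)"
  by (fastforce simp: carrier_sym_inv)

lemma embeddings_sym_inv_mono:
  "\<lbrakk>f \<in> embeddings A (sym_inv m); m \<le> n\<rbrakk> \<Longrightarrow> f \<in> embeddings A (sym_inv n)"
  using sym_inv_mono[of m n] by (auto simp: embeddings_def homs_def)

section \<open>Substructures, embeddings and isomorphisms\<close>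

lemma inverse_semigroup_substructure:
  assumes "inverse_semigroup S" "inverse_subsemigroup H S"
  shows "inverse_semigroup (S\<lparr>carrier := H\<rparr>)"
proof -
  interpret inverse_semigroup S by fact
  have "x \<in> carrier S" if "x \<in> H" for x
    using assms(2) that by (auto simp: inverse_subsemigroup_def)
  then show ?thesis
    using assms(2) unfolding inverse_subsemigroup_def
    by unfold_locales (simp_all add: mul_assoc, simp_all add: mul_sinv_mul sinv_mul_sinv sinv_unique flip: mul_assoc)
qed

lemma inverse_subsemigroup_carrier: "inverse_semigroup S \<Longrightarrow> inverse_subsemigroup (carrier S) S"
  by (auto simp: inverse_subsemigroup_def inverse_semigroup_def)

lemma homsD:
  assumes "f \<in> homs A B"
  shows "x \<in> carrier A \<Longrightarrow> f x \<in> carrier B"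
    and "\<lbrakk>x \<in> carrier A; y \<in> carrier A\<rbrakk> \<Longrightarrow> f (x \<cdot>\<^bsub>A\<^esub> y) = f x \<cdot>\<^bsub>B\<^esub> f y"
    and "x \<in> carrier A \<Longrightarrow> f (sinv A x) = sinv B (f x)"
  using assms by (auto simp: homs_def)

lemma embeddingsD:
  assumes "f \<in> embeddings A B"
  shows "x \<in> carrier A \<Longrightarrow> f x \<in> carrier B"
    and "\<lbrakk>x \<in> carrier A; y \<in> carrier A\<rbrakk> \<Longrightarrow> f (x \<cdot>\<^bsub>A\<^esub> y) = f x \<cdot>\<^bsub>B\<^esub> f y"
    and "x \<in> carrier A \<Longrightarrow> f (sinv A x) = sinv B (f x)"
    and "\<lbrakk>x \<in> carrier A; y \<in> carrier A\<rbrakk> \<Longrightarrow> f x = f y \<longleftrightarrow> x = y"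
    and "inj_on f (carrier A)"
    and "f \<in> homs A B"
  using assms by (auto simp: embeddings_def homs_def inj_on_eq_iff)

lemma embeddings_cong:
  assumes "inverse_semigroup A" "f \<in> embeddings A B" "\<And>x. x \<in> carrier A \<Longrightarrow> g x = f x"
  shows "g \<in> embeddings A B"
  using assms inverse_semigroup.mul_closed[OF assms(1)] inverse_semigroup.sinv_closed[OF assms(1)]
  by (auto simp: embeddings_def homs_def inj_on_def)

lemma homs_comp: "\<lbrakk>f \<in> homs A B; g \<in> homs B C\<rbrakk> \<Longrightarrow> (\<lambda>x. g (f x)) \<in> homs A C"
  by (auto simp: homs_def image_subset_iff)

lemma embeddings_comp: "\<lbrakk>f \<in> embeddings A B; g \<in> embeddings B C\<rbrakk> \<Longrightarrow> (\<lambda>x. g (f x)) \<in> embeddings A C"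
  unfolding embeddings_def by (auto intro: homs_comp simp: inj_on_def homs_def image_subset_iff)

lemma isos_embeddings: "f \<in> isos A B \<Longrightarrow> f \<in> embeddings A B"
  by (auto simp: isos_def embeddings_def bij_betw_def)

lemma isos_surj: "f \<in> isos A B \<Longrightarrow> f ` carrier A = carrier B"
  by (auto simp: isos_def bij_betw_def)

lemma isosI: "\<lbrakk>f \<in> embeddings A B; f ` carrier A = carrier B\<rbrakk> \<Longrightarrow> f \<in> isos A B"
  by (auto simp: isos_def embeddings_def bij_betw_def)

text \<open>\<open>h\<close> is \<open>f\<close> followed by the inverse of \<open>g\<close> on its
  image; the laws are checked after applying the injective \<open>g\<close>. With \<open>g\<close>
  the embedding of a stage, this pulls embeddings into a limit back to finite stages.\<close>

lemma embeddings_factor: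
  assumes A: "inverse_semigroup A" and B: "inverse_semigroup B"
    and f: "f \<in> embeddings A C" and g: "g \<in> embeddings B C"
    and sub: "f ` carrier A \<subseteq> g ` carrier B"
  shows "\<exists>h\<in>embeddings A B. \<forall>x\<in>carrier A. g (h x) = f x"
proof -
  interpret A: inverse_semigroup A by fact
  interpret B: inverse_semigroup B by fact
  define h where "h x = inv_into (carrier B) g (f x)" for x
  have h: "h x \<in> carrier B" "g (h x) = f x" if "x \<in> carrier A" for x
    using that sub by (auto simp: h_def inv_into_into f_inv_into_f image_subset_iff)
  have "h (x \<cdot>\<^bsub>A\<^esub> y) = h x \<cdot>\<^bsub>B\<^esub> h y" if "x \<in> carrier A" "y \<in> carrier A" for x y
  proof -
    have "g (h (x \<cdot>\<^bsub>A\<^esub> y)) = g (h x \<cdot>\<^bsub>B\<^esub> h y)"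
      using that h embeddingsD(2)[OF f] embeddingsD(2)[OF g] by (simp add: A.mul_closed)
    then show ?thesis
      using that h(1) embeddingsD(4)[OF g] by (meson A.mul_closed B.mul_closed)
  qed
  moreover have "h (sinv A x) = sinv B (h x)" if "x \<in> carrier A" for x
  proof -
    have "g (h (sinv A x)) = g (sinv B (h x))"
      using that h embeddingsD(3)[OF f] embeddingsD(3)[OF g] by (simp add: A.sinv_closed)
    then show ?thesis
      using that h(1) embeddingsD(4)[OF g] by (meson A.sinv_closed B.sinv_closed)
  qed
  moreover have "inj_on h (carrier A)"
    using h(2) embeddingsD(4)[OF f] by (metis inj_onI)
  ultimately have "h \<in> embeddings A B"
    using h(1) by (auto simp: embeddings_def homs_def)
  then show ?thesis using h(2) by auto
qed

lemma isos_sym: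
  assumes "inverse_semigroup A" "inverse_semigroup B" "f \<in> isos A B"
  shows "\<exists>g\<in>isos B A. (\<forall>x\<in>carrier A. g (f x) = x) \<and> (\<forall>y\<in>carrier B. f (g y) = y)"
proof -
  have id: "(\<lambda>y. y) \<in> embeddings B B" by (auto simp: embeddings_def homs_def)
  note f = isos_embeddings[OF assms(3)] isos_surj[OF assms(3)]
  obtain g where g: "g \<in> embeddings B A" "\<forall>y\<in>carrier B. f (g y) = y"
    using embeddings_factor[OF assms(2,1) id f(1)] f(2) by auto
  have *: "g (f x) = x" if "x \<in> carrier A" for x
    using that g f embeddingsD(1,4)[OF f(1)] embeddingsD(1)[OF g(1)] by metis
  have "g ` carrier B = carrier A"
    using * embeddingsD(1)[OF g(1)] embeddingsD(1)[OF f(1)] by force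
  then show ?thesis using g * by (auto intro: isosI)
qed

lemma isos_comp: "\<lbrakk>f \<in> isos A B; g \<in> isos B C\<rbrakk> \<Longrightarrow> (\<lambda>x. g (f x)) \<in> isos A C"
  by (rule isosI, blast intro: embeddings_comp isos_embeddings)
     (metis image_image isos_surj)

text \<open>A point fixed by \<open>h\<close> lies in the domain of \<open>h\<close>, so points at
  which nothing is defined count only when \<open>H\<close> is empty. Over all \<open>H\<close>
  these numbers are Burnside's marks.\<close>

definition mark :: "'b set \<Rightarrow> ('a \<Rightarrow> ('b \<times> 'b) set) \<Rightarrow> 'a set \<Rightarrow> nat" where
  "mark P \<tau> H = card {p \<in> P. \<forall>h\<in>H. (p, p) \<in> \<tau> h}"

section \<open>Renaming the points of an action along a bijection\<close>

lemma map_prod_relcomp: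
  assumes "inj_on b P" "r \<subseteq> P \<times> P" "s \<subseteq> P \<times> P"
  shows "map_prod b b ` (r O s) = map_prod b b ` r O map_prod b b ` s"
  using assms by (force simp: relcomp_unfold image_iff inj_on_def)

lemma map_prod_converse: "map_prod b b ` (r\<inverse>) = (map_prod b b ` r)\<inverse>"
  by (force simp: image_iff)

lemma map_prod_mem:
  assumes "inj_on b P" "r \<subseteq> P \<times> P" "p \<in> P" "q \<in> P"
  shows "(b p, b q) \<in> map_prod b b ` r \<longleftrightarrow> (p, q) \<in> r"
proof
  assume "(b p, b q) \<in> map_prod b b ` r"
  then obtain p' q' where *: "(p', q') \<in> r" "b p = b p'" "b q = b q'" by auto
  then have "p' \<in> P" "q' \<in> P" using assms(2) by auto
  then have "p = p'" "q = q'" using * assms by (auto dest: inj_onD)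
  then show "(p, q) \<in> r" using * by simp
qed (force simp: image_iff)

lemma map_prod_single_valued:
  assumes "inj_on b P" "r \<subseteq> P \<times> P" "single_valued r"
  shows "single_valued (map_prod b b ` r)"
proof (rule single_valuedI)
  fix x y z assume "(x, y) \<in> map_prod b b ` r" "(x, z) \<in> map_prod b b ` r"
  then obtain p q p' q' where "(p, q) \<in> r" "(p', q') \<in> r" "x = b p" "y = b q" "x = b p'" "z = b q'"
    by auto
  then show "y = z" using assms by (metis inj_onD mem_Sigma_iff single_valuedD subsetD)
qed

lemma rep_conj:
  assumes "rep A P \<tau>" "bij_betw b P Q"
  shows "rep A Q (\<lambda>x. map_prod b b ` \<tau> x)"
proof -
  have inj: "inj_on b P" and Q: "Q = b ` P" using assms(2) by (auto simp: bij_betw_def)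
  have "single_valued ((map_prod b b ` \<tau> x)\<inverse>)" if "x \<in> carrier A" for x
    unfolding map_prod_converse[symmetric]
    using assms(1) that by (intro map_prod_single_valued[OF inj]) (auto simp: rep_def)
  then show ?thesis
    using assms(1) map_prod_relcomp[OF inj] map_prod_single_valued[OF inj]
    unfolding rep_def Q by (auto 0 3 simp: map_prod_converse)
qed

lemma mark_conj:
  assumes "rep A P \<tau>" "bij_betw b P Q" "H \<subseteq> carrier A"
  shows "mark Q (\<lambda>x. map_prod b b ` \<tau> x) H = mark P \<tau> H"
proof -
  have inj: "inj_on b P" and Q: "Q = b ` P" using assms(2) by (auto simp: bij_betw_def)
  have sub: "\<tau> h \<subseteq> P \<times> P" if "h \<in> H" for h using assms that by (auto simp: rep_def)
  have "{q \<in> Q. \<forall>h\<in>H. (q, q) \<in> map_prod b b ` \<tau> h} = b ` {p \<in> P. \<forall>h\<in>H. (p, p) \<in> \<tau> h}"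
    unfolding Q by (auto simp: map_prod_mem[OF inj sub])
  moreover have "inj_on b {p \<in> P. \<forall>h\<in>H. (p, p) \<in> \<tau> h}"
    using inj by (auto intro: inj_on_subset)
  ultimately show ?thesis
    unfolding mark_def by (simp add: card_image)
qed

lemma inj_on_map_prod_image:
  assumes "rep A P \<tau>" "inj_on b P" "inj_on \<tau> (carrier A)"
  shows "inj_on (\<lambda>x. map_prod b b ` \<tau> x) (carrier A)"
proof (rule inj_onI)
  fix x y assume xy: "x \<in> carrier A" "y \<in> carrier A" "map_prod b b ` \<tau> x = map_prod b b ` \<tau> y"
  have "\<tau> x \<subseteq> P \<times> P" "\<tau> y \<subseteq> P \<times> P" using xy assms(1) by (auto simp: rep_def)
  then have "\<tau> x = \<tau> y"
    using inj_on_image_eq_iff[OF map_prod_inj_on[OF assms(2) assms(2)]] xy(3) by metis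
  then show "x = y" using assms(3) xy by (auto dest: inj_onD)
qed

lemma rep_transfer:
  assumes "rep A P \<tau>" "finite P"
  obtains m \<rho> where "\<rho> \<in> homs A (sym_inv m)"
    "\<And>H. H \<subseteq> carrier A \<Longrightarrow> mark {1..m} \<rho> H = mark P \<tau> H"
    "inj_on \<tau> (carrier A) \<Longrightarrow> inj_on \<rho> (carrier A)"
proof -
  obtain b where b: "bij_betw b P {1..card P}"
    using assms(2) by (metis bij_betw_iff_card card_atLeastAtMost diff_Suc_1 finite_atLeastAtMost)
  show thesis
  proof (rule that)
    show "(\<lambda>x. map_prod b b ` \<tau> x) \<in> homs A (sym_inv (card P))"
      unfolding homs_sym_inv using rep_conj[OF assms(1) b] .
  qed (use mark_conj[OF assms(1) b] inj_on_map_prod_image[OF assms(1)] b in \<open>auto simp: bij_betw_def\<close>)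
qed

text \<open>Right multiplication by \<open>b\<close> is in general not injective on
  \<open>A\<close>. It is so on the left ideal of those \<open>a\<close> that absorb the idempotent
  \<open>b b^-1\<close> on the right, and right multiplication by the inverse of \<open>b\<close>
  then undoes it.\<close>

theorem Wagner_Preston:
  assumes "finite_inverse_semigroup A"
  obtains m f where "f \<in> embeddings A (sym_inv m)"
proof -
  interpret inverse_semigroup A using assms by (simp add: finite_inverse_semigroup_def)
  note c = mul_closed sinv_closed
  let ?i = "sinv A"
  define \<tau> where "\<tau> b = {(a, a \<cdot>\<^bsub>A\<^esub> b) |a. a \<in> carrier A \<and> a \<cdot>\<^bsub>A\<^esub> (b \<cdot>\<^bsub>A\<^esub> ?i b) = a}" for b
  have inv_sub: "(\<tau> b)\<inverse> \<subseteq> \<tau> (?i b)" if b: "b \<in> carrier A" for b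
  proof
    fix z assume "z \<in> (\<tau> b)\<inverse>"
    then obtain a where a: "z = (a \<cdot>\<^bsub>A\<^esub> b, a)" "a \<in> carrier A" "a \<cdot>\<^bsub>A\<^esub> (b \<cdot>\<^bsub>A\<^esub> ?i b) = a"
      by (auto simp: \<tau>_def)
    have "a \<cdot>\<^bsub>A\<^esub> b \<cdot>\<^bsub>A\<^esub> (?i b \<cdot>\<^bsub>A\<^esub> ?i (?i b)) = a \<cdot>\<^bsub>A\<^esub> (b \<cdot>\<^bsub>A\<^esub> ?i b \<cdot>\<^bsub>A\<^esub> b)"
      using a b by (simp add: c mul_assoc sinv_sinv)
    moreover have "a \<cdot>\<^bsub>A\<^esub> b \<cdot>\<^bsub>A\<^esub> ?i b = a" using a b by (simp add: c mul_assoc)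
    ultimately show "z \<in> \<tau> (?i b)"
      unfolding \<tau>_def using a b by (auto simp: c mul_sinv_mul intro!: exI[of _ "a \<cdot>\<^bsub>A\<^esub> b"])
  qed
  have inv: "\<tau> (?i b) = (\<tau> b)\<inverse>" if "b \<in> carrier A" for b
    using inv_sub[OF that] inv_sub[of "?i b"] that by (auto simp: c sinv_sinv)
  have sv: "single_valued (\<tau> b)" for b by (auto simp: \<tau>_def single_valued_def)
  have comp: "\<tau> (b \<cdot>\<^bsub>A\<^esub> d) = \<tau> b O \<tau> d" if b: "b \<in> carrier A" and d: "d \<in> carrier A" for b d
  proof -
    \<comment> \<open>The two sides are the domain conditions of \<open>\<tau> (b \<cdot> d)\<close>
      and of \<open>\<tau> b O \<tau> d\<close>. Reaching \<open>?N\<close> requires that the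
      idempotents \<open>?i b \<cdot> b\<close> and \<open>d \<cdot> ?i d\<close> commute.\<close>
    have *: "a \<cdot>\<^bsub>A\<^esub> (b \<cdot>\<^bsub>A\<^esub> d \<cdot>\<^bsub>A\<^esub> ?i (b \<cdot>\<^bsub>A\<^esub> d)) = a \<longleftrightarrow>
        a \<cdot>\<^bsub>A\<^esub> (b \<cdot>\<^bsub>A\<^esub> ?i b) = a \<and> a \<cdot>\<^bsub>A\<^esub> b \<cdot>\<^bsub>A\<^esub> (d \<cdot>\<^bsub>A\<^esub> ?i d) = a \<cdot>\<^bsub>A\<^esub> b"
      (is "?L \<longleftrightarrow> ?M \<and> ?N") if a: "a \<in> carrier A" for a
    proof
      assume ?L
      then have L: "a \<cdot>\<^bsub>A\<^esub> (b \<cdot>\<^bsub>A\<^esub> (d \<cdot>\<^bsub>A\<^esub> (?i d \<cdot>\<^bsub>A\<^esub> ?i b))) = a"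
        using a b d by (simp add: c mul_assoc sinv_mul)
      have "a \<cdot>\<^bsub>A\<^esub> (b \<cdot>\<^bsub>A\<^esub> ?i b) = a \<cdot>\<^bsub>A\<^esub> (b \<cdot>\<^bsub>A\<^esub> (d \<cdot>\<^bsub>A\<^esub> (?i d \<cdot>\<^bsub>A\<^esub> ?i b))) \<cdot>\<^bsub>A\<^esub> (b \<cdot>\<^bsub>A\<^esub> ?i b)"
        using L by simp
      also have "\<dots> = a \<cdot>\<^bsub>A\<^esub> (b \<cdot>\<^bsub>A\<^esub> (d \<cdot>\<^bsub>A\<^esub> (?i d \<cdot>\<^bsub>A\<^esub> (?i b \<cdot>\<^bsub>A\<^esub> b \<cdot>\<^bsub>A\<^esub> ?i b))))"
        using a b d by (simp add: c mul_assoc)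
      also have "\<dots> = a" using L b by (simp add: sinv_mul_sinv)
      finally have M: ?M .
      have "a \<cdot>\<^bsub>A\<^esub> b = a \<cdot>\<^bsub>A\<^esub> (b \<cdot>\<^bsub>A\<^esub> (d \<cdot>\<^bsub>A\<^esub> (?i d \<cdot>\<^bsub>A\<^esub> ?i b))) \<cdot>\<^bsub>A\<^esub> b" using L by simp
      also have "\<dots> = a \<cdot>\<^bsub>A\<^esub> (b \<cdot>\<^bsub>A\<^esub> (d \<cdot>\<^bsub>A\<^esub> ?i d \<cdot>\<^bsub>A\<^esub> (?i b \<cdot>\<^bsub>A\<^esub> b)))"
        using a b d by (simp add: c mul_assoc)
      also have "\<dots> = a \<cdot>\<^bsub>A\<^esub> (b \<cdot>\<^bsub>A\<^esub> ?i b \<cdot>\<^bsub>A\<^esub> b) \<cdot>\<^bsub>A\<^esub> (d \<cdot>\<^bsub>A\<^esub> ?i d)"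
        unfolding sinv_mul_commute[OF b d, symmetric] using a b d by (simp add: c mul_assoc)
      finally have ?N using b by (simp add: mul_sinv_mul)
      with M show "?M \<and> ?N" ..
    next
      assume MN: "?M \<and> ?N"
      have "a \<cdot>\<^bsub>A\<^esub> (b \<cdot>\<^bsub>A\<^esub> d \<cdot>\<^bsub>A\<^esub> ?i (b \<cdot>\<^bsub>A\<^esub> d)) = a \<cdot>\<^bsub>A\<^esub> b \<cdot>\<^bsub>A\<^esub> (d \<cdot>\<^bsub>A\<^esub> ?i d) \<cdot>\<^bsub>A\<^esub> ?i b"
        using a b d by (simp add: c mul_assoc sinv_mul)
      also have "\<dots> = a" using MN a b by (simp add: c mul_assoc)
      finally show ?L .
    qed
    show ?thesis
    proof (rule Set.set_eqI)
      fix z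
      show "z \<in> \<tau> (b \<cdot>\<^bsub>A\<^esub> d) \<longleftrightarrow> z \<in> \<tau> b O \<tau> d"
        using * b d by (cases z) (auto simp: \<tau>_def relcomp_unfold c mul_assoc)
    qed
  qed
  have rep: "rep A (carrier A) \<tau>"
    unfolding rep_def
  proof (intro ballI conjI)
    fix x assume "x \<in> carrier A"
    then show "\<tau> x \<subseteq> carrier A \<times> carrier A" by (auto simp: \<tau>_def c)
    show "single_valued ((\<tau> x)\<inverse>)" using sv inv \<open>x \<in> carrier A\<close> by metis
  qed (use sv comp inv in auto)
  have inj: "inj_on \<tau> (carrier A)"
  proof (rule inj_onI)
    \<comment> \<open>Both maps are evaluated at the point \<open>?i x\<close>. With the roles
      exchanged \<open>y\<close> equals \<open>?f \<cdot> x\<close>, and commuting \<open>?e\<close>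
      with \<open>?f\<close> then gives \<open>x = y\<close>.\<close>
    have *: "x = x \<cdot>\<^bsub>A\<^esub> ?i x \<cdot>\<^bsub>A\<^esub> y" if "x \<in> carrier A" "y \<in> carrier A" "\<tau> x = \<tau> y" for x y
    proof -
      have "(?i x, ?i x \<cdot>\<^bsub>A\<^esub> x) \<in> \<tau> x"
        using that(1) by (auto simp: \<tau>_def c mul_assoc[symmetric] sinv_mul_sinv)
      then have "?i x \<cdot>\<^bsub>A\<^esub> x = ?i x \<cdot>\<^bsub>A\<^esub> y" unfolding \<open>\<tau> x = \<tau> y\<close> by (auto simp: \<tau>_def)
      then show ?thesis using that by (metis c(2) mul_assoc mul_sinv_mul)
    qed
    fix x y assume xy: "x \<in> carrier A" "y \<in> carrier A" "\<tau> x = \<tau> y"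
    let ?e = "x \<cdot>\<^bsub>A\<^esub> ?i x" and ?f = "y \<cdot>\<^bsub>A\<^esub> ?i y"
    have comm: "?e \<cdot>\<^bsub>A\<^esub> ?f = ?f \<cdot>\<^bsub>A\<^esub> ?e"
      using xy by (intro idem_commute) (simp_all add: c mul_sinv_idem)
    have "x = ?e \<cdot>\<^bsub>A\<^esub> (?f \<cdot>\<^bsub>A\<^esub> x)" using * xy by metis
    also have "\<dots> = ?e \<cdot>\<^bsub>A\<^esub> ?f \<cdot>\<^bsub>A\<^esub> x" using xy by (simp add: c mul_assoc)
    also have "\<dots> = ?f \<cdot>\<^bsub>A\<^esub> (?e \<cdot>\<^bsub>A\<^esub> x)" unfolding comm using xy by (simp add: c mul_assoc)
    also have "\<dots> = ?f \<cdot>\<^bsub>A\<^esub> x" using xy by (simp add: mul_sinv_mul)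
    also have "\<dots> = y" using *[of y x] xy by simp
    finally show "x = y" .
  qed
  show thesis
    using rep_transfer[OF rep] assms inj that
    by (metis (no_types, lifting) CollectI embeddings_def finite_inverse_semigroup_def)
qed

section \<open>Stabilizers, orbits and Burnside's theorem\<close>

lemma repD:
  assumes "rep A P \<tau>" "x \<in> carrier A"
  shows "\<tau> x \<subseteq> P \<times> P" "single_valued (\<tau> x)" "single_valued ((\<tau> x)\<inverse>)"
    and "y \<in> carrier A \<Longrightarrow> \<tau> (x \<cdot>\<^bsub>A\<^esub> y) = \<tau> x O \<tau> y"
    and "\<tau> (sinv A x) = (\<tau> x)\<inverse>"
  using assms by (auto simp: rep_def)

definition stab :: "'a inv_alg \<Rightarrow> ('a \<Rightarrow> ('b \<times> 'b) set) \<Rightarrow> 'b \<Rightarrow> 'a set" where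
  "stab A \<tau> p = {x \<in> carrier A. (p, p) \<in> \<tau> x}"

lemma stab_inverse_subsemigroup:
  assumes "inverse_semigroup A" "rep A P \<tau>" "x \<in> stab A \<tau> p"
  shows "inverse_subsemigroup (stab A \<tau> p) A"
  using assms inverse_semigroup.mul_closed[OF assms(1)] inverse_semigroup.sinv_closed[OF assms(1)]
  by (auto simp: inverse_subsemigroup_def stab_def repD)

lemma rep_relcomp_converse:
  assumes "inverse_semigroup A" "rep A P \<tau>" "y \<in> carrier A" "z \<in> carrier A" "(u, p) \<in> \<tau> y" "(v, p) \<in> \<tau> z"
  shows "y \<cdot>\<^bsub>A\<^esub> sinv A z \<in> carrier A" "(u, v) \<in> \<tau> (y \<cdot>\<^bsub>A\<^esub> sinv A z)"
  using assms inverse_semigroup.mul_closed[OF assms(1)] inverse_semigroup.sinv_closed[OF assms(1)]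
  by (auto simp: repD)

text \<open>The idempotent \<open>y y^-1\<close> fixes \<open>u\<close>, hence also
  \<open>v\<close>, so \<open>y\<close> is defined at \<open>v\<close>.\<close>

lemma stab_subset_defined:
  assumes A: "inverse_semigroup A" and \<rho>: "rep A P \<rho>" and \<sigma>: "rep A Q \<sigma>"
    and sub: "stab A \<rho> u \<subseteq> stab A \<sigma> v"
    and y: "y \<in> carrier A" "(u, p) \<in> \<rho> y"
  shows "\<exists>p'. (v, p') \<in> \<sigma> y"
proof -
  have "y \<cdot>\<^bsub>A\<^esub> sinv A y \<in> stab A \<rho> u"
    using rep_relcomp_converse[OF A \<rho> y(1) y(1) y(2) y(2)] by (simp add: stab_def)
  then have "(v, v) \<in> \<sigma> (y \<cdot>\<^bsub>A\<^esub> sinv A y)" using sub by (auto simp: stab_def)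
  then show ?thesis
    using y(1) inverse_semigroup.sinv_closed[OF A y(1)] by (auto simp: repD[OF \<sigma>])
qed

text \<open>The element \<open>y x z^-1\<close> leads from \<open>u\<close> over \<open>p\<close>
  and \<open>q\<close> back to \<open>u\<close>. It therefore fixes \<open>v\<close> as well, and
  the path of \<open>v\<close> runs over \<open>p'\<close> and \<open>q'\<close>.\<close>

lemma stab_subset_equivariant:
  assumes A: "inverse_semigroup A" and \<rho>: "rep A P \<rho>" and \<sigma>: "rep A Q \<sigma>"
    and sub: "stab A \<rho> u \<subseteq> stab A \<sigma> v"
    and x: "x \<in> carrier A" "(p, q) \<in> \<rho> x"
    and y: "y \<in> carrier A" "(u, p) \<in> \<rho> y" "(v, p') \<in> \<sigma> y"
    and z: "z \<in> carrier A" "(u, q) \<in> \<rho> z" "(v, q') \<in> \<sigma> z"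
  shows "(p', q') \<in> \<sigma> x"
proof -
  interpret inverse_semigroup A by fact
  have "(u, q) \<in> \<rho> (y \<cdot>\<^bsub>A\<^esub> x)" using x y by (auto simp: repD[OF \<rho>])
  then have "y \<cdot>\<^bsub>A\<^esub> x \<cdot>\<^bsub>A\<^esub> sinv A z \<in> stab A \<rho> u"
    using rep_relcomp_converse[OF A \<rho> _ z(1) _ z(2)] x y by (auto simp: stab_def mul_closed)
  then have "(v, v) \<in> \<sigma> (y \<cdot>\<^bsub>A\<^esub> x \<cdot>\<^bsub>A\<^esub> sinv A z)" using sub by (auto simp: stab_def)
  then obtain s t where "(v, s) \<in> \<sigma> y" "(s, t) \<in> \<sigma> x" "(v, t) \<in> \<sigma> z"
    using x y z by (auto simp: repD[OF \<sigma>] mul_closed sinv_closed)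
  then show ?thesis
    using y z repD(2)[OF \<sigma>] by (metis single_valuedD)
qed

definition invariant :: "'a inv_alg \<Rightarrow> ('a \<Rightarrow> ('b \<times> 'b) set) \<Rightarrow> 'b set \<Rightarrow> bool" where
  "invariant A \<tau> U \<longleftrightarrow> (\<forall>x\<in>carrier A. \<forall>(p, q)\<in>\<tau> x. p \<in> U \<longleftrightarrow> q \<in> U)"

lemma invariantD: "\<lbrakk>invariant A \<tau> U; x \<in> carrier A; (p, q) \<in> \<tau> x\<rbrakk> \<Longrightarrow> p \<in> U \<longleftrightarrow> q \<in> U"
  by (auto simp: invariant_def)

text \<open>For an action of an inverse semigroup, \<open>u\<close> belongs to its own orbit exactly
  when some element is defined at \<open>u\<close>; otherwise the orbit is empty.\<close>

definition orbit :: "'a inv_alg \<Rightarrow> ('a \<Rightarrow> ('b \<times> 'b) set) \<Rightarrow> 'b \<Rightarrow> 'b set" where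
  "orbit A \<tau> u = {p. \<exists>x\<in>carrier A. (u, p) \<in> \<tau> x}"

lemma invariant_orbit:
  assumes A: "inverse_semigroup A" and \<tau>: "rep A P \<tau>"
  shows "invariant A \<tau> (orbit A \<tau> u)"
proof -
  interpret inverse_semigroup A by fact
  have "(u, q) \<in> \<tau> (y \<cdot>\<^bsub>A\<^esub> x)" if "x \<in> carrier A" "y \<in> carrier A" "(p, q) \<in> \<tau> x" "(u, p) \<in> \<tau> y" for x y p q
    using that by (auto simp: repD[OF \<tau>])
  moreover have "(u, p) \<in> \<tau> (y \<cdot>\<^bsub>A\<^esub> sinv A x)" if "x \<in> carrier A" "y \<in> carrier A" "(p, q) \<in> \<tau> x" "(u, q) \<in> \<tau> y" for x y p q
    using that by (auto simp: repD[OF \<tau>] sinv_closed)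
  ultimately show ?thesis
    unfolding invariant_def orbit_def by (auto, (meson mul_closed sinv_closed)+)
qed

lemma orbit_subset: "invariant A \<tau> U \<Longrightarrow> u \<in> U \<Longrightarrow> orbit A \<tau> u \<subseteq> U"
  by (auto simp: invariant_def orbit_def)

lemma invariant_Diff: "\<lbrakk>invariant A \<tau> U; invariant A \<tau> V\<rbrakk> \<Longrightarrow> invariant A \<tau> (U - V)"
  by (fastforce simp: invariant_def)

definition equivariant :: "'a inv_alg \<Rightarrow> 'b set \<Rightarrow> ('a \<Rightarrow> ('b \<times> 'b) set) \<Rightarrow> ('a \<Rightarrow> ('c \<times> 'c) set) \<Rightarrow> ('b \<Rightarrow> 'c) \<Rightarrow> bool"
  where "equivariant A U \<rho> \<sigma> \<beta> \<longleftrightarrow>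
    (\<forall>x\<in>carrier A. \<forall>p\<in>U. \<forall>q\<in>U. (p, q) \<in> \<rho> x \<longleftrightarrow> (\<beta> p, \<beta> q) \<in> \<sigma> x)"

text \<open>The bijection sends the point reached from \<open>u\<close> by \<open>y\<close> to the
  point reached from \<open>v\<close> by \<open>y\<close>; equality of the stabilizers makes this
  independent of \<open>y\<close>.\<close>

lemma orbit_equivariant_bij:
  assumes A: "inverse_semigroup A" and \<rho>: "rep A P \<rho>" and \<sigma>: "rep A Q \<sigma>"
    and st: "stab A \<rho> u = stab A \<sigma> v"
  shows "\<exists>\<beta>. bij_betw \<beta> (orbit A \<rho> u) (orbit A \<sigma> v) \<and> equivariant A (orbit A \<rho> u) \<rho> \<sigma> \<beta>"
proof -
  note dom = stab_subset_defined[OF A \<rho> \<sigma>, of u v] stab_subset_defined[OF A \<sigma> \<rho>, of v u]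
  note equi = stab_subset_equivariant[OF A \<rho> \<sigma>, of u v] stab_subset_equivariant[OF A \<sigma> \<rho>, of v u]
  have "\<forall>p\<in>orbit A \<rho> u. \<exists>p' y. y \<in> carrier A \<and> (u, p) \<in> \<rho> y \<and> (v, p') \<in> \<sigma> y"
    using dom(1) st unfolding orbit_def by blast
  then obtain \<beta> w where \<beta>: "\<And>p. p \<in> orbit A \<rho> u \<Longrightarrow> w p \<in> carrier A \<and> (u, p) \<in> \<rho> (w p) \<and> (v, \<beta> p) \<in> \<sigma> (w p)"
    by metis
  have eq: "(p, q) \<in> \<rho> x \<longleftrightarrow> (\<beta> p, \<beta> q) \<in> \<sigma> x"
    if "x \<in> carrier A" "p \<in> orbit A \<rho> u" "q \<in> orbit A \<rho> u" for x p q
    using equi[where x = x and y = "w p" and z = "w q"] st that \<beta> by blast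
  \<comment> \<open>The idempotent \<open>?x\<close> fixes \<open>p\<close>, so by equivariance it
    takes \<open>p'\<close> to \<open>\<beta> p\<close>; but it also fixes
    \<open>p'\<close>.\<close>
  have same: "\<beta> p = p'" if "y \<in> carrier A" "(u, p) \<in> \<rho> y" "(v, p') \<in> \<sigma> y" for p p' y
  proof -
    have p: "p \<in> orbit A \<rho> u" using that by (auto simp: orbit_def)
    let ?x = "sinv A y \<cdot>\<^bsub>A\<^esub> y"
    have x: "?x \<in> carrier A" "(p, p) \<in> \<rho> ?x" "(p', p') \<in> \<sigma> ?x"
      using that A by (auto simp: repD[OF \<rho>] repD[OF \<sigma>] inverse_semigroup.mul_closed inverse_semigroup.sinv_closed)
    have "(p', \<beta> p) \<in> \<sigma> ?x"
      using equi(1)[OF _ x(1,2) that, of "w p" "\<beta> p"] \<beta>[OF p] st by blast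
    then show ?thesis using x repD(2)[OF \<sigma> x(1)] by (metis single_valuedD)
  qed
  have "inj_on \<beta> (orbit A \<rho> u)"
  proof (rule inj_onI)
    fix p q assume pq: "p \<in> orbit A \<rho> u" "q \<in> orbit A \<rho> u" "\<beta> p = \<beta> q"
    let ?x = "sinv A (w p) \<cdot>\<^bsub>A\<^esub> w p"
    have x: "?x \<in> carrier A" "(p, p) \<in> \<rho> ?x" "(\<beta> p, \<beta> q) \<in> \<sigma> ?x"
      using \<beta>[OF pq(1)] pq(3) A
      by (auto simp: repD[OF \<rho>] repD[OF \<sigma>] inverse_semigroup.mul_closed inverse_semigroup.sinv_closed)
    then have "(p, q) \<in> \<rho> ?x" using eq pq by blast
    then show "p = q" using x repD(2)[OF \<rho> x(1)] by (metis single_valuedD)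
  qed
  moreover have "\<beta> ` orbit A \<rho> u = orbit A \<sigma> v"
  proof
    show "\<beta> ` orbit A \<rho> u \<subseteq> orbit A \<sigma> v"
      using \<beta> unfolding orbit_def[of A \<sigma>] by blast
    show "orbit A \<sigma> v \<subseteq> \<beta> ` orbit A \<rho> u"
    proof
      fix p' assume "p' \<in> orbit A \<sigma> v"
      then obtain y where y: "y \<in> carrier A" "(v, p') \<in> \<sigma> y" by (auto simp: orbit_def)
      then obtain p where "(u, p) \<in> \<rho> y" using dom(2) st by blast
      then show "p' \<in> \<beta> ` orbit A \<rho> u" using same[of y p p'] y by (force simp: orbit_def)
    qed
  qed
  ultimately show ?thesis
    using eq by (auto simp: bij_betw_def equivariant_def)
qed

lemma mark_equivariant:
  assumes "bij_betw \<beta> U V" "equivariant A U \<rho> \<sigma> \<beta>" "H \<subseteq> carrier A"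
  shows "mark U \<rho> H = mark V \<sigma> H"
  unfolding mark_def
proof (rule bij_betw_same_card)
  show "bij_betw \<beta> {p \<in> U. \<forall>h\<in>H. (p, p) \<in> \<rho> h} {p \<in> V. \<forall>h\<in>H. (p, p) \<in> \<sigma> h}"
    using assms unfolding bij_betw_def equivariant_def subset_iff
    by (auto intro: inj_on_subset intro!: imageI)
qed

lemma mark_Diff:
  assumes "finite U" "V \<subseteq> U"
  shows "mark (U - V) \<tau> H = mark U \<tau> H - mark V \<tau> H"
proof -
  have "{p \<in> U - V. \<forall>h\<in>H. (p, p) \<in> \<tau> h} =
      {p \<in> U. \<forall>h\<in>H. (p, p) \<in> \<tau> h} - {p \<in> V. \<forall>h\<in>H. (p, p) \<in> \<tau> h}" by auto
  then show ?thesis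
    unfolding mark_def using assms by (simp add: card_Diff_subset finite_subset Collect_mono_iff subset_iff)
qed

text \<open>
  This is Burnside's theorem on the table of marks. Among the inverse subsemigroups with a fixed
  point, a maximal one is the stabilizer of all its fixed points, on either side, and the orbits of
  two such points are isomorphic; remove them and continue.
\<close>

lemma equal_marks_equivariant_bij:
  assumes A: "inverse_semigroup A" "finite (carrier A)" and \<rho>: "rep A P \<rho>" and \<sigma>: "rep A Q \<sigma>"
  shows "\<lbrakk>finite U; finite V; invariant A \<rho> U; invariant A \<sigma> V;
    \<And>u. u \<in> U \<Longrightarrow> stab A \<rho> u \<noteq> {}; \<And>v. v \<in> V \<Longrightarrow> stab A \<sigma> v \<noteq> {};
    \<And>H. inverse_subsemigroup H A \<Longrightarrow> mark U \<rho> H = mark V \<sigma> H\<rbrakk>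
   \<Longrightarrow> \<exists>\<beta>. bij_betw \<beta> U V \<and> equivariant A U \<rho> \<sigma> \<beta>"
proof (induction "card U" arbitrary: U V rule: less_induct)
  case less
  \<comment> \<open>As the marks of both sides agree, one family serves for both: it contains the
    stabilizers of all points of \<open>U\<close> and of \<open>V\<close>.\<close>
  define fixing where "fixing = {H. inverse_subsemigroup H A \<and> mark U \<rho> H > 0}"
  have "fixing \<subseteq> Pow (carrier A)" by (auto simp: fixing_def inverse_subsemigroup_def)
  then have fin: "finite fixing" using A(2) by (meson finite_Pow_iff finite_subset)
  have stU: "stab A \<rho> u \<in> fixing" if "u \<in> U" for u
    using that less.prems(1,5) stab_inverse_subsemigroup[OF A(1) \<rho>, of _ u]
    by (fastforce simp: fixing_def mark_def card_gt_0_iff stab_def)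
  have stV: "stab A \<sigma> v \<in> fixing" if "v \<in> V" for v
  proof -
    have s: "inverse_subsemigroup (stab A \<sigma> v) A"
      using that less.prems(6) stab_inverse_subsemigroup[OF A(1) \<sigma>, of _ v] by blast
    moreover have "mark V \<sigma> (stab A \<sigma> v) > 0"
      using that less.prems(2) by (auto simp: mark_def card_gt_0_iff stab_def)
    ultimately show ?thesis using less.prems(7)[OF s] by (simp add: fixing_def)
  qed
  show ?case
  proof (cases "U = {}")
    case True
    then have "fixing = {}" by (auto simp: fixing_def mark_def)
    then have "V = {}" using stV by blast
    then show ?thesis using True by (auto simp: equivariant_def bij_betw_def)
  next
    case False
    then have "fixing \<noteq> {}" using stU by blast
    then obtain H where H: "H \<in> fixing" and max: "\<And>K. K \<in> fixing \<Longrightarrow> H \<subseteq> K \<Longrightarrow> K = H"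
      using finite_has_maximal[OF fin] by metis
    have Hs: "inverse_subsemigroup H A" "H \<subseteq> carrier A"
      using H by (auto simp: fixing_def inverse_subsemigroup_def)
    obtain u where u: "u \<in> U" "\<forall>h\<in>H. (u, u) \<in> \<rho> h"
      using H less.prems(1) by (auto simp: fixing_def mark_def card_gt_0_iff)
    have "mark V \<sigma> H > 0" using H less.prems(7)[OF Hs(1)] by (simp add: fixing_def)
    then obtain v where v: "v \<in> V" "\<forall>h\<in>H. (v, v) \<in> \<sigma> h"
      by (auto simp: mark_def card_gt_0_iff)
    have "stab A \<rho> u = H" using max[OF stU[OF u(1)]] u Hs by (auto simp: stab_def)
    moreover have "stab A \<sigma> v = H" using max[OF stV[OF v(1)]] v Hs by (auto simp: stab_def)
    ultimately obtain \<beta> where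
      \<beta>: "bij_betw \<beta> (orbit A \<rho> u) (orbit A \<sigma> v)" "equivariant A (orbit A \<rho> u) \<rho> \<sigma> \<beta>"
      using orbit_equivariant_bij[OF A(1) \<rho> \<sigma>] by metis
    let ?O = "orbit A \<rho> u" and ?O' = "orbit A \<sigma> v"
    have inv: "invariant A \<rho> ?O" "invariant A \<sigma> ?O'"
      using invariant_orbit[OF A(1) \<rho>] invariant_orbit[OF A(1) \<sigma>] by auto
    have sub: "?O \<subseteq> U" "?O' \<subseteq> V" using orbit_subset[OF less.prems(3) u(1)] orbit_subset[OF less.prems(4) v(1)] by auto
    have "u \<in> ?O"
      using u Hs unfolding orbit_def inverse_subsemigroup_def by blast
    then have "card (U - ?O) < card U" using u less.prems(1) by (metis DiffD2 Diff_subset psubsetI psubset_card_mono)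
    moreover have "mark (U - ?O) \<rho> K = mark (V - ?O') \<sigma> K" if "inverse_subsemigroup K A" for K
      using mark_Diff[OF less.prems(1) sub(1), of \<rho> K] mark_Diff[OF less.prems(2) sub(2), of \<sigma> K] less.prems(7)[OF that]
        mark_equivariant[OF \<beta>, of K] that by (simp add: inverse_subsemigroup_def)
    ultimately have "\<exists>\<gamma>. bij_betw \<gamma> (U - ?O) (V - ?O') \<and> equivariant A (U - ?O) \<rho> \<sigma> \<gamma>"
      using less.prems(1-6) inv by (intro less.hyps) (auto intro: invariant_Diff)
    then obtain \<gamma> where \<gamma>: "bij_betw \<gamma> (U - ?O) (V - ?O')" "equivariant A (U - ?O) \<rho> \<sigma> \<gamma>"
      by blast
    define \<delta> where "\<delta> p = (if p \<in> ?O then \<beta> p else \<gamma> p)" for p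
    have "bij_betw \<delta> (?O \<union> (U - ?O)) (?O' \<union> (V - ?O'))"
      unfolding \<delta>_def by (rule bij_betw_disjoint_Un[OF \<beta>(1) \<gamma>(1)]) auto
    then have bij: "bij_betw \<delta> U V" using sub by (simp add: Un_absorb1)
    moreover have "(p, q) \<in> \<rho> x \<longleftrightarrow> (\<delta> p, \<delta> q) \<in> \<sigma> x" if "x \<in> carrier A" "p \<in> U" "q \<in> U" for x p q
    proof -
      \<comment> \<open>No element relates a point of an orbit to a point outside it, on either
        side. Hence only pairs on which \<open>\<delta>\<close> is wholly \<open>\<beta>\<close> or
        wholly \<open>\<gamma>\<close> remain to be compared.\<close>
      have \<delta>O: "\<delta> r \<in> ?O' \<longleftrightarrow> r \<in> ?O" if "r \<in> U" for r
        using that \<beta>(1) \<gamma>(1) by (auto simp: \<delta>_def bij_betw_def)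
      have "p \<in> ?O \<longleftrightarrow> q \<in> ?O" if "(p, q) \<in> \<rho> x"
        using invariantD[OF inv(1) \<open>x \<in> carrier A\<close> that] .
      moreover have "p \<in> ?O \<longleftrightarrow> q \<in> ?O" if "(\<delta> p, \<delta> q) \<in> \<sigma> x"
        using invariantD[OF inv(2) \<open>x \<in> carrier A\<close> that] \<delta>O \<open>p \<in> U\<close> \<open>q \<in> U\<close> by blast
      moreover have "(p, q) \<in> \<rho> x \<longleftrightarrow> (\<delta> p, \<delta> q) \<in> \<sigma> x" if "p \<in> ?O \<longleftrightarrow> q \<in> ?O"
        using that \<open>x \<in> carrier A\<close> \<open>p \<in> U\<close> \<open>q \<in> U\<close> \<beta>(2) \<gamma>(2)
        by (auto simp: equivariant_def \<delta>_def)
      ultimately show ?thesis by blast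
    qed
    ultimately show ?thesis by (auto simp: equivariant_def)
  qed
qed

text \<open>Points at which nothing is defined do not affect the marks of inverse subsemigroups.
  Both actions live on the same finite set, so once the other points are matched, equally many such
  points are left on each side, and any bijection between them completes
  \<open>\<pi>\<close>.\<close>

theorem equal_marks_conjugate:
  assumes A: "inverse_semigroup A" "finite (carrier A)" and P: "finite P"
    and \<rho>: "rep A P \<rho>" and \<sigma>: "rep A P \<sigma>"
    and eq: "\<And>H. inverse_subsemigroup H A \<Longrightarrow> mark P \<rho> H = mark P \<sigma> H"
  shows "\<exists>\<pi>. bij_betw \<pi> P P \<and> (\<forall>x\<in>carrier A. \<sigma> x = map_prod \<pi> \<pi> ` \<rho> x)"
proof -
  interpret inverse_semigroup A by fact
  define U where "U \<tau> = {p \<in> P. stab A \<tau> p \<noteq> {}}" for \<tau> :: "'a \<Rightarrow> ('b \<times> 'b) set"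
  have in_U: "p \<in> U \<tau> \<and> q \<in> U \<tau>" if \<tau>: "rep A P \<tau>" and x: "x \<in> carrier A" "(p, q) \<in> \<tau> x" for \<tau> p q x
  proof -
    have "(p, p) \<in> \<tau> (x \<cdot>\<^bsub>A\<^esub> sinv A x)" "(q, q) \<in> \<tau> (sinv A x \<cdot>\<^bsub>A\<^esub> x)"
      using x by (auto simp: repD[OF \<tau>] sinv_closed)
    then show ?thesis
      using x repD(1)[OF \<tau> x(1)] by (auto simp: U_def stab_def intro: mul_closed sinv_closed)
  qed
  have inv: "invariant A \<tau> (U \<tau>)" if "rep A P \<tau>" for \<tau>
    using in_U[OF that] by (auto simp: invariant_def)
  have mark: "mark (U \<tau>) \<tau> H = mark P \<tau> H" if "inverse_subsemigroup H A" for \<tau> H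
  proof -
    have "{p \<in> U \<tau>. \<forall>h\<in>H. (p, p) \<in> \<tau> h} = {p \<in> P. \<forall>h\<in>H. (p, p) \<in> \<tau> h}"
      using that by (auto simp: U_def stab_def inverse_subsemigroup_def)
    then show ?thesis by (simp add: mark_def)
  qed
  have "\<exists>\<beta>. bij_betw \<beta> (U \<rho>) (U \<sigma>) \<and> equivariant A (U \<rho>) \<rho> \<sigma> \<beta>"
    using P inv[OF \<rho>] inv[OF \<sigma>] mark eq
    by (intro equal_marks_equivariant_bij[OF A \<rho> \<sigma>]) (auto simp: U_def)
  then obtain \<beta> where \<beta>: "bij_betw \<beta> (U \<rho>) (U \<sigma>)" "equivariant A (U \<rho>) \<rho> \<sigma> \<beta>" by auto
  have sub: "U \<tau> \<subseteq> P" for \<tau> by (auto simp: U_def)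
  have "card (P - U \<rho>) = card (P - U \<sigma>)"
    using sub P bij_betw_same_card[OF \<beta>(1)] by (simp add: card_Diff_subset finite_subset[OF sub])
  then obtain \<gamma> where \<gamma>: "bij_betw \<gamma> (P - U \<rho>) (P - U \<sigma>)"
    using P by (metis bij_betw_iff_card finite_Diff)
  define \<pi> where "\<pi> p = (if p \<in> U \<rho> then \<beta> p else \<gamma> p)" for p
  have "bij_betw \<pi> (U \<rho> \<union> (P - U \<rho>)) (U \<sigma> \<union> (P - U \<sigma>))"
    unfolding \<pi>_def by (rule bij_betw_disjoint_Un[OF \<beta>(1) \<gamma>]) auto
  then have \<pi>: "bij_betw \<pi> P P" using sub by (simp add: Un_absorb1)
  moreover have "\<sigma> x = map_prod \<pi> \<pi> ` \<rho> x" if x: "x \<in> carrier A" for x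
  proof
    have eqv: "(p, q) \<in> \<rho> x \<longleftrightarrow> (\<pi> p, \<pi> q) \<in> \<sigma> x" if "p \<in> U \<rho>" "q \<in> U \<rho>" for p q
      using \<beta>(2) x that by (auto simp: equivariant_def \<pi>_def)
    show "map_prod \<pi> \<pi> ` \<rho> x \<subseteq> \<sigma> x" using eqv in_U[OF \<rho> x] by auto
    show "\<sigma> x \<subseteq> map_prod \<pi> \<pi> ` \<rho> x"
    proof (rule subrelI)
      fix p' q' assume pq: "(p', q') \<in> \<sigma> x"
      then have "p' \<in> \<beta> ` U \<rho>" "q' \<in> \<beta> ` U \<rho>" using in_U[OF \<sigma> x] \<beta>(1) by (auto simp: bij_betw_def)
      then obtain p q where "p \<in> U \<rho>" "q \<in> U \<rho>" "p' = \<pi> p" "q' = \<pi> q" by (auto simp: \<pi>_def)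
      then show "(p', q') \<in> map_prod \<pi> \<pi> ` \<rho> x" using eqv pq by force
    qed
  qed
  ultimately show ?thesis by blast
qed

section \<open>Domains, ranges and ranks of partial bijections\<close>

lemma relcomp_converse:
  assumes "x \<in> carrier (sym_inv n)"
  shows "x O x\<inverse> = Id_on (Domain x)" "x\<inverse> O x = Id_on (Range x)"
  using assms unfolding carrier_sym_inv single_valued_def by (auto simp: Id_on_iff)

lemma finite_sym_inv:
  assumes "x \<in> carrier (sym_inv n)"
  shows "finite x" "finite (Domain x)" "finite (Range x)"
proof -
  show "finite x" using assms finite_subset[of x "{1..n} \<times> {1..n}"] by (auto simp only: carrier_sym_inv)
  then show "finite (Domain x)" "finite (Range x)" by (auto simp: finite_Domain finite_Range)
qed

lemma card_Domain_Range:
  assumes "x \<in> carrier (sym_inv n)"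
  shows "card (Domain x) = card x" "card (Range x) = card x"
proof -
  have "inj_on fst x" "inj_on snd x"
    using assms by (auto simp: carrier_sym_inv single_valued_def inj_on_def)
  then show "card (Domain x) = card x" "card (Range x) = card x"
    by (metis Domain_fst card_image, metis Range_snd card_image)
qed

lemma Domain_sym_inv: "x \<in> carrier (sym_inv n) \<Longrightarrow> Domain x \<subseteq> {1..n}"
  unfolding carrier_sym_inv by blast

lemma Id_on_sym_inv: "A \<subseteq> {1..n} \<Longrightarrow> Id_on A \<in> carrier (sym_inv n)"
  unfolding carrier_sym_inv by (auto simp: single_valued_def)

lemma Id_on_relcomp: "Domain x \<subseteq> A \<Longrightarrow> Id_on A O x = x"
  by auto

lemma relcomp_Id_on: "Range x \<subseteq> A \<Longrightarrow> x O Id_on A = x"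
  by auto

lemma relcomp_converse_cancel:
  assumes "b \<in> carrier (sym_inv n)" "Range x \<subseteq> Domain b"
  shows "x O b O b\<inverse> = x"
  by (simp add: relcomp_converse[OF assms(1)] relcomp_Id_on[OF assms(2)])

lemma Domain_relcomp_eq: "Range x \<subseteq> Domain b \<Longrightarrow> Domain (x O b) = Domain x"
  and Range_relcomp_eq: "Domain b \<subseteq> Range x \<Longrightarrow> Range (x O b) = Range b"
  by (auto, blast+)

section \<open>Subgroups and coset actions\<close>

definition dm :: "('b \<times> 'b) set set \<Rightarrow> 'b set" where
  "dm H = Domain (\<Union>H)"

text \<open>If all elements of an inverse subsemigroup have the same domain, they are permutations of it.\<close>

definition subgrp :: "nat \<Rightarrow> (nat \<times> nat) set set \<Rightarrow> bool" where
  "subgrp n H \<longleftrightarrow> inverse_subsemigroup H (sym_inv n) \<and> (\<forall>h\<in>H. Domain h = dm H)"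

lemma subgrpI:
  assumes "inverse_subsemigroup H (sym_inv n)" "\<And>h. h \<in> H \<Longrightarrow> Domain h = A"
  shows "subgrp n H" "dm H = A"
proof -
  show "dm H = A" using assms by (auto simp: dm_def Domain_Union inverse_subsemigroup_def)
  then show "subgrp n H" using assms by (simp add: subgrp_def)
qed

lemma subgrpD:
  assumes "subgrp n H"
  shows "H \<noteq> {}" "H \<subseteq> carrier (sym_inv n)" "finite H"
    and "\<lbrakk>h \<in> H; k \<in> H\<rbrakk> \<Longrightarrow> h O k \<in> H"
    and "h \<in> H \<Longrightarrow> h\<inverse> \<in> H"
    and "h \<in> H \<Longrightarrow> Domain h = dm H"
    and "h \<in> H \<Longrightarrow> Range h = dm H"
    and "h \<in> H \<Longrightarrow> h O h\<inverse> = Id_on (dm H)"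
    and "h \<in> H \<Longrightarrow> h\<inverse> O h = Id_on (dm H)"
    and "Id_on (dm H) \<in> H"
    and "dm H \<subseteq> {1..n}" "finite (dm H)"
proof -
  show H: "H \<noteq> {}" "H \<subseteq> carrier (sym_inv n)" using assms by (auto simp: subgrp_def inverse_subsemigroup_def)
  then show "finite H" by (meson finite_carrier_sym_inv finite_subset)
  show mul: "h O k \<in> H" if "h \<in> H" "k \<in> H" for h k
    using assms that by (auto simp: subgrp_def inverse_subsemigroup_def)
  show inv: "h\<inverse> \<in> H" if "h \<in> H" for h
    using assms that by (auto simp: subgrp_def inverse_subsemigroup_def)
  show dom: "Domain h = dm H" if "h \<in> H" for h
    using assms that by (auto simp: subgrp_def)
  show ran: "Range h = dm H" if "h \<in> H" for h
    using dom[OF inv[OF that]] by simp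
  show eq: "h O h\<inverse> = Id_on (dm H)" if "h \<in> H" for h
    using relcomp_converse(1)[of h n] H(2) that dom[OF that] by auto
  show "h\<inverse> O h = Id_on (dm H)" if "h \<in> H" for h
    using eq[OF inv[OF that]] by simp
  obtain h where h: "h \<in> H" using H by blast
  then show "Id_on (dm H) \<in> H" using mul[OF h inv[OF h]] eq[OF h] by simp
  show "dm H \<subseteq> {1..n}" using Domain_sym_inv[of h n] H(2) h dom[OF h] by auto
  then show "finite (dm H)" by (rule finite_subset) simp
qed

definition coset :: "(nat \<times> nat) set set \<Rightarrow> (nat \<times> nat) set \<Rightarrow> (nat \<times> nat) set set" where
  "coset K x = (\<lambda>k. k O x) ` K"

definition cosets :: "nat \<Rightarrow> (nat \<times> nat) set set \<Rightarrow> (nat \<times> nat) set set set" where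
  "cosets n K = coset K ` {x \<in> carrier (sym_inv n). Domain x = dm K}"

text \<open>The transitive action on right cosets by right multiplication. The condition on the
  range ensures that \<open>x O b\<close> still has domain \<open>dm K\<close> and so represents a
  coset again.\<close>

definition coset_rep ::
    "nat \<Rightarrow> (nat \<times> nat) set set \<Rightarrow> (nat \<times> nat) set \<Rightarrow> ((nat \<times> nat) set set \<times> (nat \<times> nat) set set) set" where
  "coset_rep n K b =
    {(coset K x, coset K (x O b)) |x. x \<in> carrier (sym_inv n) \<and> Domain x = dm K \<and> Range x \<subseteq> Domain b}"

lemma coset_relcomp:
  assumes "subgrp n K" "k \<in> K"
  shows "coset K (k O x) = coset K x"
proof -
  note K = subgrpD[OF assms(1)]
  have "h O x \<in> (\<lambda>h. h O k O x) ` K" if "h \<in> K" for h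
  proof (rule image_eqI)
    have "h O k\<inverse> O k = h" using K(9) K(7) that assms(2) by (simp add: relcomp_Id_on)
    then show "h O x = (h O k\<inverse>) O k O x" by (metis O_assoc)
  qed (use K that assms in simp)
  moreover have "h O k O x \<in> (\<lambda>h. h O x) ` K" if "h \<in> K" for h
    using K(4) that assms(2) by (auto simp flip: O_assoc)
  ultimately show ?thesis unfolding coset_def by blast
qed

lemma coset_eqD:
  assumes "subgrp n K" "Domain x = dm K" "Domain y = dm K" "coset K x = coset K y"
  shows "\<exists>k\<in>K. y = k O x"
proof -
  have "Id_on (dm K) O y = y" using assms(3) by (simp add: Id_on_relcomp)
  then have "y \<in> coset K y" using subgrpD(10)[OF assms(1)]
    unfolding coset_def by (intro image_eqI[where x = "Id_on (dm K)"]) simp_all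
  then have "y \<in> coset K x" using assms(4) by simp
  then show ?thesis by (auto simp: coset_def)
qed

text \<open>Another representative of the coset is \<open>k O x\<close> with \<open>k\<close> a
  permutation of \<open>dm K\<close>; it has the same range as \<open>x\<close>, so the condition
  depends on the coset alone.\<close>

lemma coset_rep_iff:
  assumes K: "subgrp n K" and x: "x \<in> carrier (sym_inv n)" "Domain x = dm K"
  shows "(coset K x, q) \<in> coset_rep n K b \<longleftrightarrow> Range x \<subseteq> Domain b \<and> q = coset K (x O b)"
proof
  assume "(coset K x, q) \<in> coset_rep n K b"
  then obtain y where y: "coset K x = coset K y" "Domain y = dm K" "Range y \<subseteq> Domain b" "q = coset K (y O b)"
    by (auto simp: coset_rep_def)
  then obtain k where k: "k \<in> K" "y = k O x" using coset_eqD[OF K x(2) y(2)] by blast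
  then have "Range y = Range x" using subgrpD(7)[OF K] x(2) by (simp add: Range_relcomp_eq)
  then show "Range x \<subseteq> Domain b \<and> q = coset K (x O b)"
    using y k coset_relcomp[OF K] by (simp add: O_assoc)
qed (use x in \<open>auto simp: coset_rep_def\<close>)

lemma rep_coset_rep:
  assumes K: "subgrp n K"
  shows "rep (sym_inv n) (cosets n K) (coset_rep n K)"
proof -
  note iff = coset_rep_iff[OF K]
  have form: "\<exists>x. x \<in> carrier (sym_inv n) \<and> Domain x = dm K \<and> p = coset K x" if "(p, q) \<in> coset_rep n K b" for p q b
    using that by (auto simp: coset_rep_def)
  have sv: "single_valued (coset_rep n K b)" for b
    using form iff unfolding single_valued_def by metis
  have inv_sub: "(coset_rep n K b)\<inverse> \<subseteq> coset_rep n K (b\<inverse>)" if b: "b \<in> carrier (sym_inv n)" for b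
  proof
    fix z assume "z \<in> (coset_rep n K b)\<inverse>"
    then obtain x where x: "x \<in> carrier (sym_inv n)" "Domain x = dm K" "Range x \<subseteq> Domain b"
      "z = (coset K (x O b), coset K x)" by (auto simp: coset_rep_def)
    have "(x O b) O b\<inverse> = x" using relcomp_converse_cancel[OF b x(3)] by (simp add: O_assoc)
    moreover have "x O b \<in> carrier (sym_inv n)" "Domain (x O b) = dm K" "Range (x O b) \<subseteq> Domain (b\<inverse>)"
      using x b by (auto simp: sym_inv_closed Domain_relcomp_eq)
    ultimately show "z \<in> coset_rep n K (b\<inverse>)" using x(4) iff by simp
  qed
  have inv: "coset_rep n K (b\<inverse>) = (coset_rep n K b)\<inverse>" if "b \<in> carrier (sym_inv n)" for b
    using inv_sub[OF that] inv_sub[OF sym_inv_closed(2)[OF that]] by auto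
  have comp: "coset_rep n K (b O c) = coset_rep n K b O coset_rep n K c"
    if b: "b \<in> carrier (sym_inv n)" and c: "c \<in> carrier (sym_inv n)" for b c
  proof -
    have "(coset K x, q) \<in> coset_rep n K (b O c) \<longleftrightarrow> (coset K x, q) \<in> coset_rep n K b O coset_rep n K c"
      if x: "x \<in> carrier (sym_inv n)" "Domain x = dm K" for x q
    proof -
      \<comment> \<open>The composite is defined where neither factor loses a point of the range;
        left to right uses that \<open>b\<close> is single-valued.\<close>
      have "Range x \<subseteq> Domain (b O c) \<longleftrightarrow> Range x \<subseteq> Domain b \<and> Range (x O b) \<subseteq> Domain c" (is "?L \<longleftrightarrow> ?R")
      proof
        show "?L \<Longrightarrow> ?R" using b unfolding carrier_sym_inv single_valued_def by (auto, blast+)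
        assume R: ?R
        show ?L
        proof
          fix y assume "y \<in> Range x"
          then obtain p z where "(p, y) \<in> x" "(y, z) \<in> b" using R by blast
          then have "z \<in> Range (x O b)" by blast
          then show "y \<in> Domain (b O c)" using R \<open>(y, z) \<in> b\<close> by blast
        qed
      qed
      moreover have "(coset K x, q) \<in> coset_rep n K b O coset_rep n K c \<longleftrightarrow>
          Range x \<subseteq> Domain b \<and> (coset K (x O b), q) \<in> coset_rep n K c"
        by (auto simp only: relcomp_unfold iff[OF x] mem_Collect_eq case_prod_conv)
      moreover have "(coset K (x O b), q) \<in> coset_rep n K c \<longleftrightarrow> Range (x O b) \<subseteq> Domain c \<and> q = coset K (x O b O c)"
        if "Range x \<subseteq> Domain b"
        using iff[of "x O b"] x b that by (simp add: sym_inv_closed Domain_relcomp_eq O_assoc)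
      ultimately show ?thesis by (auto simp only: iff[OF x])
    qed
    note eq = this
    have "(p, q) \<in> coset_rep n K (b O c) \<longleftrightarrow> (p, q) \<in> coset_rep n K b O coset_rep n K c" for p q
    proof (cases "\<exists>x. x \<in> carrier (sym_inv n) \<and> Domain x = dm K \<and> p = coset K x")
      case True
      then show ?thesis using eq by auto
    next
      case False
      then show ?thesis using form by (metis relcompE prod.inject)
    qed
    then show ?thesis by auto
  qed
  have "coset_rep n K b \<subseteq> cosets n K \<times> cosets n K" if "b \<in> carrier (sym_inv n)" for b
    using that by (auto simp: coset_rep_def cosets_def sym_inv_closed Domain_relcomp_eq intro!: imageI)
  then show ?thesis
    using sv inv comp sym_inv_closed(2) unfolding rep_def by (metis sym_inv_sel)
qed

lemma finite_cosets [simp]: "finite (cosets n K)"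
  by (simp add: cosets_def)

text \<open>For subgroups the first two conditions make \<open>x\<close> a bijection from
  \<open>dm K\<close> onto \<open>dm H\<close>, the only idempotent of a subgroup being the identity
  of its domain.\<close>

definition conjugate :: "nat \<Rightarrow> (nat \<times> nat) set set \<Rightarrow> (nat \<times> nat) set set \<Rightarrow> bool" where
  "conjugate n K H \<longleftrightarrow> (\<exists>x\<in>carrier (sym_inv n). x O x\<inverse> \<in> K \<and> x\<inverse> O x \<in> H \<and>
     (\<forall>h\<in>H. x O h O x\<inverse> \<in> K) \<and> (\<forall>k\<in>K. x\<inverse> O k O x \<in> H))"

text \<open>\<open>x\<close> takes fixed points of \<open>K\<close> injectively to fixed points of
  \<open>H\<close>. It is defined at them because \<open>x O x\<inverse>\<close> lies in
  \<open>K\<close>, and \<open>h\<close> fixes the image because \<open>x O h O x\<inverse>\<close>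
  fixes the point.\<close>

lemma mark_conjugate_le:
  assumes \<rho>: "rep (sym_inv n) P \<rho>" "finite P" and x: "x \<in> carrier (sym_inv n)"
    and H: "H \<subseteq> carrier (sym_inv n)" and K: "x O x\<inverse> \<in> K" "\<And>h. h \<in> H \<Longrightarrow> x O h O x\<inverse> \<in> K"
  shows "mark P \<rho> K \<le> mark P \<rho> H"
proof -
  have comp: "\<rho> (y O z) = \<rho> y O \<rho> z" "\<rho> (y\<inverse>) = (\<rho> y)\<inverse>"
    if "y \<in> carrier (sym_inv n)" "z \<in> carrier (sym_inv n)" for y z
    using repD(4,5)[OF \<rho>(1)] that by auto
  have "\<exists>q. (p, q) \<in> \<rho> x" if "\<forall>k\<in>K. (p, p) \<in> \<rho> k" for p
    using that K(1) comp x sym_inv_closed(2)[OF x] by force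
  then obtain w where w: "\<And>p. \<forall>k\<in>K. (p, p) \<in> \<rho> k \<Longrightarrow> (p, w p) \<in> \<rho> x" by metis
  have fixed: "(w p, w p) \<in> \<rho> h" if p: "\<forall>k\<in>K. (p, p) \<in> \<rho> k" and h: "h \<in> H" for p h
  proof -
    have "(p, p) \<in> \<rho> (x O h O x\<inverse>)" using p K(2) h by blast
    also have "\<dots> = \<rho> x O \<rho> h O (\<rho> x)\<inverse>"
      using comp(1)[OF x, of "h O x\<inverse>"] comp(1)[of h "x\<inverse>"] comp(2)[OF x x] x h H
      by (auto simp: sym_inv_closed subset_iff)
    finally show ?thesis using w[OF p] repD(2)[OF \<rho>(1) x] by (auto dest: single_valuedD)
  qed
  show ?thesis unfolding mark_def
  proof (rule card_inj_on_le)
    show "inj_on w {p \<in> P. \<forall>k\<in>K. (p, p) \<in> \<rho> k}"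
      using w repD(3)[OF \<rho>(1) x] unfolding inj_on_def single_valued_def by (auto, metis)
    show "w ` {p \<in> P. \<forall>k\<in>K. (p, p) \<in> \<rho> k} \<subseteq> {p \<in> P. \<forall>h\<in>H. (p, p) \<in> \<rho> h}"
      using fixed w repD(1)[OF \<rho>(1) x] by blast
  qed (use \<rho> in simp)
qed

lemma mark_conjugate:
  assumes "rep (sym_inv n) P \<rho>" "finite P" "H \<subseteq> carrier (sym_inv n)" "K \<subseteq> carrier (sym_inv n)" "conjugate n K H"
  shows "mark P \<rho> K = mark P \<rho> H"
proof -
  obtain x where x: "x \<in> carrier (sym_inv n)" "x O x\<inverse> \<in> K" "x\<inverse> O x \<in> H"
     "\<forall>h\<in>H. x O h O x\<inverse> \<in> K" "\<forall>k\<in>K. x\<inverse> O k O x \<in> H" using assms(5) by (auto simp: conjugate_def)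
  then show ?thesis
    using mark_conjugate_le[OF assms(1,2), of x H K] mark_conjugate_le[OF assms(1,2), of "x\<inverse>" K H] assms(3,4)
    by (simp add: sym_inv_closed)
qed

text \<open>The stabilizer of a coset \<open>K x\<close> is the subgroup \<open>x\<^sup>-\<^sup>1 K x\<close> together with the elements above it.\<close>

lemma mark_coset_rep_pos:
  assumes K: "subgrp n K" and H: "subgrp n H" and pos: "mark (cosets n K) (coset_rep n K) H > 0"
  obtains "card (dm K) < card (dm H)" | "card (dm K) = card (dm H)" "card H < card K"
  | "card (dm K) = card (dm H)" "card H = card K" "conjugate n K H"
proof -
  note Kd = subgrpD[OF K] and Hd = subgrpD[OF H]
  obtain x where x: "x \<in> carrier (sym_inv n)" "Domain x = dm K"
    and fix_x: "\<And>h. h \<in> H \<Longrightarrow> (coset K x, coset K x) \<in> coset_rep n K h"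
    using pos by (auto simp: mark_def card_gt_0_iff cosets_def)
  \<comment> \<open>The identity of \<open>H\<close> fixes the coset of \<open>x\<close>, hence is
    defined on the range of \<open>x\<close>. This compares the ranks.\<close>
  have sub: "Range x \<subseteq> dm H"
    using fix_x[OF Hd(10)] coset_rep_iff[OF K x] by auto
  have card_x: "card (dm K) = card (Range x)" using card_Domain_Range[OF x(1)] x(2) by simp
  show thesis
  proof (cases "card (dm K) = card (dm H)")
    case True
    then have Rx: "Range x = dm H" using card_x sub Hd(12) by (metis card_subset_eq)
    have xh: "x O h O x\<inverse> \<in> K" if h: "h \<in> H" for h
    proof -
      have "coset K x = coset K (x O h)" "Domain (x O h) = dm K"
        using fix_x[OF h] coset_rep_iff[OF K x] x(2) Rx Hd(6)[OF h] by (auto simp: Domain_relcomp_eq)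
      then obtain k where k: "k \<in> K" "x O h = k O x" using coset_eqD[OF K x(2), of "x O h"] by auto
      have "x O h O x\<inverse> = (x O h) O x\<inverse>" by (simp add: O_assoc)
      also have "\<dots> = k O x O x\<inverse>" unfolding k(2) by (simp add: O_assoc)
      also have "\<dots> = k" using relcomp_converse_cancel[OF x(1), of k] Kd(7)[OF k(1)] x(2) by simp
      finally show ?thesis using k by simp
    qed
    have cancel: "x\<inverse> O (x O h O x\<inverse>) O x = h" if "h \<in> H" for h
    proof -
      have "x\<inverse> O (x O h O x\<inverse>) O x = (x\<inverse> O x) O h O (x\<inverse> O x)" by (simp add: O_assoc)
      also have "\<dots> = h"
        using Hd(6,7)[OF that] Rx unfolding relcomp_converse(2)[OF x(1)] by (simp add: Id_on_relcomp relcomp_Id_on)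
      finally show ?thesis .
    qed
    \<comment> \<open>Conjugation by \<open>x\<close> embeds \<open>H\<close> in \<open>K\<close>,
      which compares the orders. For equal orders it is onto, and \<open>x\<close> witnesses the
      conjugacy.\<close>
    let ?c = "\<lambda>h. x O h O x\<inverse>"
    have inj: "inj_on ?c H" by (rule inj_on_inverseI[where g = "\<lambda>k. x\<inverse> O k O x"]) (rule cancel)
    have im: "?c ` H \<subseteq> K" using xh by blast
    have le: "card H \<le> card K" using card_inj_on_le[OF inj im Kd(3)] .
    show thesis
    proof (cases "card H = card K")
      case eq: True
      then have "?c ` H = K" using card_subset_eq[OF Kd(3) im] card_image[OF inj] by simp
      have "x\<inverse> O k O x \<in> H" if k: "k \<in> K" for k
      proof -
        obtain h where "h \<in> H" "k = x O h O x\<inverse>" using \<open>?c ` H = K\<close> k by blast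
        then show ?thesis using cancel[of h] by simp
      qed
      moreover have "x O x\<inverse> \<in> K" "x\<inverse> O x \<in> H"
        using relcomp_converse[OF x(1)] x(2) Rx Kd(10) Hd(10) by auto
      ultimately show thesis using that(3) True eq xh x(1) by (auto simp: conjugate_def)
    qed (use le that True in simp)
  next
    case False
    then show thesis using that(1) card_mono[OF Hd(12) sub] card_x by simp
  qed
qed

text \<open>The diagonal of the table of marks: \<open>K\<close> fixes the coset of its
  identity.\<close>

lemma mark_coset_rep_self:
  assumes K: "subgrp n K"
  shows "mark (cosets n K) (coset_rep n K) K > 0"
proof -
  note Kd = subgrpD[OF K]
  let ?e = "Id_on (dm K)"
  have e: "?e \<in> carrier (sym_inv n)" "Domain ?e = dm K" "Range ?e = dm K" using Kd(2,10) by auto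
  have "(coset K ?e, coset K ?e) \<in> coset_rep n K k" if "k \<in> K" for k
  proof -
    have "?e O k = k O ?e" using Kd(6,7)[OF that] by (simp add: Id_on_relcomp relcomp_Id_on)
    then show ?thesis using coset_relcomp[OF K that, of ?e] coset_rep_iff[OF K e(1,2)] e(3) Kd(6)[OF that] by simp
  qed
  moreover have "coset K ?e \<in> cosets n K" using e by (auto simp: cosets_def)
  ultimately show ?thesis by (auto simp: mark_def card_gt_0_iff)
qed

section \<open>Equalizing marks\<close>

lemma homs_disjoint_union:
  assumes A: "inverse_semigroup A" and fin: "finite I" and \<rho>: "\<And>i. i \<in> I \<Longrightarrow> \<rho> i \<in> homs A (sym_inv (m i))"
  shows "\<exists>M. \<exists>\<sigma>\<in>homs A (sym_inv M).
    (\<forall>H. H \<subseteq> carrier A \<longrightarrow> mark {1..M} \<sigma> H = (\<Sum>i\<in>I. mark {1..m i} (\<rho> i) H)) \<and>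
    (\<forall>i\<in>I. inj_on (\<rho> i) (carrier A) \<longrightarrow> inj_on \<sigma> (carrier A))"
proof -
  let ?P = "SIGMA i:I. {1..m i}"
  define \<tau> where "\<tau> x = {((i, p), (i, q)) |i p q. i \<in> I \<and> (p, q) \<in> \<rho> i x}" for x
  have r: "rep A {1..m i} (\<rho> i)" if "i \<in> I" for i using \<rho>[OF that] by (simp add: homs_sym_inv)
  have rep: "rep A ?P \<tau>"
    unfolding rep_def
  proof (intro ballI conjI)
    fix x assume x: "x \<in> carrier A"
    show "\<tau> x \<subseteq> ?P \<times> ?P" using repD(1)[OF r x] unfolding \<tau>_def by fast
    show "single_valued (\<tau> x)"
      using repD(2)[OF r x] unfolding \<tau>_def single_valued_def by blast
    show "single_valued ((\<tau> x)\<inverse>)"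
      using repD(3)[OF r x] unfolding \<tau>_def single_valued_def by blast
    show "\<tau> (x \<cdot>\<^bsub>A\<^esub> y) = \<tau> x O \<tau> y" if y: "y \<in> carrier A" for y
    proof -
      have "\<tau> (x \<cdot>\<^bsub>A\<^esub> y) = {((i, p), (i, q)) |i p q. i \<in> I \<and> (p, q) \<in> \<rho> i x O \<rho> i y}"
        using repD(4)[OF r x y] unfolding \<tau>_def by blast
      also have "\<dots> = \<tau> x O \<tau> y" unfolding \<tau>_def relcomp_unfold by blast
      finally show ?thesis .
    qed
    have "\<tau> (sinv A x) = {((i, p), (i, q)) |i p q. i \<in> I \<and> (p, q) \<in> (\<rho> i x)\<inverse>}"
      using repD(5)[OF r x] unfolding \<tau>_def by blast
    then show "\<tau> (sinv A x) = (\<tau> x)\<inverse>" unfolding \<tau>_def by auto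
  qed
  have mark: "mark ?P \<tau> H = (\<Sum>i\<in>I. mark {1..m i} (\<rho> i) H)" for H
  proof -
    have "{p \<in> ?P. \<forall>h\<in>H. (p, p) \<in> \<tau> h} = (SIGMA i:I. {p \<in> {1..m i}. \<forall>h\<in>H. (p, p) \<in> \<rho> i h})"
      by (auto simp: \<tau>_def)
    then show ?thesis using fin by (simp add: mark_def)
  qed
  have inj: "inj_on \<tau> (carrier A)" if i: "i \<in> I" "inj_on (\<rho> i) (carrier A)" for i
  proof (rule inj_onI)
    fix x y assume xy: "x \<in> carrier A" "y \<in> carrier A" "\<tau> x = \<tau> y"
    have "\<rho> i z = {(p, q). ((i, p), (i, q)) \<in> \<tau> z}" for z using i by (auto simp: \<tau>_def)
    then have "\<rho> i x = \<rho> i y" using xy by simp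
    then show "x = y" using i xy by (auto dest: inj_onD)
  qed
  have finP: "finite ?P" using fin by simp
  obtain M \<sigma> where "\<sigma> \<in> homs A (sym_inv M)"
    "\<And>H. H \<subseteq> carrier A \<Longrightarrow> mark {1..M} \<sigma> H = mark ?P \<tau> H"
    "inj_on \<tau> (carrier A) \<Longrightarrow> inj_on \<sigma> (carrier A)"
    using rep_transfer[OF rep finP] by blast
  then show ?thesis using mark inj by (intro exI[of _ M] bexI[of _ \<sigma>]) auto
qed

text \<open>Copies are told apart by an index in \<open>{..<w j}\<close>. Faithfulness is inherited
  from any one faithful action that occurs at least once.\<close>

lemma homs_multiples:
  assumes A: "inverse_semigroup A" and fin: "finite J" and \<rho>: "\<And>j. j \<in> J \<Longrightarrow> \<rho> j \<in> homs A (sym_inv (m j))"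
  shows "\<exists>M. \<exists>\<sigma>\<in>homs A (sym_inv M).
    (\<forall>H. H \<subseteq> carrier A \<longrightarrow> mark {1..M} \<sigma> H = (\<Sum>j\<in>J. w j * mark {1..m j} (\<rho> j) H)) \<and>
    (\<forall>j\<in>J. w j > 0 \<and> inj_on (\<rho> j) (carrier A) \<longrightarrow> inj_on \<sigma> (carrier A))"
proof -
  let ?I = "SIGMA j:J. {..<w j}"
  have "\<rho> (fst i) \<in> homs A (sym_inv (m (fst i)))" if "i \<in> ?I" for i using \<rho> that by auto
  then have "\<exists>M. \<exists>\<sigma>\<in>homs A (sym_inv M).
    (\<forall>H. H \<subseteq> carrier A \<longrightarrow> mark {1..M} \<sigma> H = (\<Sum>i\<in>?I. mark {1..m (fst i)} (\<rho> (fst i)) H)) \<and>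
    (\<forall>i\<in>?I. inj_on (\<rho> (fst i)) (carrier A) \<longrightarrow> inj_on \<sigma> (carrier A))"
    by (rule homs_disjoint_union[OF A finite_SigmaI[OF fin finite_lessThan]])
  then obtain M \<sigma> where \<sigma>: "\<sigma> \<in> homs A (sym_inv M)"
    "\<forall>H. H \<subseteq> carrier A \<longrightarrow> mark {1..M} \<sigma> H = (\<Sum>i\<in>?I. mark {1..m (fst i)} (\<rho> (fst i)) H)"
    "\<forall>i\<in>?I. inj_on (\<rho> (fst i)) (carrier A) \<longrightarrow> inj_on \<sigma> (carrier A)"
    by (elim exE bexE conjE)
  have "(\<Sum>i\<in>?I. mark {1..m (fst i)} (\<rho> (fst i)) H) = (\<Sum>j\<in>J. w j * mark {1..m j} (\<rho> j) H)" for H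
    using sum.Sigma[of J "\<lambda>j. {..<w j}" "\<lambda>j k. mark {1..m j} (\<rho> j) H"] fin by (simp add: split_def)
  moreover have "inj_on \<sigma> (carrier A)" if "j \<in> J" "w j > 0" "inj_on (\<rho> j) (carrier A)" for j
    using bspec[OF \<sigma>(3), of "(j, 0)"] that by simp
  ultimately show ?thesis using \<sigma>(1,2) by auto
qed

lemma image_inverse_subsemigroup:
  assumes "f \<in> homs A B" "inverse_subsemigroup H A"
  shows "inverse_subsemigroup (f ` H) B"
proof -
  have "x \<in> carrier A" if "x \<in> H" for x using assms(2) that by (auto simp: inverse_subsemigroup_def)
  then show ?thesis
    using assms(2) homsD[OF assms(1)] unfolding inverse_subsemigroup_def
    by (auto simp flip: homsD(2,3)[OF assms(1)])
qed

lemma subgrp_image: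
  assumes f: "f \<in> homs (sym_inv n) (sym_inv a)" and H: "subgrp n H"
  shows "subgrp a (f ` H)" "dm (f ` H) = Domain (f (Id_on (dm H)))"
proof -
  note Hd = subgrpD[OF H]
  have i: "inverse_subsemigroup (f ` H) (sym_inv a)"
    using H image_inverse_subsemigroup[OF f] by (simp add: subgrp_def)
  have "Domain (f h) = Domain (f (Id_on (dm H)))" if h: "h \<in> H" for h
  proof -
    have hc: "h \<in> carrier (sym_inv n)" using h Hd(2) by blast
    then have "f (Id_on (dm H)) = f h O (f h)\<inverse>"
      using homsD(2,3)[OF f hc] homsD(2)[OF f hc, of "h\<inverse>"] Hd(8)[OF h] by (simp add: sym_inv_closed)
    then show ?thesis using relcomp_converse(1)[OF homsD(1)[OF f hc]] by simp
  qed
  then show "subgrp a (f ` H)" "dm (f ` H) = Domain (f (Id_on (dm H)))"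
    by (intro subgrpI[OF i]; blast)+
qed

text \<open>A bijection \<open>g\<close> from \<open>A\<close> to \<open>B\<close> has
  \<open>Id_on A\<close> and \<open>Id_on B\<close> as its two products with its converse. Their
  images are the identities on the domain and the range of \<open>f g\<close>, which are equally
  large.\<close>

lemma card_Domain_image_eq:
  assumes f: "f \<in> homs (sym_inv n) (sym_inv a)" and A: "A \<subseteq> {1..n}" and B: "B \<subseteq> {1..n}" and eq: "card A = card B"
  shows "card (Domain (f (Id_on A))) = card (Domain (f (Id_on B)))"
proof -
  obtain b where b: "bij_betw b A B"
    using A B eq by (meson finite_atLeastAtMost finite_same_card_bij finite_subset)
  define g where "g = {(x, b x) |x. x \<in> A}"
  have g: "g \<in> carrier (sym_inv n)"
    using A B b by (auto simp: g_def carrier_sym_inv single_valued_def bij_betw_def dest: inj_onD)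
  have DR: "Domain g = A" "Range g = B" using b by (auto simp: g_def bij_betw_def)
  have "Id_on A = g O g\<inverse>" "Id_on B = g\<inverse> O g" using relcomp_converse[OF g] DR by auto
  then have "f (Id_on A) = f g O (f g)\<inverse>" "f (Id_on B) = (f g)\<inverse> O f g"
    using homsD(2)[OF f g, of "g\<inverse>"] homsD(2)[OF f _ g, of "g\<inverse>"] homsD(3)[OF f g] g
    by (simp_all add: sym_inv_closed)
  then show ?thesis
    using relcomp_converse[OF homsD(1)[OF f g]] card_Domain_Range[OF homsD(1)[OF f g]] by simp
qed

text \<open>By the case of equal rank, \<open>A\<close> may be replaced by a proper subset of
  \<open>B\<close>. Images of nested identities are nested identities, and injectivity keeps the
  inclusion proper.\<close>

lemma card_Domain_image_less:
  assumes f: "f \<in> embeddings (sym_inv n) (sym_inv a)" and A: "A \<subseteq> {1..n}" and B: "B \<subseteq> {1..n}" and less: "card A < card B"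
  shows "card (Domain (f (Id_on A))) < card (Domain (f (Id_on B)))"
proof -
  note hom = embeddingsD(6)[OF f]
  obtain A' where A': "A' \<subseteq> B" "card A' = card A"
    using less by (meson less_imp_le_nat obtain_subset_with_card_n)
  then have A'n: "A' \<subseteq> {1..n}" using B by blast
  have "A' \<noteq> B" using A' less by auto
  have fin: "finite (Domain (f (Id_on B)))"
    using finite_sym_inv(2)[OF homsD(1)[OF hom Id_on_sym_inv[OF B]]] .
  have Id_f: "f (Id_on C) = Id_on (Domain (f (Id_on C)))" if C: "C \<subseteq> {1..n}" for C
  proof -
    have "f (Id_on C) = f (Id_on C) O (f (Id_on C))\<inverse>"
      using homsD(2)[OF hom Id_on_sym_inv[OF C], of "(Id_on C)\<inverse>"] homsD(3)[OF hom Id_on_sym_inv[OF C]]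
      by (simp add: Id_on_sym_inv[OF C] Id_on_relcomp)
    then show ?thesis using relcomp_converse(1)[OF homsD(1)[OF hom Id_on_sym_inv[OF C]]] by simp
  qed
  have "Id_on A' O Id_on B = Id_on A'" using A' by auto
  then have "f (Id_on A') = f (Id_on A') O f (Id_on B)"
    using homsD(2)[OF hom Id_on_sym_inv[OF A'n] Id_on_sym_inv[OF B]] by simp
  also have "\<dots> = Id_on (Domain (f (Id_on A')) \<inter> Domain (f (Id_on B)))"
    by (subst Id_f[OF A'n], subst Id_f[OF B]) auto
  finally have "Domain (f (Id_on A')) = Domain (f (Id_on A')) \<inter> Domain (f (Id_on B))"
    by (metis Domain_Id_on)
  then have "Domain (f (Id_on A')) \<subseteq> Domain (f (Id_on B))" by blast
  moreover have "Domain (f (Id_on A')) \<noteq> Domain (f (Id_on B))"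
  proof
    assume "Domain (f (Id_on A')) = Domain (f (Id_on B))"
    then have "f (Id_on A') = f (Id_on B)" using Id_f A'n B by metis
    then have "Id_on A' = Id_on B"
      using embeddingsD(4)[OF f Id_on_sym_inv[OF A'n] Id_on_sym_inv[OF B]] by simp
    then show False using \<open>A' \<noteq> B\<close> by (metis Domain_Id_on)
  qed
  ultimately have "card (Domain (f (Id_on A'))) < card (Domain (f (Id_on B)))"
    using fin by (simp add: psubset_card_mono psubset_eq)
  then show ?thesis using card_Domain_image_eq[OF hom A'n A A'(2)] by simp
qed

text \<open>Carries comparisons of rank from \<open>sym_inv a\<close>, whose coset actions are used,
  back to \<open>sym_inv n\<close>, where levels are measured.\<close>

lemma card_dm_image_iff:
  assumes f: "f \<in> embeddings (sym_inv n) (sym_inv a)" and H: "subgrp n H" and K: "subgrp n K"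
  shows "card (dm (f ` K)) < card (dm (f ` H)) \<longleftrightarrow> card (dm K) < card (dm H)"
    "card (dm (f ` K)) = card (dm (f ` H)) \<longleftrightarrow> card (dm K) = card (dm H)"
proof -
  note dm = subgrpD(11)[OF H] subgrpD(11)[OF K]
  have "dm (f ` H) = Domain (f (Id_on (dm H)))" "dm (f ` K) = Domain (f (Id_on (dm K)))"
    using subgrp_image(2)[OF embeddingsD(6)[OF f]] H K by auto
  then show "card (dm (f ` K)) < card (dm (f ` H)) \<longleftrightarrow> card (dm K) < card (dm H)"
    "card (dm (f ` K)) = card (dm (f ` H)) \<longleftrightarrow> card (dm K) = card (dm H)"
    using card_Domain_image_less[OF f dm(2,1)] card_Domain_image_less[OF f dm]
      card_Domain_image_eq[OF embeddingsD(6)[OF f] dm]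
    by (cases "card (dm K)" "card (dm H)" rule: linorder_cases; simp)+
qed

text \<open>
  Low level means small rank, and large order among the subgroups of a fixed rank. A coset action of
  \<open>f ` K\<close> has fixed points only under subgroups of at least the level of \<open>K\<close>.
\<close>

definition level :: "nat \<Rightarrow> (nat \<times> nat) set set \<Rightarrow> nat" where
  "level n H = card (dm H) * Suc (card (carrier (sym_inv n))) + (card (carrier (sym_inv n)) - card H)"

text \<open>The second summand of \<open>level\<close> is at most \<open>?N\<close>, so the factor
  \<open>Suc ?N\<close> lets the rank decide first; the subtraction turns large order into low
  level.\<close>

lemma level_less:
  assumes "subgrp n H" "subgrp n K" "card (dm K) < card (dm H) \<or> card (dm K) = card (dm H) \<and> card H < card K"
  shows "level n K < level n H"
proof -
  let ?N = "card (carrier (sym_inv n))"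
  have le: "card H \<le> ?N" "card K \<le> ?N" using subgrpD(2) assms(1,2) by (auto intro!: card_mono)
  show ?thesis
  proof (cases "card (dm K) < card (dm H)")
    case True
    then have "Suc (card (dm K)) * Suc ?N \<le> card (dm H) * Suc ?N" by (intro mult_right_mono) auto
    then show ?thesis unfolding level_def by simp
  next
    case False
    then show ?thesis using assms(3) le unfolding level_def by auto
  qed
qed

definition coset_mark ::
    "nat \<Rightarrow> ((nat \<times> nat) set \<Rightarrow> (nat \<times> nat) set) \<Rightarrow> (nat \<times> nat) set set \<Rightarrow> (nat \<times> nat) set set \<Rightarrow> nat" where
  "coset_mark a f K H = mark (cosets a (f ` K)) (coset_rep a (f ` K)) (f ` H)"

text \<open>Triangularity of the table of marks. Within a level the conjugacy takes place in
  \<open>sym_inv a\<close>, where subgroups not conjugate in \<open>sym_inv n\<close> may be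
  fused.\<close>

lemma coset_mark_pos:
  assumes f: "f \<in> embeddings (sym_inv n) (sym_inv a)" and H: "subgrp n H" and K: "subgrp n K"
    and pos: "coset_mark a f K H > 0"
  shows "level n K < level n H \<or> level n K = level n H \<and> conjugate a (f ` K) (f ` H)"
proof -
  note hom = embeddingsD(6)[OF f]
  have card: "card (f ` L) = card L" if "subgrp n L" for L
    using embeddingsD(5)[OF f] subgrpD(2)[OF that] by (meson card_image inj_on_subset)
  show ?thesis
  proof (cases rule: mark_coset_rep_pos[OF subgrp_image(1)[OF hom K] subgrp_image(1)[OF hom H] pos[unfolded coset_mark_def]])
    case 3
    then have "level n K = level n H" using card card_dm_image_iff[OF f H K] H K by (simp add: level_def)
    then show ?thesis using 3 by simp
  qed (use card card_dm_image_iff[OF f H K] H K level_less[OF H K] in auto)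
qed

text \<open>The deficit \<open>D * (M - mark)\<close> at each \<open>H\<close> of level
  \<open>t\<close> is filled by copies of the coset actions belonging to the subgroups
  \<open>K\<close> of level \<open>t\<close>. These have no fixed points below that level; above it
  nothing is controlled. The modulus \<open>q\<close> is fixed before \<open>D\<close> and
  \<open>M\<close>, so that two embeddings can later share \<open>D\<close> and
  \<open>M\<close>.\<close>

lemma equalize_marks_at_level:
  assumes f: "f \<in> embeddings (sym_inv n) (sym_inv a)" and g: "g \<in> embeddings (sym_inv a) (sym_inv m)"
  shows "\<exists>q>0. \<forall>D M. q dvd D \<and> D > 0 \<and> (\<forall>H. mark {1..m} g (f ` H) \<le> M) \<longrightarrow>
    (\<exists>m'. \<exists>g'\<in>embeddings (sym_inv a) (sym_inv m'). \<forall>H. subgrp n H \<longrightarrow>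
       (level n H < t \<longrightarrow> mark {1..m'} g' (f ` H) = D * mark {1..m} g (f ` H)) \<and>
       (level n H = t \<longrightarrow> mark {1..m'} g' (f ` H) = D * M))"
proof -
  note hom = embeddingsD(6)[OF f]
  let ?N = "carrier (sym_inv n)" and ?A = "carrier (sym_inv a)"
  define F where "F = {H. subgrp n H \<and> level n H = t}"
  have "F \<subseteq> Pow ?N" using subgrpD(2) by (auto simp: F_def)
  then have finF: "finite F" by (meson finite_Pow_iff finite_carrier_sym_inv finite_subset)
  have fsub: "f ` H \<subseteq> ?A" if "subgrp n H" for H using subgrpD(2)[OF subgrp_image(1)[OF hom that]] .
  let ?c = "coset_mark a f"
  \<comment> \<open>The fixed points of the image of \<open>H\<close> in one copy of each coset
    action of the level. Conjugate subgroups are not thinned out to representatives; as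
    \<open>Q\<close> is constant on classes, dividing by it corrects for the repetition.\<close>
  define Q where "Q H = (\<Sum>K\<in>F. ?c K H)" for H
  have conj_mark: "mark P \<rho> (f ` K) = mark P \<rho> (f ` H)"
    if "?c K H > 0" "H \<in> F" "K \<in> F" "rep (sym_inv a) P \<rho>" "finite P" for K H P and \<rho> :: "_ \<Rightarrow> ('x \<times> 'x) set"
  proof -
    have "conjugate a (f ` K) (f ` H)" using coset_mark_pos[OF f _ _ that(1)] that by (auto simp: F_def)
    then show ?thesis using mark_conjugate[OF that(4,5)] fsub that(2,3) by (auto simp: F_def)
  qed
  have Q_conj: "Q K = Q H" if "?c K H > 0" "H \<in> F" "K \<in> F" for K H
  proof -
    have "?c L K = ?c L H" if "L \<in> F" for L
      unfolding coset_mark_def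
      using conj_mark[OF \<open>?c K H > 0\<close> \<open>H \<in> F\<close> \<open>K \<in> F\<close> rep_coset_rep finite_cosets] that
        subgrp_image(1)[OF hom] by (simp add: F_def)
    then show ?thesis by (simp add: Q_def)
  qed
  have Q_pos: "Q H > 0" if "H \<in> F" for H
  proof -
    have "?c H H > 0"
      unfolding coset_mark_def using mark_coset_rep_self subgrp_image(1)[OF hom] that by (simp add: F_def)
    then show ?thesis using that finF by (auto simp: Q_def intro!: sum_pos2[of F H])
  qed
  have "\<forall>K\<in>F. \<exists>mK \<rho>K. \<rho>K \<in> homs (sym_inv a) (sym_inv mK) \<and>
      (\<forall>H. H \<subseteq> ?A \<longrightarrow> mark {1..mK} \<rho>K H = mark (cosets a (f ` K)) (coset_rep a (f ` K)) H)"
  proof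
    fix K assume "K \<in> F"
    then have "subgrp a (f ` K)" using subgrp_image(1)[OF hom] by (simp add: F_def)
    from rep_transfer[OF rep_coset_rep[OF this] finite_cosets] show "\<exists>mK \<rho>K. \<rho>K \<in> homs (sym_inv a) (sym_inv mK) \<and>
      (\<forall>H. H \<subseteq> ?A \<longrightarrow> mark {1..mK} \<rho>K H = mark (cosets a (f ` K)) (coset_rep a (f ` K)) H)"
      by metis
  qed
  then obtain mc \<rho>c where \<rho>c: "\<And>K. K \<in> F \<Longrightarrow> \<rho>c K \<in> homs (sym_inv a) (sym_inv (mc K))"
    and mark_c: "\<And>K H. \<lbrakk>K \<in> F; subgrp n H\<rbrakk> \<Longrightarrow> mark {1..mc K} (\<rho>c K) (f ` H) = ?c K H"
    unfolding coset_mark_def using fsub by metis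
  have "\<exists>m'. \<exists>g'\<in>embeddings (sym_inv a) (sym_inv m'). \<forall>H. subgrp n H \<longrightarrow>
       (level n H < t \<longrightarrow> mark {1..m'} g' (f ` H) = D * mark {1..m} g (f ` H)) \<and>
       (level n H = t \<longrightarrow> mark {1..m'} g' (f ` H) = D * M)"
    if D: "(\<Prod>H\<in>F. Q H) dvd D" "D > 0" and M: "\<forall>H. mark {1..m} g (f ` H) \<le> M" for D M
  proof -
    let ?a = "\<lambda>H. mark {1..m} g (f ` H)"
    \<comment> \<open>\<open>None\<close> stands for \<open>g\<close>, \<open>Some K\<close> for the
      coset action of \<open>K\<close>. The quotient is exact because \<open>D\<close> is a multiple
      of the product of all \<open>Q H\<close>.\<close>
    define w where "w j = (case j of None \<Rightarrow> D | Some K \<Rightarrow> (M - ?a K) * (D div Q K))" for j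
    let ?\<rho> = "\<lambda>j. case j of None \<Rightarrow> g | Some K \<Rightarrow> \<rho>c K" and ?m = "\<lambda>j. case j of None \<Rightarrow> m | Some K \<Rightarrow> mc K"
    have "?\<rho> j \<in> homs (sym_inv a) (sym_inv (?m j))" if "j \<in> insert None (Some ` F)" for j
      using that \<rho>c embeddingsD(6)[OF g] by auto
    then have "\<exists>m'. \<exists>g'\<in>homs (sym_inv a) (sym_inv m').
      (\<forall>H. H \<subseteq> ?A \<longrightarrow> mark {1..m'} g' H = (\<Sum>j\<in>insert None (Some ` F). w j * mark {1..?m j} (?\<rho> j) H)) \<and>
      (\<forall>j\<in>insert None (Some ` F). w j > 0 \<and> inj_on (?\<rho> j) ?A \<longrightarrow> inj_on g' ?A)"
      using finF by (intro homs_multiples[OF inverse_semigroup_sym_inv]) simp_all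
    then obtain m' g' where g': "g' \<in> homs (sym_inv a) (sym_inv m')"
      and mark_sum: "\<forall>H. H \<subseteq> ?A \<longrightarrow>
        mark {1..m'} g' H = (\<Sum>j\<in>insert None (Some ` F). w j * mark {1..?m j} (?\<rho> j) H)"
      and inj: "\<forall>j\<in>insert None (Some ` F). w j > 0 \<and> inj_on (?\<rho> j) ?A \<longrightarrow> inj_on g' ?A"
      by (elim exE bexE conjE)
    have "g' \<in> embeddings (sym_inv a) (sym_inv m')"
      using g' bspec[OF inj, of None] D embeddingsD(5)[OF g] by (simp add: embeddings_def w_def)
    moreover have mark: "mark {1..m'} g' (f ` H) = D * ?a H + (\<Sum>K\<in>F. w (Some K) * ?c K H)" if H: "subgrp n H" for H
      using mark_sum[rule_format, OF fsub[OF H]] finF mark_c[OF _ H] by (simp add: sum.reindex w_def)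
    moreover have "mark {1..m'} g' (f ` H) = D * ?a H" if H: "subgrp n H" "level n H < t" for H
    proof -
      have "?c K H = 0" if "K \<in> F" for K
        using coset_mark_pos[OF f H(1), of K] that H(2) by (auto simp: F_def)
      then show ?thesis using mark[OF H(1)] by simp
    qed
    moreover have "mark {1..m'} g' (f ` H) = D * M" if H: "subgrp n H" "level n H = t" for H
    proof -
      have HF: "H \<in> F" using H by (simp add: F_def)
      \<comment> \<open>If \<open>?c K H\<close> is positive, the images of \<open>K\<close> and
        \<open>H\<close> are conjugate, so their marks and their values of \<open>Q\<close> agree,
        and with them the weights. The sum thus becomes \<open>w (Some H) * Q H\<close>, which is
        the deficit.\<close>
      have "w (Some K) * ?c K H = w (Some H) * ?c K H" if K: "K \<in> F" for K
      proof (cases "?c K H > 0")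
        case True
        have "?a K = ?a H"
          using conj_mark[OF True HF K, of "{1..m}" g] embeddingsD(6)[OF g] by (simp add: homs_sym_inv)
        then show ?thesis using Q_conj[OF True HF K] by (simp add: w_def)
      qed simp
      then have "(\<Sum>K\<in>F. w (Some K) * ?c K H) = w (Some H) * Q H"
        unfolding Q_def sum_distrib_left by (rule sum.cong[OF refl])
      also have "\<dots> = (M - ?a H) * D"
        using D(1) dvd_trans[OF dvd_prodI[OF finF HF, of Q] D(1)] by (simp add: w_def)
      finally have "mark {1..m'} g' (f ` H) = D * ?a H + (M - ?a H) * D" using mark[OF H(1)] by simp
      then show ?thesis using M by (metis add_mult_distrib2 le_add_diff_inverse mult.commute)
    qed
    ultimately show ?thesis by blast
  qed
  moreover have "(\<Prod>H\<in>F. Q H) > 0" using Q_pos by (simp add: prod_pos)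
  ultimately show ?thesis by blast
qed

lemma mark_le: "mark {1..m} \<rho> H \<le> m"
  unfolding mark_def by (rule order.trans[OF card_mono[of "{1..m}"]]) auto

text \<open>Scaling both sides by the same factor keeps the equalities already reached, and what is
  added at level \<open>t\<close> is invisible at the lower levels.\<close>

lemma equalize_marks_below:
  assumes f: "f \<in> embeddings (sym_inv n) (sym_inv a)" and f': "f' \<in> embeddings (sym_inv n) (sym_inv b)"
  shows "\<exists>m m'. \<exists>g\<in>embeddings (sym_inv a) (sym_inv m). \<exists>g'\<in>embeddings (sym_inv b) (sym_inv m').
    \<forall>H. subgrp n H \<and> level n H < t \<longrightarrow> mark {1..m} g (f ` H) = mark {1..m'} g' (f' ` H)"
proof (induction t)
  case 0
  have "(\<lambda>x. x) \<in> embeddings (sym_inv k) (sym_inv k)" for k by (auto simp: embeddings_def homs_def)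
  then show ?case by auto
next
  case (Suc t)
  then obtain m m' g g' where g: "g \<in> embeddings (sym_inv a) (sym_inv m)" and g': "g' \<in> embeddings (sym_inv b) (sym_inv m')"
    and eq: "\<And>H. \<lbrakk>subgrp n H; level n H < t\<rbrakk> \<Longrightarrow> mark {1..m} g (f ` H) = mark {1..m'} g' (f' ` H)" by blast
  from equalize_marks_at_level[OF f g, of t] obtain q where q: "q > 0" and q_ex: "\<forall>D M. q dvd D \<and> D > 0 \<and> (\<forall>H. mark {1..m} g (f ` H) \<le> M) \<longrightarrow>
    (\<exists>l. \<exists>h\<in>embeddings (sym_inv a) (sym_inv l). \<forall>H. subgrp n H \<longrightarrow>
       (level n H < t \<longrightarrow> mark {1..l} h (f ` H) = D * mark {1..m} g (f ` H)) \<and>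
       (level n H = t \<longrightarrow> mark {1..l} h (f ` H) = D * M))"
    by (elim exE conjE)
  from equalize_marks_at_level[OF f' g', of t] obtain q' where q': "q' > 0" and q'_ex: "\<forall>D M. q' dvd D \<and> D > 0 \<and> (\<forall>H. mark {1..m'} g' (f' ` H) \<le> M) \<longrightarrow>
    (\<exists>l. \<exists>h\<in>embeddings (sym_inv b) (sym_inv l). \<forall>H. subgrp n H \<longrightarrow>
       (level n H < t \<longrightarrow> mark {1..l} h (f' ` H) = D * mark {1..m'} g' (f' ` H)) \<and>
       (level n H = t \<longrightarrow> mark {1..l} h (f' ` H) = D * M))"
    by (elim exE conjE)
  \<comment> \<open>A mark is at most the number of points, so \<open>max m m'\<close> is a common
    target for both sides. Likewise \<open>q * q'\<close> is a common multiple for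
    \<open>D\<close>.\<close>
  have le: "\<forall>H. mark {1..m} g (f ` H) \<le> max m m'" "\<forall>H. mark {1..m'} g' (f' ` H) \<le> max m m'"
    using mark_le le_max_iff_disj by metis+
  obtain l h where h: "h \<in> embeddings (sym_inv a) (sym_inv l)" "\<forall>H. subgrp n H \<longrightarrow>
       (level n H < t \<longrightarrow> mark {1..l} h (f ` H) = q * q' * mark {1..m} g (f ` H)) \<and>
       (level n H = t \<longrightarrow> mark {1..l} h (f ` H) = q * q' * max m m')"
    using q_ex[THEN spec, THEN spec, of "q * q'" "max m m'"] q q' le by auto
  obtain l' h' where h': "h' \<in> embeddings (sym_inv b) (sym_inv l')" "\<forall>H. subgrp n H \<longrightarrow>
       (level n H < t \<longrightarrow> mark {1..l'} h' (f' ` H) = q * q' * mark {1..m'} g' (f' ` H)) \<and>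
       (level n H = t \<longrightarrow> mark {1..l'} h' (f' ` H) = q * q' * max m m')"
    using q'_ex[THEN spec, THEN spec, of "q * q'" "max m m'"] q q' le by auto
  have "mark {1..l} h (f ` H) = mark {1..l'} h' (f' ` H)" if "subgrp n H" "level n H < Suc t" for H
    using that h(2) h'(2) eq by (metis less_Suc_eq)
  then show ?case using h(1) h'(1) by blast
qed

lemma equalize_marks:
  assumes f: "f \<in> embeddings (sym_inv n) (sym_inv a)" and f': "f' \<in> embeddings (sym_inv n) (sym_inv b)"
  shows "\<exists>m m'. \<exists>g\<in>embeddings (sym_inv a) (sym_inv m). \<exists>g'\<in>embeddings (sym_inv b) (sym_inv m').
    \<forall>H. subgrp n H \<longrightarrow> mark {1..m} g (f ` H) = mark {1..m'} g' (f' ` H)"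
proof -
  let ?N = "card (carrier (sym_inv n))"
  \<comment> \<open>The rank is at most \<open>n\<close> and the second summand of a level at most
    \<open>?N\<close>, so every level lies below \<open>?t\<close>.\<close>
  let ?t = "n * Suc ?N + ?N + 1"
  have "level n H < ?t" if "subgrp n H" for H
  proof -
    have "card (dm H) \<le> n" using card_mono[OF _ subgrpD(11)[OF that]] by simp
    then have "card (dm H) * Suc ?N \<le> n * Suc ?N" by (rule mult_le_mono1)
    then show ?thesis unfolding level_def by linarith
  qed
  then have "subgrp n H \<and> level n H < ?t \<longleftrightarrow> subgrp n H" for H by blast
  then show ?thesis using equalize_marks_below[OF f f', of ?t] by simp
qed

text \<open>\<open>H\<close> is the minimal ideal of \<open>W\<close>, its elements of least rank.
  An idempotent of \<open>H\<close> times \<open>w\<close> is an element of \<open>H\<close>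
  contained in \<open>w\<close>. By \<open>rep_mono\<close>, points fixed by \<open>H\<close> are
  then fixed by all of \<open>W\<close>.\<close>

lemma minimal_subgrp:
  assumes W: "inverse_subsemigroup W (sym_inv n)"
  obtains H where "subgrp n H" "H \<subseteq> W" "\<And>w. w \<in> W \<Longrightarrow> \<exists>h\<in>H. h \<subseteq> w"
proof -
  have ne: "W \<noteq> {}" and sub: "W \<subseteq> carrier (sym_inv n)" and mul: "\<And>x y. \<lbrakk>x \<in> W; y \<in> W\<rbrakk> \<Longrightarrow> x O y \<in> W"
    and inv: "\<And>x. x \<in> W \<Longrightarrow> x\<inverse> \<in> W" using W by (auto simp: inverse_subsemigroup_def)
  define k where "k = Min (card ` W)"
  have finW: "finite W" using sub by (meson finite_carrier_sym_inv finite_subset)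
  define H where "H = {h \<in> W. card h = k}"
  have k_le: "k \<le> card w" if "w \<in> W" for w using finW that by (simp add: k_def)
  have "k \<in> card ` W" using finW ne unfolding k_def by (intro Min_in) auto
  then have Hne: "H \<noteq> {}" by (auto simp: H_def)
  \<comment> \<open>A product has at most the rank of each factor, and no element of
    \<open>W\<close> has rank below \<open>k\<close>.\<close>
  have prod: "x O y \<in> H" "y O x \<in> H" if x: "x \<in> H" and y: "y \<in> W" for x y
  proof -
    have c: "x \<in> carrier (sym_inv n)" "x O y \<in> carrier (sym_inv n)" "y O x \<in> carrier (sym_inv n)"
      using x y sub mul by (auto simp: H_def)
    have "card (x O y) \<le> card x"
      using card_mono[OF finite_sym_inv(2)[OF c(1)], of "Domain (x O y)"] card_Domain_Range[OF c(1)] card_Domain_Range[OF c(2)] by fastforce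
    moreover have "card (y O x) \<le> card x"
      using card_mono[OF finite_sym_inv(3)[OF c(1)], of "Range (y O x)"] card_Domain_Range[OF c(1)] card_Domain_Range[OF c(3)] by fastforce
    ultimately show "x O y \<in> H" "y O x \<in> H"
      using mul[of x y] mul[of y x] k_le[of "x O y"] k_le[of "y O x"] x y by (auto simp: H_def)
  qed
  have "x\<inverse> \<in> H" if "x \<in> H" for x
    using that inv by (auto simp: H_def card_inverse)
  then have Hi: "inverse_subsemigroup H (sym_inv n)"
    using Hne prod(1) sub by (auto simp: inverse_subsemigroup_def H_def)
  \<comment> \<open>\<open>y O y\<inverse> O x\<close> is the restriction of \<open>x\<close> to the
    domain of \<open>y\<close>. It lies in \<open>H\<close> and so has the rank of \<open>x\<close>:
    the restriction loses nothing.\<close>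
  have "Domain x \<subseteq> Domain y" if x: "x \<in> H" and y: "y \<in> H" for x y
  proof -
    have W: "x \<in> W" "y \<in> W" using x y by (auto simp: H_def)
    have c: "x \<in> carrier (sym_inv n)" "y \<in> carrier (sym_inv n)" "y\<inverse> O x \<in> carrier (sym_inv n)" "y O y\<inverse> O x \<in> H"
      using W sub mul inv prod(2)[OF x] by (auto simp flip: O_assoc)
    have "Domain (y O y\<inverse> O x) = Domain x"
    proof (rule card_subset_eq)
      show "finite (Domain x)" using finite_sym_inv(2)[OF c(1)] .
      have "y O y\<inverse> O x = Id_on (Domain y) O x" using relcomp_converse(1)[OF c(2)] by (metis O_assoc)
      then show "Domain (y O y\<inverse> O x) \<subseteq> Domain x" by auto
      show "card (Domain (y O y\<inverse> O x)) = card (Domain x)"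
        using c(4) x card_Domain_Range(1)[of _ n] sub by (auto simp: H_def subset_iff)
    qed
    then show ?thesis by blast
  qed
  then have "Domain x = Domain (SOME y. y \<in> H)" if "x \<in> H" for x
    using that by (metis someI subset_antisym)
  from subgrpI(1)[OF Hi this] have "subgrp n H" .
  moreover have "\<exists>h\<in>H. h \<subseteq> w" if w: "w \<in> W" for w
  proof -
    obtain x where x: "x \<in> H" using Hne by blast
    then have "x O x\<inverse> \<in> H" using inv prod(1) by (auto simp: H_def)
    then have "x O x\<inverse> O w \<in> H" using prod(1)[OF _ w] by (metis O_assoc)
    moreover have "x O x\<inverse> O w \<subseteq> w"
    proof -
      have "x O x\<inverse> O w = Id_on (Domain x) O w"
        using relcomp_converse(1)[of x n] x sub by (metis (no_types, lifting) H_def O_assoc mem_Collect_eq subsetD)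
      then show ?thesis by auto
    qed
    ultimately show ?thesis by blast
  qed
  ultimately show thesis using that by (auto simp: H_def)
qed

text \<open>Inclusion of partial bijections is algebraic, namely
  \<open>x = x O x\<inverse> O y\<close>, so homomorphisms preserve it.\<close>

lemma rep_mono:
  assumes \<rho>: "rep (sym_inv n) P \<rho>" and x: "x \<in> carrier (sym_inv n)" and y: "y \<in> carrier (sym_inv n)" and "x \<subseteq> y"
  shows "\<rho> x \<subseteq> \<rho> y"
proof -
  have "x = x O x\<inverse> O y"
  proof -
    have "x O x\<inverse> O y = Id_on (Domain x) O y" using relcomp_converse(1)[OF x] by (metis O_assoc)
    moreover have "(p, q) \<in> x \<longleftrightarrow> p \<in> Domain x \<and> (p, q) \<in> y" for p q
      using \<open>x \<subseteq> y\<close> y unfolding carrier_sym_inv single_valued_def by blast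
    then have "Id_on (Domain x) O y = x" by auto
    ultimately show ?thesis by simp
  qed
  then have "\<rho> x = (\<rho> x O (\<rho> x)\<inverse>) O \<rho> y"
    using repD(4)[OF \<rho> x, of "x\<inverse> O y"] repD(4)[OF \<rho> sym_inv_closed(2)[OF x], of y] repD(5)[OF \<rho> x] x y
    by (simp add: sym_inv_closed O_assoc)
  moreover have "\<rho> x O (\<rho> x)\<inverse> \<subseteq> Id"
    using repD(3)[OF \<rho> x] by (auto simp: single_valued_def)
  then have "(\<rho> x O (\<rho> x)\<inverse>) O \<rho> y \<subseteq> \<rho> y" by blast
  ultimately show ?thesis by simp
qed

theorem sym_inv_amalgamation:
  assumes f: "f \<in> embeddings (sym_inv n) (sym_inv a)" and f': "f' \<in> embeddings (sym_inv n) (sym_inv b)"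
  obtains M g g' where "g \<in> embeddings (sym_inv a) (sym_inv M)" "g' \<in> embeddings (sym_inv b) (sym_inv M)"
    "\<And>x. x \<in> carrier (sym_inv n) \<Longrightarrow> g (f x) = g' (f' x)"
proof -
  obtain m m' g g' where g: "g \<in> embeddings (sym_inv a) (sym_inv m)" and g': "g' \<in> embeddings (sym_inv b) (sym_inv m')"
    and eq: "\<forall>H. subgrp n H \<longrightarrow> mark {1..m} g (f ` H) = mark {1..m'} g' (f' ` H)"
    using equalize_marks[OF f f'] by (elim exE bexE)
  \<comment> \<open>Points at which nothing is defined are added to give both actions the same set
    of points; marks of nonempty sets do not change.\<close>
  let ?M = "max m m'"
  have gM: "g \<in> embeddings (sym_inv a) (sym_inv ?M)" and g'M: "g' \<in> embeddings (sym_inv b) (sym_inv ?M)"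
    using embeddings_sym_inv_mono[OF g] embeddings_sym_inv_mono[OF g'] by auto
  have \<rho>: "rep (sym_inv n) {1..?M} (\<lambda>x. g (f x))" and \<sigma>: "rep (sym_inv n) {1..?M} (\<lambda>x. g' (f' x))"
    using homs_comp[OF embeddingsD(6)[OF f] embeddingsD(6)[OF gM]]
      homs_comp[OF embeddingsD(6)[OF f'] embeddingsD(6)[OF g'M]] by (simp_all add: homs_sym_inv)
  have mark_max: "mark {1..k} (\<lambda>x. u (v x)) H = mark {1..l} u (v ` H)"
    if u: "u \<in> embeddings (sym_inv d) (sym_inv l)" and v: "v \<in> embeddings (sym_inv n) (sym_inv d)"
      and H: "H \<subseteq> carrier (sym_inv n)" "H \<noteq> {}" and "l \<le> k" for u v d l k H
  proof -
    obtain h where h: "h \<in> H" using H by blast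
    then have "u (v h) \<subseteq> {1..l} \<times> {1..l}"
      using embeddingsD(1)[OF u] embeddingsD(1)[OF v] H unfolding carrier_sym_inv[of _ l] by blast
    then have "{p \<in> {1..k}. \<forall>h\<in>H. (p, p) \<in> u (v h)} = {p \<in> {1..l}. \<forall>h\<in>v ` H. (p, p) \<in> u h}"
      using h \<open>l \<le> k\<close> by fastforce
    then show ?thesis by (simp add: mark_def)
  qed
  have "mark {1..?M} (\<lambda>x. g (f x)) W = mark {1..?M} (\<lambda>x. g' (f' x)) W" if W: "inverse_subsemigroup W (sym_inv n)" for W
  proof -
    have Wc: "W \<subseteq> carrier (sym_inv n)" using W by (auto simp: inverse_subsemigroup_def)
    obtain H where H: "subgrp n H" "H \<subseteq> W" "\<And>w. w \<in> W \<Longrightarrow> \<exists>h\<in>H. h \<subseteq> w"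
      using minimal_subgrp[OF W] by blast
    have WH: "mark {1..?M} \<tau> W = mark {1..?M} \<tau> H" if \<tau>: "rep (sym_inv n) {1..?M} \<tau>" for \<tau>
    proof -
      have "(p, p) \<in> \<tau> w" if w: "w \<in> W" and p: "\<forall>h\<in>H. (p, p) \<in> \<tau> h" for p w
      proof -
        obtain h where "h \<in> H" "h \<subseteq> w" using H(3)[OF w] by blast
        then show ?thesis using rep_mono[OF \<tau>, of h w] p w Wc H(2) by blast
      qed
      then have "{p \<in> {1..?M}. \<forall>h\<in>W. (p, p) \<in> \<tau> h} = {p \<in> {1..?M}. \<forall>h\<in>H. (p, p) \<in> \<tau> h}"
        using H(2) by blast
      then show ?thesis by (simp add: mark_def)
    qed
    show ?thesis
      unfolding WH[OF \<rho>] WH[OF \<sigma>]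
      using mark_max[OF g f subgrpD(2,1)[OF H(1)], of ?M] mark_max[OF g' f' subgrpD(2,1)[OF H(1)], of ?M] eq H(1) by simp
  qed
  from equal_marks_conjugate[OF inverse_semigroup_sym_inv finite_carrier_sym_inv finite_atLeastAtMost \<rho> \<sigma> this]
  obtain \<pi> where \<pi>: "bij_betw \<pi> {1..?M} {1..?M}"
    "\<And>x. x \<in> carrier (sym_inv n) \<Longrightarrow> g' (f' x) = map_prod \<pi> \<pi> ` g (f x)" by blast
  have gr: "rep (sym_inv a) {1..?M} g" using embeddingsD(6)[OF gM] by (simp add: homs_sym_inv)
  \<comment> \<open>All of \<open>g\<close> is conjugated by \<open>\<pi>\<close>, not only its
    restriction to the copy of \<open>sym_inv n\<close>; the result is an embedding of
    \<open>sym_inv a\<close> compatible with \<open>g'\<close>.\<close>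
  have "(\<lambda>x. map_prod \<pi> \<pi> ` g x) \<in> embeddings (sym_inv a) (sym_inv ?M)"
    unfolding embeddings_def mem_Collect_eq homs_sym_inv
    using rep_conj[OF gr \<pi>(1)] inj_on_map_prod_image[OF gr, of \<pi>] embeddingsD(5)[OF gM] \<pi>(1) by (simp add: bij_betw_def)
  then show thesis using that g'M \<pi>(2) by force
qed

section \<open>Amalgamation bases\<close>

lemma inverse_semigroup_iso:
  assumes A: "inverse_semigroup A" and h: "h \<in> isos A B"
  shows "inverse_semigroup B"
proof -
  interpret A: inverse_semigroup A by fact
  note e = embeddingsD[OF isos_embeddings[OF h]]
  have B: "carrier B = h ` carrier A" using isos_surj[OF h] by simp
  note m = e(2)[symmetric] e(3)[symmetric]
  show ?thesis
  proof
    show "carrier B \<noteq> {}" using A.nonempty B by simp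
  next
    fix x y assume "x \<in> carrier B" "y \<in> carrier B"
    then show "x \<cdot>\<^bsub>B\<^esub> y \<in> carrier B" unfolding B by (auto simp: m A.mul_closed)
  next
    fix x assume "x \<in> carrier B"
    then show "sinv B x \<in> carrier B" unfolding B by (auto simp: m A.sinv_closed)
  next
    fix x y z assume "x \<in> carrier B" "y \<in> carrier B" "z \<in> carrier B"
    then show "x \<cdot>\<^bsub>B\<^esub> y \<cdot>\<^bsub>B\<^esub> z = x \<cdot>\<^bsub>B\<^esub> (y \<cdot>\<^bsub>B\<^esub> z)"
      unfolding B by (auto simp: m A.mul_closed A.mul_assoc)
  next
    fix x assume "x \<in> carrier B"
    then show "x \<cdot>\<^bsub>B\<^esub> sinv B x \<cdot>\<^bsub>B\<^esub> x = x"
      unfolding B by (auto simp: m A.mul_closed A.sinv_closed A.mul_sinv_mul)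
  next
    fix x assume "x \<in> carrier B"
    then show "sinv B x \<cdot>\<^bsub>B\<^esub> x \<cdot>\<^bsub>B\<^esub> sinv B x = sinv B x"
      unfolding B by (auto simp: m A.mul_closed A.sinv_closed A.sinv_mul_sinv)
  next
    fix x y assume *: "x \<in> carrier B" "y \<in> carrier B" "x \<cdot>\<^bsub>B\<^esub> y \<cdot>\<^bsub>B\<^esub> x = x" "y \<cdot>\<^bsub>B\<^esub> x \<cdot>\<^bsub>B\<^esub> y = y"
    obtain u v where uv: "u \<in> carrier A" "v \<in> carrier A" "x = h u" "y = h v" using *(1,2) unfolding B by auto
    have "u \<cdot>\<^bsub>A\<^esub> v \<cdot>\<^bsub>A\<^esub> u = u" "v \<cdot>\<^bsub>A\<^esub> u \<cdot>\<^bsub>A\<^esub> v = v"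
      using *(3,4) uv by (auto simp: m e(4) A.mul_closed)
    then have "v = sinv A u" using uv A.sinv_unique by blast
    then show "y = sinv B x" using uv by (simp add: m)
  qed
qed

lemma transport:
  assumes A: "inverse_semigroup A" and h: "inj_on h (carrier A)"
  obtains B where "h \<in> isos A B" "inverse_semigroup B"
proof -
  let ?g = "inv_into (carrier A) h"
  define B where "B = \<lparr>carrier = h ` carrier A, mul = \<lambda>x y. h (?g x \<cdot>\<^bsub>A\<^esub> ?g y), sinv = \<lambda>x. h (sinv A (?g x))\<rparr>"
  have "h \<in> isos A B" using h by (auto simp: isos_def homs_def B_def bij_betw_def)
  then show thesis using that inverse_semigroup_iso[OF A] by blast
qed

text \<open>Passes to the natural numbers, over which the definitions of universality, amalgamation
  bases and maximal homogeneity quantify.\<close>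

lemma nat_copy:
  assumes "finite_inverse_semigroup A"
  obtains B :: "nat inv_alg" and h where "finite_inverse_semigroup B" "h \<in> isos A B"
proof -
  obtain h :: "'a \<Rightarrow> nat" where h: "inj_on h (carrier A)"
    using assms finite_imp_inj_to_nat_seg by (metis finite_inverse_semigroup_def)
  obtain B where "h \<in> isos A B" "inverse_semigroup B"
    using transport[OF _ h] assms by (metis finite_inverse_semigroup_def)
  moreover have "finite (carrier B)"
    using isos_surj[OF calculation(1)] assms by (metis finite_imageI finite_inverse_semigroup_def)
  ultimately show thesis using that by (simp add: finite_inverse_semigroup_def)
qed

lemma amalgamation_base_iso:
  assumes A: "amalgamation_base A" and h: "h \<in> isos A B"
  shows "amalgamation_base B"
  unfolding amalgamation_base_def
proof (intro conjI allI impI ballI)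
  have "finite_inverse_semigroup A" using A by (simp add: amalgamation_base_def)
  then show "finite_inverse_semigroup B"
    using inverse_semigroup_iso[OF _ h] isos_surj[OF h]
    by (metis finite_imageI finite_inverse_semigroup_def)
  fix A1 A2 :: "nat inv_alg" and f1 f2
  assume *: "finite_inverse_semigroup A1" "finite_inverse_semigroup A2" and f: "f1 \<in> embeddings B A1" "f2 \<in> embeddings B A2"
  have "(\<lambda>x. f1 (h x)) \<in> embeddings A A1" "(\<lambda>x. f2 (h x)) \<in> embeddings A A2"
    using embeddings_comp[OF isos_embeddings[OF h]] f by auto
  then obtain C :: "nat inv_alg" and g1 g2 where "finite_inverse_semigroup C" "g1 \<in> embeddings A1 C" "g2 \<in> embeddings A2 C"
      "\<forall>x\<in>carrier A. g1 (f1 (h x)) = g2 (f2 (h x))"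
    using A * unfolding amalgamation_base_def by meson
  moreover have "carrier B = h ` carrier A" using isos_surj[OF h] by simp
  ultimately show "\<exists>C :: nat inv_alg. finite_inverse_semigroup C \<and>
      (\<exists>g1\<in>embeddings A1 C. \<exists>g2\<in>embeddings A2 C. \<forall>x\<in>carrier B. g1 (f1 x) = g2 (f2 x))"
    by (intro exI[of _ C] conjI bexI[of _ g1] bexI[of _ g2]) simp_all
qed

text \<open>Embedding \<open>A1\<close> and \<open>A2\<close> by Wagner-Preston reduces arbitrary
  finite extensions to symmetric ones.\<close>

lemma amalgamation_base_sym_inv: "amalgamation_base (sym_inv n)"
  unfolding amalgamation_base_def
proof (intro conjI allI impI ballI)
  fix A1 A2 :: "nat inv_alg" and f1 f2
  assume A1: "finite_inverse_semigroup A1" and A2: "finite_inverse_semigroup A2"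
    and f: "f1 \<in> embeddings (sym_inv n) A1" "f2 \<in> embeddings (sym_inv n) A2"
  obtain a w1 where w1: "w1 \<in> embeddings A1 (sym_inv a)" using Wagner_Preston[OF A1] .
  obtain b w2 where w2: "w2 \<in> embeddings A2 (sym_inv b)" using Wagner_Preston[OF A2] .
  obtain M g g' where g: "g \<in> embeddings (sym_inv a) (sym_inv M)" "g' \<in> embeddings (sym_inv b) (sym_inv M)"
    "\<And>x. x \<in> carrier (sym_inv n) \<Longrightarrow> g (w1 (f1 x)) = g' (w2 (f2 x))"
    using sym_inv_amalgamation[OF embeddings_comp[OF f(1) w1] embeddings_comp[OF f(2) w2]] by metis
  obtain B :: "nat inv_alg" and h where B: "finite_inverse_semigroup B" "h \<in> isos (sym_inv M) B"
    using nat_copy[OF finite_inverse_semigroup_sym_inv] .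
  have "(\<lambda>x. h (g (w1 x))) \<in> embeddings A1 B" "(\<lambda>x. h (g' (w2 x))) \<in> embeddings A2 B"
    using embeddings_comp[OF embeddings_comp[OF w1 g(1)] isos_embeddings[OF B(2)]]
      embeddings_comp[OF embeddings_comp[OF w2 g(2)] isos_embeddings[OF B(2)]] by auto
  moreover have "\<forall>x\<in>carrier (sym_inv n). h (g (w1 (f1 x))) = h (g' (w2 (f2 x)))" using g(3) by simp
  ultimately show "\<exists>B :: nat inv_alg. finite_inverse_semigroup B \<and>
      (\<exists>g1\<in>embeddings A1 B. \<exists>g2\<in>embeddings A2 B. \<forall>x\<in>carrier (sym_inv n). g1 (f1 x) = g2 (f2 x))"
    using B(1) by (intro exI[of _ B] conjI bexI[of _ "\<lambda>x. h (g (w1 x))"] bexI[of _ "\<lambda>x. h (g' (w2 x))"])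
qed simp

text \<open>The amalgam provided by the definition is embedded in some \<open>sym_inv M\<close>, so
  that it can become a stage of a chain of symmetric inverse semigroups.\<close>

lemma amalgamation_base_sym_invD:
  assumes A: "amalgamation_base A" and f: "f \<in> embeddings A (sym_inv a)" "f' \<in> embeddings A (sym_inv b)"
  shows "\<exists>M. \<exists>g\<in>embeddings (sym_inv a) (sym_inv M). \<exists>g'\<in>embeddings (sym_inv b) (sym_inv M).
    \<forall>x\<in>carrier A. g (f x) = g' (f' x)"
proof -
  obtain A1 :: "nat inv_alg" and h1 where A1: "finite_inverse_semigroup A1" "h1 \<in> isos (sym_inv a) A1"
    using nat_copy[OF finite_inverse_semigroup_sym_inv] .
  obtain A2 :: "nat inv_alg" and h2 where A2: "finite_inverse_semigroup A2" "h2 \<in> isos (sym_inv b) A2"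
    using nat_copy[OF finite_inverse_semigroup_sym_inv] .
  have h: "h1 \<in> embeddings (sym_inv a) A1" "h2 \<in> embeddings (sym_inv b) A2"
    using A1(2) A2(2) isos_embeddings by auto
  obtain C :: "nat inv_alg" and g1 g2 where C: "finite_inverse_semigroup C" "g1 \<in> embeddings A1 C" "g2 \<in> embeddings A2 C"
      "\<forall>x\<in>carrier A. g1 (h1 (f x)) = g2 (h2 (f' x))"
    using A A1(1) A2(1) embeddings_comp[OF f(1) h(1)] embeddings_comp[OF f(2) h(2)]
    unfolding amalgamation_base_def by meson
  obtain M w where w: "w \<in> embeddings C (sym_inv M)" using Wagner_Preston[OF C(1)] .
  show ?thesis
    by (rule exI, rule bexI[OF _ embeddings_comp[OF embeddings_comp[OF h(1) C(2)] w]],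
        rule bexI[OF _ embeddings_comp[OF embeddings_comp[OF h(2) C(3)] w]]) (use C(4) in simp)
qed

lemma isos_image:
  assumes "f \<in> embeddings A S"
  shows "f \<in> isos A (S\<lparr>carrier := f ` carrier A\<rparr>)"
  using assms by (auto simp: isos_def embeddings_def homs_def bij_betw_def)

lemma embeddings_substructure:
  "\<lbrakk>f \<in> embeddings A (S\<lparr>carrier := H\<rparr>); H \<subseteq> carrier S\<rbrakk> \<Longrightarrow> f \<in> embeddings A S"
  by (auto simp: embeddings_def homs_def inj_on_def subset_iff)

section \<open>Exhaustions by finite symmetric inverse semigroups\<close>

text \<open>A limit seen from inside. Connecting maps stay implicit:
  \<open>\<kappa> (Suc k) y = \<kappa> k x\<close> says that \<open>y\<close> is the image of
  \<open>x\<close> at the next stage. In this form one passes easily to subsequences of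
  stages.\<close>

definition exhaustion :: "'a inv_alg \<Rightarrow> (nat \<Rightarrow> nat) \<Rightarrow> (nat \<Rightarrow> (nat \<times> nat) set \<Rightarrow> 'a) \<Rightarrow> bool" where
  "exhaustion S i \<kappa> \<longleftrightarrow> (\<forall>k. \<kappa> k \<in> embeddings (sym_inv (i k)) S) \<and>
     (\<forall>k. \<kappa> k ` carrier (sym_inv (i k)) \<subseteq> \<kappa> (Suc k) ` carrier (sym_inv (i (Suc k)))) \<and>
     carrier S = (\<Union>k. \<kappa> k ` carrier (sym_inv (i k)))"

lemma exhaustion_mono:
  assumes "exhaustion S i \<kappa>" "k \<le> l"
  shows "\<kappa> k ` carrier (sym_inv (i k)) \<subseteq> \<kappa> l ` carrier (sym_inv (i l))"
  using assms lift_Suc_mono_le[of "\<lambda>k. \<kappa> k ` carrier (sym_inv (i k))"] by (simp add: exhaustion_def)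

lemma exhaustion_finite_subset:
  assumes S: "exhaustion S i \<kappa>" and "finite X" "X \<subseteq> carrier S"
  shows "\<exists>k\<ge>l. X \<subseteq> \<kappa> k ` carrier (sym_inv (i k))"
  using assms(2,3)
proof (induction X)
  case (insert x X)
  then obtain k where k: "k \<ge> l" "X \<subseteq> \<kappa> k ` carrier (sym_inv (i k))" by auto
  obtain m where m: "x \<in> \<kappa> m ` carrier (sym_inv (i m))" using insert.prems S by (auto simp: exhaustion_def)
  have "insert x X \<subseteq> \<kappa> (max k m) ` carrier (sym_inv (i (max k m)))"
    using k(2) m exhaustion_mono[OF S, of k "max k m"] exhaustion_mono[OF S, of m "max k m"] by auto
  then show ?case using k(1) by (meson max.coboundedI1)
qed auto

lemma exhaustion_factor:
  assumes S: "exhaustion S i \<kappa>" and A: "finite_inverse_semigroup A" and f: "f \<in> embeddings A S"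
  obtains k h where "k \<ge> l" "h \<in> embeddings A (sym_inv (i k))" "\<And>x. x \<in> carrier A \<Longrightarrow> \<kappa> k (h x) = f x"
proof -
  have "finite (f ` carrier A)" "f ` carrier A \<subseteq> carrier S"
    using A embeddingsD(1)[OF f] by (auto simp: finite_inverse_semigroup_def)
  then obtain k where k: "k \<ge> l" "f ` carrier A \<subseteq> \<kappa> k ` carrier (sym_inv (i k))"
    using exhaustion_finite_subset[OF S] by metis
  have "\<exists>h\<in>embeddings A (sym_inv (i k)). \<forall>x\<in>carrier A. \<kappa> k (h x) = f x"
    using S A k(2) by (intro embeddings_factor[OF _ _ f]) (auto simp: exhaustion_def finite_inverse_semigroup_def)
  then show thesis using that k(1) by blast
qed

text \<open>\<open>\<alpha>\<close> is read off at any stage containing the element, and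
  \<open>comp\<close> makes the value independent of the stage. Any two elements share a stage, so
  the laws and injectivity come from the \<open>\<phi> k\<close>.\<close>

lemma exhaustion_glue:
  assumes S: "exhaustion S i \<kappa>" and \<phi>: "\<And>k. \<phi> k \<in> embeddings (sym_inv (i k)) T"
    and comp: "\<And>k x y. \<lbrakk>x \<in> carrier (sym_inv (i k)); y \<in> carrier (sym_inv (i (Suc k))); \<kappa> (Suc k) y = \<kappa> k x\<rbrakk>
      \<Longrightarrow> \<phi> (Suc k) y = \<phi> k x"
    and surj: "carrier T = (\<Union>k. \<phi> k ` carrier (sym_inv (i k)))"
  obtains \<alpha> where "\<alpha> \<in> isos S T" "\<And>k x. x \<in> carrier (sym_inv (i k)) \<Longrightarrow> \<alpha> (\<kappa> k x) = \<phi> k x"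
proof -
  have \<kappa>: "\<kappa> k \<in> embeddings (sym_inv (i k)) S" for k using S by (simp add: exhaustion_def)
  have comp': "\<phi> l y = \<phi> k x"
    if "k \<le> l" "x \<in> carrier (sym_inv (i k))" "y \<in> carrier (sym_inv (i l))" "\<kappa> l y = \<kappa> k x" for k l x y
    using that
  proof (induction l arbitrary: y rule: dec_induct)
    case base
    then show ?case using embeddingsD(4)[OF \<kappa>] by simp
  next
    case (step l)
    obtain z where z: "z \<in> carrier (sym_inv (i l))" "\<kappa> l z = \<kappa> k x"
      using exhaustion_mono[OF S step.hyps(1)] step.prems(1) by force
    then have "\<phi> l z = \<phi> k x" using step by blast
    then show ?case using comp[OF z(1) step.prems(2)] step.prems(3) z(2) by simp
  qed
  have "\<forall>s\<in>carrier S. \<exists>k x. x \<in> carrier (sym_inv (i k)) \<and> \<kappa> k x = s"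
    using S by (force simp: exhaustion_def)
  then obtain K X where KX: "\<And>s. s \<in> carrier S \<Longrightarrow> X s \<in> carrier (sym_inv (i (K s))) \<and> \<kappa> (K s) (X s) = s"
    by metis
  define \<alpha> where "\<alpha> s = \<phi> (K s) (X s)" for s
  have \<alpha>: "\<alpha> (\<kappa> k x) = \<phi> k x" if "x \<in> carrier (sym_inv (i k))" for k x
  proof -
    have "\<kappa> k x \<in> carrier S" using embeddingsD(1)[OF \<kappa> that] .
    from KX[OF this] have K: "X (\<kappa> k x) \<in> carrier (sym_inv (i (K (\<kappa> k x))))" "\<kappa> (K (\<kappa> k x)) (X (\<kappa> k x)) = \<kappa> k x"
      by auto
    show ?thesis unfolding \<alpha>_def
      using comp'[OF _ that K] comp'[OF _ K(1) that K(2)[symmetric]] by (cases "k \<le> K (\<kappa> k x)") auto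
  qed
  have pair: "\<exists>k x y. x \<in> carrier (sym_inv (i k)) \<and> y \<in> carrier (sym_inv (i k)) \<and> s = \<kappa> k x \<and> t = \<kappa> k y"
    if st: "s \<in> carrier S" "t \<in> carrier S" for s t
  proof -
    obtain k where "{s, t} \<subseteq> \<kappa> k ` carrier (sym_inv (i k))"
      using exhaustion_finite_subset[OF S, of "{s, t}" 0] st by auto
    then obtain x y where "x \<in> carrier (sym_inv (i k))" "y \<in> carrier (sym_inv (i k))" "s = \<kappa> k x" "t = \<kappa> k y"
      by (auto simp: image_iff)
    then show ?thesis by (intro exI conjI)
  qed
  have "\<alpha> \<in> embeddings S T"
    unfolding embeddings_def homs_def mem_Collect_eq
  proof (intro conjI ballI inj_onI)
    show "\<alpha> ` carrier S \<subseteq> carrier T" using KX embeddingsD(1)[OF \<phi>] by (auto simp: \<alpha>_def)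
  next
    fix s t assume "s \<in> carrier S" "t \<in> carrier S"
    then obtain k x y where st: "x \<in> carrier (sym_inv (i k))" "y \<in> carrier (sym_inv (i k))" "s = \<kappa> k x" "t = \<kappa> k y"
      using pair by blast
    have "s \<cdot>\<^bsub>S\<^esub> t = \<kappa> k (x O y)" using embeddingsD(2)[OF \<kappa> st(1,2)] st by simp
    then show "\<alpha> (s \<cdot>\<^bsub>S\<^esub> t) = \<alpha> s \<cdot>\<^bsub>T\<^esub> \<alpha> t"
      using \<alpha> st sym_inv_closed(1)[OF st(1,2)] embeddingsD(2)[OF \<phi> st(1,2)] by simp
  next
    fix s assume "s \<in> carrier S"
    then obtain k x where s: "x \<in> carrier (sym_inv (i k))" "s = \<kappa> k x" using pair by blast
    have "sinv S s = \<kappa> k (x\<inverse>)" using embeddingsD(3)[OF \<kappa> s(1)] s by simp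
    then show "\<alpha> (sinv S s) = sinv T (\<alpha> s)"
      using \<alpha> s sym_inv_closed(2)[OF s(1)] embeddingsD(3)[OF \<phi> s(1)] by simp
  next
    fix s t assume "s \<in> carrier S" "t \<in> carrier S" "\<alpha> s = \<alpha> t"
    then show "s = t" using pair[of s t] \<alpha> embeddingsD(4)[OF \<phi>] by metis
  qed
  moreover have "\<alpha> ` carrier S = carrier T"
  proof
    show "\<alpha> ` carrier S \<subseteq> carrier T" using KX embeddingsD(1)[OF \<phi>] by (auto simp: \<alpha>_def)
    show "carrier T \<subseteq> \<alpha> ` carrier S"
    proof
      fix t assume "t \<in> carrier T"
      then obtain k x where "x \<in> carrier (sym_inv (i k))" "t = \<phi> k x" unfolding surj by blast
      then show "t \<in> \<alpha> ` carrier S" using \<alpha> embeddingsD(1)[OF \<kappa>] by (metis image_eqI)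
    qed
  qed
  ultimately have "\<alpha> \<in> isos S T" by (rule isosI)
  then show thesis using \<alpha> by (rule that)
qed

section \<open>Back and forth between two exhaustions\<close>

definition extends_embeddings :: "'a inv_alg \<Rightarrow> bool" where
  "extends_embeddings S \<longleftrightarrow> (\<forall>n m. \<forall>f\<in>embeddings (sym_inv n) (sym_inv m). \<forall>h\<in>embeddings (sym_inv n) S.
     \<exists>h'\<in>embeddings (sym_inv m) S. \<forall>x\<in>carrier (sym_inv n). h' (f x) = h x)"

text \<open>A zigzag: \<open>\<phi>\<close> lands in stage \<open>l\<close> of \<open>T\<close>; the
  extension property of \<open>S\<close> carries that stage back into a stage \<open>k'\<close> of
  \<open>S\<close>, and the one of \<open>T\<close> carries \<open>k'\<close> forth again. Taking
  \<open>l \<ge> n\<close> puts stage \<open>n\<close> of \<open>T\<close> into the new image, and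
  \<open>k' > n\<close> makes the domains exhaust \<open>S\<close>.\<close>

lemma back_and_forth_step:
  assumes S: "exhaustion S i \<kappa>" "extends_embeddings S" and T: "exhaustion T j \<theta>" "extends_embeddings T"
    and \<phi>: "\<phi> \<in> embeddings (sym_inv (i k)) T"
  obtains k' \<phi>' where "k' > k" "k' > n" "\<phi>' \<in> embeddings (sym_inv (i k')) T"
    "\<And>x y. \<lbrakk>x \<in> carrier (sym_inv (i k)); y \<in> carrier (sym_inv (i k')); \<kappa> k' y = \<kappa> k x\<rbrakk> \<Longrightarrow> \<phi>' y = \<phi> x"
    "\<theta> n ` carrier (sym_inv (j n)) \<subseteq> \<phi>' ` carrier (sym_inv (i k'))"
proof -
  have \<kappa>: "\<kappa> l \<in> embeddings (sym_inv (i l)) S" and \<theta>: "\<theta> l \<in> embeddings (sym_inv (j l)) T" for l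
    using S(1) T(1) by (simp_all add: exhaustion_def)
  obtain l f where f: "l \<ge> n" "f \<in> embeddings (sym_inv (i k)) (sym_inv (j l))"
    "\<And>x. x \<in> carrier (sym_inv (i k)) \<Longrightarrow> \<theta> l (f x) = \<phi> x"
    using exhaustion_factor[OF T(1) finite_inverse_semigroup_sym_inv \<phi>] by blast
  obtain \<psi> where \<psi>: "\<psi> \<in> embeddings (sym_inv (j l)) S" "\<And>x. x \<in> carrier (sym_inv (i k)) \<Longrightarrow> \<psi> (f x) = \<kappa> k x"
    using S(2) f(2) \<kappa>[of k] unfolding extends_embeddings_def by blast
  obtain k' f' where f': "k' \<ge> Suc (max k n)" "f' \<in> embeddings (sym_inv (j l)) (sym_inv (i k'))"
    "\<And>x. x \<in> carrier (sym_inv (j l)) \<Longrightarrow> \<kappa> k' (f' x) = \<psi> x"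
    using exhaustion_factor[OF S(1) finite_inverse_semigroup_sym_inv \<psi>(1)] by blast
  obtain \<phi>' where \<phi>': "\<phi>' \<in> embeddings (sym_inv (i k')) T" "\<And>x. x \<in> carrier (sym_inv (j l)) \<Longrightarrow> \<phi>' (f' x) = \<theta> l x"
    using T(2) f'(2) \<theta>[of l] unfolding extends_embeddings_def by blast
  show thesis
  proof (rule that)
    show "\<phi>' \<in> embeddings (sym_inv (i k')) T" by fact
    show "k' > k" "k' > n" using f'(1) by auto
    fix x y assume x: "x \<in> carrier (sym_inv (i k))" and y: "y \<in> carrier (sym_inv (i k'))" "\<kappa> k' y = \<kappa> k x"
    have fx: "f x \<in> carrier (sym_inv (j l))" using embeddingsD(1)[OF f(2) x] .
    then have "\<kappa> k' y = \<kappa> k' (f' (f x))" using y \<psi>(2)[OF x] f'(3) by simp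
    then have "y = f' (f x)" using embeddingsD(4)[OF \<kappa> y(1)] embeddingsD(1)[OF f'(2) fx] by simp
    then show "\<phi>' y = \<phi> x" using \<phi>'(2)[OF fx] f(3)[OF x] by simp
  next
    have "\<theta> n ` carrier (sym_inv (j n)) \<subseteq> \<theta> l ` carrier (sym_inv (j l))" using exhaustion_mono[OF T(1) f(1)] .
    also have "\<dots> \<subseteq> \<phi>' ` carrier (sym_inv (i k'))"
      using \<phi>'(2) embeddingsD(1)[OF f'(2)] by (metis image_eqI image_subsetI)
    finally show "\<theta> n ` carrier (sym_inv (j n)) \<subseteq> \<phi>' ` carrier (sym_inv (i k'))" .
  qed
qed

text \<open>Stage \<open>n\<close> is guaranteed to be absorbed only at step \<open>Suc n\<close>,
  hence the shift.\<close>

lemma UN_subset_UN_Suc: "(\<And>n. A n \<subseteq> B (Suc n)) \<Longrightarrow> (\<Union>n. A n) \<subseteq> (\<Union>n. B n)"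
  by blast

lemma back_and_forth:
  assumes S: "exhaustion S i \<kappa>" "extends_embeddings S" and T: "exhaustion T j \<theta>" "extends_embeddings T"
    and \<phi>: "\<phi> \<in> embeddings (sym_inv (i k)) T"
  obtains \<alpha> where "\<alpha> \<in> isos S T" "\<And>x. x \<in> carrier (sym_inv (i k)) \<Longrightarrow> \<alpha> (\<kappa> k x) = \<phi> x"
proof -
  \<comment> \<open>A state is a stage of \<open>S\<close> with an embedding of it in
    \<open>T\<close>. The clause for \<open>n = 0\<close> pins the start to the given
    \<open>\<phi>\<close>, which \<open>\<alpha>\<close> has to extend.\<close>
  let ?P = "\<lambda>(n :: nat) p. snd p \<in> embeddings (sym_inv (i (fst p))) T \<and> (n = 0 \<longrightarrow> p = (k, \<phi>))"
  let ?Q = "\<lambda>(n :: nat) p p'. fst p' > fst p \<and> fst p' > n \<and>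
    (\<forall>x\<in>carrier (sym_inv (i (fst p))). \<forall>y\<in>carrier (sym_inv (i (fst p'))).
       \<kappa> (fst p') y = \<kappa> (fst p) x \<longrightarrow> snd p' y = snd p x) \<and>
    \<theta> n ` carrier (sym_inv (j n)) \<subseteq> snd p' ` carrier (sym_inv (i (fst p')))"
  have "\<exists>p. \<forall>n. ?P n (p n) \<and> ?Q n (p n) (p (Suc n))"
  proof (rule dependent_nat_choice)
    show "\<exists>p. ?P 0 p" using \<phi> by auto
    fix p :: "nat \<times> ((nat \<times> nat) set \<Rightarrow> 'b)" and n assume p: "?P n p"
    then have "snd p \<in> embeddings (sym_inv (i (fst p))) T" by blast
    from back_and_forth_step[OF S T this, of n] obtain k' \<phi>' where "k' > fst p" "k' > n" "\<phi>' \<in> embeddings (sym_inv (i k')) T"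
      "\<And>x y. \<lbrakk>x \<in> carrier (sym_inv (i (fst p))); y \<in> carrier (sym_inv (i k')); \<kappa> k' y = \<kappa> (fst p) x\<rbrakk> \<Longrightarrow> \<phi>' y = snd p x"
      "\<theta> n ` carrier (sym_inv (j n)) \<subseteq> \<phi>' ` carrier (sym_inv (i k'))" by metis
    then show "\<exists>p'. ?P (Suc n) p' \<and> ?Q n p p'" by (intro exI[of _ "(k', \<phi>')"]) simp
  qed
  then obtain p where PQ: "\<forall>n. ?P n (p n) \<and> ?Q n (p n) (p (Suc n))" by (elim exE)
  have P: "?P n (p n)" and Q: "?Q n (p n) (p (Suc n))" for n
    using spec[OF PQ, of n] by (rule conjunct1, rule conjunct2)
  \<comment> \<open>The stages visited still exhaust \<open>S\<close>, since the one of step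
    \<open>Suc n\<close> exceeds \<open>n\<close>.\<close>
  have S': "exhaustion S (\<lambda>n. i (fst (p n))) (\<lambda>n. \<kappa> (fst (p n)))"
    unfolding exhaustion_def
  proof (intro conjI allI)
    show "\<kappa> (fst (p n)) \<in> embeddings (sym_inv (i (fst (p n)))) S" for n using S(1) by (simp add: exhaustion_def)
    show "\<kappa> (fst (p n)) ` carrier (sym_inv (i (fst (p n)))) \<subseteq> \<kappa> (fst (p (Suc n))) ` carrier (sym_inv (i (fst (p (Suc n)))))" for n
      using exhaustion_mono[OF S(1)] Q[of n] by simp
    have "\<kappa> n ` carrier (sym_inv (i n)) \<subseteq> \<kappa> (fst (p (Suc n))) ` carrier (sym_inv (i (fst (p (Suc n)))))" for n
      using exhaustion_mono[OF S(1)] Q[of n] by simp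
    then have "carrier S \<subseteq> (\<Union>n. \<kappa> (fst (p n)) ` carrier (sym_inv (i (fst (p n)))))"
      using S(1) UN_subset_UN_Suc[of "\<lambda>n. \<kappa> n ` carrier (sym_inv (i n))" "\<lambda>n. \<kappa> (fst (p n)) ` carrier (sym_inv (i (fst (p n))))"]
      by (simp add: exhaustion_def)
    moreover have "(\<Union>n. \<kappa> (fst (p n)) ` carrier (sym_inv (i (fst (p n))))) \<subseteq> carrier S"
      using S(1) unfolding exhaustion_def by blast
    ultimately show "carrier S = (\<Union>n. \<kappa> (fst (p n)) ` carrier (sym_inv (i (fst (p n)))))" by blast
  qed
  have surj: "carrier T = (\<Union>n. snd (p n) ` carrier (sym_inv (i (fst (p n)))))"
  proof
    show "carrier T \<subseteq> (\<Union>n. snd (p n) ` carrier (sym_inv (i (fst (p n)))))"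
      using T(1) UN_subset_UN_Suc[of "\<lambda>n. \<theta> n ` carrier (sym_inv (j n))" "\<lambda>n. snd (p n) ` carrier (sym_inv (i (fst (p n))))"] Q
      by (simp add: exhaustion_def)
    show "(\<Union>n. snd (p n) ` carrier (sym_inv (i (fst (p n))))) \<subseteq> carrier T"
      using P embeddingsD(1)[of "snd (p _)" "sym_inv (i (fst (p _)))" T] by blast
  qed
  have "\<exists>\<alpha>\<in>isos S T. \<forall>n. \<forall>x\<in>carrier (sym_inv (i (fst (p n)))). \<alpha> (\<kappa> (fst (p n)) x) = snd (p n) x"
  proof (rule exhaustion_glue[OF S', of "\<lambda>n. snd (p n)" T])
    show "snd (p n) \<in> embeddings (sym_inv (i (fst (p n)))) T" for n using P by simp
    show "snd (p (Suc n)) y = snd (p n) x"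
      if "x \<in> carrier (sym_inv (i (fst (p n))))" "y \<in> carrier (sym_inv (i (fst (p (Suc n)))))"
        "\<kappa> (fst (p (Suc n))) y = \<kappa> (fst (p n)) x" for n x y
      using Q[of n] that by simp
  qed (use surj in blast)+
  then obtain \<alpha> where \<alpha>: "\<alpha> \<in> isos S T"
    "\<forall>n. \<forall>x\<in>carrier (sym_inv (i (fst (p n)))). \<alpha> (\<kappa> (fst (p n)) x) = snd (p n) x" by (elim bexE)
  have "p 0 = (k, \<phi>)" using P[of 0] by simp
  then show thesis using that \<alpha>(1) spec[OF \<alpha>(2), of 0] by simp
qed

section \<open>Direct limits\<close>

locale embedding_chain =
  fixes A :: "nat \<Rightarrow> 'a inv_alg" and e :: "nat \<Rightarrow> 'a \<Rightarrow> 'a"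
  assumes inverse_semigroup: "inverse_semigroup (A k)"
    and embedding: "e k \<in> embeddings (A k) (A (Suc k))"
begin

abbreviation tr :: "nat \<Rightarrow> nat \<Rightarrow> 'a \<Rightarrow> 'a" where
  "tr k m \<equiv> fold e [k..<m]"

abbreviation cls :: "nat \<Rightarrow> 'a \<Rightarrow> (nat \<times> 'a) set" where
  "cls k x \<equiv> limit_rel A e `` {(k, x)}"

lemma tr_embedding: "k \<le> m \<Longrightarrow> tr k m \<in> embeddings (A k) (A m)"
proof (induction m rule: dec_induct)
  case base
  then show ?case by (auto simp: embeddings_def homs_def)
next
  case (step m)
  have "tr k (Suc m) = (\<lambda>x. e m (tr k m x))" using step.hyps(1) by auto
  then show ?case using embeddings_comp[OF step.IH embedding] by simp
qed

lemma tr_tr: "\<lbrakk>k \<le> l; l \<le> m\<rbrakk> \<Longrightarrow> tr l m (tr k l x) = tr k m x"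
  by (metis comp_apply fold_append le_add_diff_inverse upt_add_eq_append)

text \<open>Connecting maps are injective, so eventual equality can be tested at any common stage
  \<open>m\<close>.\<close>

lemma limit_rel_iff:
  assumes "k \<le> m" "l \<le> m"
  shows "((k, x), (l, y)) \<in> limit_rel A e \<longleftrightarrow> x \<in> carrier (A k) \<and> y \<in> carrier (A l) \<and> tr k m x = tr l m y"
proof
  assume "((k, x), (l, y)) \<in> limit_rel A e"
  then obtain j where j: "x \<in> carrier (A k)" "y \<in> carrier (A l)" "max k l \<le> j" "tr k j x = tr l j y"
    by (auto simp: limit_rel_def)
  let ?n = "max j m"
  have "tr m ?n (tr k m x) = tr j ?n (tr k j x)" using assms j(3) by (simp add: tr_tr)
  also have "\<dots> = tr m ?n (tr l m y)" using assms j(3,4) by (simp add: tr_tr)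
  finally have "tr k m x = tr l m y"
    using embeddingsD(4)[OF tr_embedding[of m ?n]] embeddingsD(1)[OF tr_embedding] assms j(1,2) by simp
  then show "x \<in> carrier (A k) \<and> y \<in> carrier (A l) \<and> tr k m x = tr l m y" using j by simp
next
  assume "x \<in> carrier (A k) \<and> y \<in> carrier (A l) \<and> tr k m x = tr l m y"
  then show "((k, x), (l, y)) \<in> limit_rel A e" using assms by (auto simp: limit_rel_def)
qed

lemma equiv_limit_rel: "equiv (SIGMA k:UNIV. carrier (A k)) (limit_rel A e)"
proof (rule equivI)
  show "limit_rel A e \<subseteq> (SIGMA k:UNIV. carrier (A k)) \<times> (SIGMA k:UNIV. carrier (A k))"
    by (auto simp: limit_rel_def)
  show "refl_on (SIGMA k:UNIV. carrier (A k)) (limit_rel A e)"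
    by (auto simp: refl_on_def limit_rel_def)
  show "sym (limit_rel A e)"
    by (auto simp: sym_def limit_rel_def max.commute)
  show "trans (limit_rel A e)"
  proof (rule transI)
    fix p q r assume *: "(p, q) \<in> limit_rel A e" "(q, r) \<in> limit_rel A e"
    obtain k x l y j z where "p = (k, x)" "q = (l, y)" "r = (j, z)" by (metis surj_pair)
    then show "(p, r) \<in> limit_rel A e"
      using * limit_rel_iff[of k "max k (max l j)"] limit_rel_iff[of l "max k (max l j)"] by simp
  qed
qed

lemma cls_eq_iff:
  assumes "x \<in> carrier (A k)" "y \<in> carrier (A l)" "k \<le> m" "l \<le> m"
  shows "cls k x = cls l y \<longleftrightarrow> tr k m x = tr l m y"
  using eq_equiv_class_iff[OF equiv_limit_rel, of "(k, x)" "(l, y)"] limit_rel_iff[OF assms(3,4)] assms(1,2) by simp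

lemma cls_tr: "\<lbrakk>x \<in> carrier (A k); k \<le> m\<rbrakk> \<Longrightarrow> cls m (tr k m x) = cls k x"
  using cls_eq_iff[of "tr k m x" m x k m] embeddingsD(1)[OF tr_embedding] by simp

lemma mem_cls: "x \<in> carrier (A k) \<Longrightarrow> (k, x) \<in> cls k x"
  using equiv_class_self[OF equiv_limit_rel, of "(k, x)"] by simp

text \<open>\<open>direct_limit\<close> forms products and inverses as unions over all
  representatives; once each of them yields the same class, the union is that class.\<close>

lemma UN_constant:
  assumes "p \<in> X" "\<And>q. q \<in> X \<Longrightarrow> f q = c"
  shows "(\<Union>q\<in>X. f q) = c"
  using assms by auto

lemma direct_limit_mul:
  assumes x: "x \<in> carrier (A k)" and y: "y \<in> carrier (A k)"
  shows "cls k x \<cdot>\<^bsub>direct_limit A e\<^esub> cls k y = cls k (x \<cdot>\<^bsub>A k\<^esub> y)"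
proof -
  have *: "cls (max l j) (tr l (max l j) u \<cdot>\<^bsub>A (max l j)\<^esub> tr j (max l j) v) = cls k (x \<cdot>\<^bsub>A k\<^esub> y)"
    if u: "(l, u) \<in> cls k x" and v: "(j, v) \<in> cls k y" for l u j v
  proof -
    let ?n = "max l j" and ?m = "max k (max l j)"
    have uv: "u \<in> carrier (A l)" "tr k ?m x = tr l ?m u" "v \<in> carrier (A j)" "tr k ?m y = tr j ?m v"
      using u v limit_rel_iff[of k ?m l] limit_rel_iff[of k ?m j] by auto
    have t: "tr l ?n u \<in> carrier (A ?n)" "tr j ?n v \<in> carrier (A ?n)"
      using uv embeddingsD(1)[OF tr_embedding] by simp_all
    then have "tr ?n ?m (tr l ?n u \<cdot>\<^bsub>A ?n\<^esub> tr j ?n v) = tr l ?m u \<cdot>\<^bsub>A ?m\<^esub> tr j ?m v"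
      using embeddingsD(2)[OF tr_embedding[of ?n ?m] t] by (simp add: tr_tr)
    also have "\<dots> = tr k ?m (x \<cdot>\<^bsub>A k\<^esub> y)"
      using embeddingsD(2)[OF tr_embedding[of k ?m] x y] uv by simp
    finally show ?thesis
      using t x y by (subst cls_eq_iff[where m = ?m]) (simp_all add: inverse_semigroup.mul_closed[OF inverse_semigroup])
  qed
  have "cls k x \<cdot>\<^bsub>direct_limit A e\<^esub> cls k y = (\<Union>p\<in>cls k x. \<Union>q\<in>cls k y.
      cls (max (fst p) (fst q)) (tr (fst p) (max (fst p) (fst q)) (snd p) \<cdot>\<^bsub>A (max (fst p) (fst q))\<^esub> tr (fst q) (max (fst p) (fst q)) (snd q)))"
    by (simp add: direct_limit_def split_def)
  also have "\<dots> = cls k (x \<cdot>\<^bsub>A k\<^esub> y)"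
    by (rule UN_constant[OF mem_cls[OF x]], rule UN_constant[OF mem_cls[OF y]]) (rule *; simp)
  finally show ?thesis .
qed

lemma direct_limit_sinv:
  assumes x: "x \<in> carrier (A k)"
  shows "sinv (direct_limit A e) (cls k x) = cls k (sinv (A k) x)"
proof -
  have *: "cls l (sinv (A l) u) = cls k (sinv (A k) x)" if u: "(l, u) \<in> cls k x" for l u
  proof -
    have u: "u \<in> carrier (A l)" "tr k (max k l) x = tr l (max k l) u"
      using u limit_rel_iff[of k "max k l" l] by auto
    have "tr l (max k l) (sinv (A l) u) = tr k (max k l) (sinv (A k) x)"
      using embeddingsD(3)[OF tr_embedding[of l "max k l"] _ ] embeddingsD(3)[OF tr_embedding[of k "max k l"] x] u by simp
    then show ?thesis
      using u x by (subst cls_eq_iff[where m = "max k l"]) (simp_all add: inverse_semigroup.sinv_closed[OF inverse_semigroup])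
  qed
  have "sinv (direct_limit A e) (cls k x) = (\<Union>p\<in>cls k x. cls (fst p) (sinv (A (fst p)) (snd p)))"
    by (simp add: direct_limit_def split_def)
  also have "\<dots> = cls k (sinv (A k) x)"
    by (rule UN_constant[OF mem_cls[OF x]]) (rule *; simp)
  finally show ?thesis .
qed

lemma carrier_direct_limit: "carrier (direct_limit A e) = (\<Union>k. cls k ` carrier (A k))"
  by (auto simp: direct_limit_def quotient_def)

lemma cls_embedding: "cls k \<in> embeddings (A k) (direct_limit A e)"
proof -
  have "inj_on (cls k) (carrier (A k))"
    using cls_eq_iff[of _ k _ k k] by (auto intro!: inj_onI)
  then show ?thesis
    using direct_limit_mul direct_limit_sinv by (auto simp: embeddings_def homs_def carrier_direct_limit)
qed

lemma cls_Suc: "x \<in> carrier (A k) \<Longrightarrow> cls (Suc k) (e k x) = cls k x"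
  using cls_tr[of x k "Suc k"] by simp

end

lemma exhaustion_direct_limit:
  assumes e: "\<And>k. e k \<in> embeddings (sym_inv (i k)) (sym_inv (i (Suc k)))"
    and h: "h \<in> isos (direct_limit (\<lambda>k. sym_inv (i k)) e) S"
  defines "\<kappa> \<equiv> \<lambda>k x. h (limit_rel (\<lambda>k. sym_inv (i k)) e `` {(k, x)})"
  shows "exhaustion S i \<kappa>" "\<And>k x. x \<in> carrier (sym_inv (i k)) \<Longrightarrow> \<kappa> (Suc k) (e k x) = \<kappa> k x"
proof -
  interpret embedding_chain "\<lambda>k. sym_inv (i k)" e
    by (rule embedding_chain.intro) (use e in simp_all)
  show Suc: "\<kappa> (Suc k) (e k x) = \<kappa> k x" if "x \<in> carrier (sym_inv (i k))" for k x
    using cls_Suc[OF that] by (simp add: \<kappa>_def)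
  have "\<kappa> k \<in> embeddings (sym_inv (i k)) S" for k
    unfolding \<kappa>_def using embeddings_comp[OF cls_embedding isos_embeddings[OF h]] .
  moreover have "\<kappa> k ` carrier (sym_inv (i k)) \<subseteq> \<kappa> (Suc k) ` carrier (sym_inv (i (Suc k)))" for k
    using Suc embeddingsD(1)[OF e] by (metis image_eqI image_subsetI)
  moreover have "carrier S = (\<Union>k. \<kappa> k ` carrier (sym_inv (i k)))"
    using isos_surj[OF h, symmetric] by (simp add: carrier_direct_limit \<kappa>_def image_UN image_image)
  ultimately show "exhaustion S i \<kappa>" by (simp add: exhaustion_def)
qed

text \<open>Each axiom concerns at most three elements, and these lie together in one copy of a
  finite symmetric inverse semigroup.\<close>

lemma inverse_semigroup_exhaustion:
  assumes S: "exhaustion S i \<kappa>"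
  shows "inverse_semigroup S"
proof -
  have \<kappa>: "\<kappa> k \<in> embeddings (sym_inv (i k)) S" for k using S by (simp add: exhaustion_def)
  have iso: "\<kappa> k \<in> isos (sym_inv (i k)) (S\<lparr>carrier := \<kappa> k ` carrier (sym_inv (i k))\<rparr>)" for k
    using isos_image[OF \<kappa>] .
  have sub: "inverse_semigroup (S\<lparr>carrier := \<kappa> k ` carrier (sym_inv (i k))\<rparr>)" for k
    using inverse_semigroup_iso[OF inverse_semigroup_sym_inv iso] .
  have local: "\<exists>C. X \<subseteq> C \<and> C \<subseteq> carrier S \<and> inverse_semigroup (S\<lparr>carrier := C\<rparr>)"
    if X: "finite X" "X \<subseteq> carrier S" for X
  proof -
    obtain k where "X \<subseteq> \<kappa> k ` carrier (sym_inv (i k))" using exhaustion_finite_subset[OF S X, of 0] by auto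
    then show ?thesis using sub embeddingsD(1)[OF \<kappa>] by (metis image_subsetI)
  qed
  show ?thesis
  proof
    show "carrier S \<noteq> {}" using embeddingsD(1)[OF \<kappa>] inverse_semigroup.nonempty[OF inverse_semigroup_sym_inv] by blast
  next
    fix x y assume "x \<in> carrier S" "y \<in> carrier S"
    then obtain C where C: "{x, y} \<subseteq> C" "C \<subseteq> carrier S" "inverse_semigroup (S\<lparr>carrier := C\<rparr>)"
      using local[of "{x, y}"] by auto
    show "x \<cdot>\<^bsub>S\<^esub> y \<in> carrier S" using inverse_semigroup.mul_closed[OF C(3), of x y] C by auto
  next
    fix x assume "x \<in> carrier S"
    then obtain C where C: "{x} \<subseteq> C" "C \<subseteq> carrier S" "inverse_semigroup (S\<lparr>carrier := C\<rparr>)"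
      using local[of "{x}"] by auto
    show "sinv S x \<in> carrier S" using inverse_semigroup.sinv_closed[OF C(3), of x] C by auto
    show "x \<cdot>\<^bsub>S\<^esub> sinv S x \<cdot>\<^bsub>S\<^esub> x = x" using inverse_semigroup.mul_sinv_mul[OF C(3), of x] C by auto
    show "sinv S x \<cdot>\<^bsub>S\<^esub> x \<cdot>\<^bsub>S\<^esub> sinv S x = sinv S x" using inverse_semigroup.sinv_mul_sinv[OF C(3), of x] C by auto
  next
    fix x y z assume "x \<in> carrier S" "y \<in> carrier S" "z \<in> carrier S"
    then obtain C where C: "{x, y, z} \<subseteq> C" "C \<subseteq> carrier S" "inverse_semigroup (S\<lparr>carrier := C\<rparr>)"
      using local[of "{x, y, z}"] by auto
    show "x \<cdot>\<^bsub>S\<^esub> y \<cdot>\<^bsub>S\<^esub> z = x \<cdot>\<^bsub>S\<^esub> (y \<cdot>\<^bsub>S\<^esub> z)" using inverse_semigroup.mul_assoc[OF C(3), of x y z] C by auto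
  next
    fix x y assume *: "x \<in> carrier S" "y \<in> carrier S" "x \<cdot>\<^bsub>S\<^esub> y \<cdot>\<^bsub>S\<^esub> x = x" "y \<cdot>\<^bsub>S\<^esub> x \<cdot>\<^bsub>S\<^esub> y = y"
    then obtain C where C: "{x, y} \<subseteq> C" "C \<subseteq> carrier S" "inverse_semigroup (S\<lparr>carrier := C\<rparr>)"
      using local[of "{x, y}"] by auto
    show "y = sinv S x" using inverse_semigroup.sinv_unique[OF C(3), of x y] C * by auto
  qed
qed

section \<open>Homogeneity\<close>

lemma symmetric_inverse_limit_exhaustion:
  assumes "symmetric_inverse_limit S"
  obtains i \<kappa> where "exhaustion S i \<kappa>"
proof -
  obtain i e h where *: "inverse_semigroup S" "\<And>k. e k \<in> embeddings (sym_inv (i k)) (sym_inv (i (Suc k)))"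
    "h \<in> isos S (direct_limit (\<lambda>k. sym_inv (i k)) e)"
    using assms unfolding symmetric_inverse_limit_def isomorphic_def by blast
  have "inverse_semigroup (direct_limit (\<lambda>k. sym_inv (i k)) e)"
    using inverse_semigroup_iso[OF *(1,3)] .
  then obtain g where "g \<in> isos (direct_limit (\<lambda>k. sym_inv (i k)) e) S"
    using isos_sym[OF *(1) _ *(3)] by blast
  then show thesis using that exhaustion_direct_limit(1)[where i = i and e = e and h = g, OF *(2)] by blast
qed

lemma universal_sym_inv:
  assumes "universal S"
  obtains u where "u \<in> embeddings (sym_inv n) S"
proof -
  obtain B :: "nat inv_alg" and h where B: "finite_inverse_semigroup B" "h \<in> isos (sym_inv n) B"
    using nat_copy[OF finite_inverse_semigroup_sym_inv] .
  then obtain u where "u \<in> embeddings B S" using assms unfolding universal_def by blast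
  then show thesis using that embeddings_comp[OF isos_embeddings[OF B(2)]] by blast
qed

text \<open>Universality gives some embedding \<open>u\<close> of \<open>sym_inv m\<close>. Then
  \<open>u\<close> after \<open>f\<close>, and \<open>h\<close>, give two copies of the base
  \<open>sym_inv n\<close>; the automorphism \<open>\<alpha>\<close> taking the first to the second
  turns \<open>u\<close> into the extension.\<close>

lemma maximally_homogeneous_extends_embeddings:
  assumes S: "maximally_homogeneous S"
  shows "extends_embeddings S"
  unfolding extends_embeddings_def
proof (intro allI ballI)
  fix n m f h
  assume f: "f \<in> embeddings (sym_inv n) (sym_inv m)" and h: "h \<in> embeddings (sym_inv n) S"
  have inv: "inverse_semigroup S" using S by (simp add: maximally_homogeneous_def)
  obtain u where u: "u \<in> embeddings (sym_inv m) S"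
    using universal_sym_inv S by (metis maximally_homogeneous_def)
  obtain B :: "nat inv_alg" and b where B: "finite_inverse_semigroup B" "b \<in> isos (sym_inv n) B"
    using nat_copy[OF finite_inverse_semigroup_sym_inv] .
  have uf: "(\<lambda>x. u (f x)) \<in> embeddings (sym_inv n) S" using embeddings_comp[OF f u] .
  let ?T1 = "(\<lambda>x. u (f x)) ` carrier (sym_inv n)" and ?T2 = "h ` carrier (sym_inv n)"
  have sub: "inverse_subsemigroup ?T1 S" "inverse_subsemigroup ?T2 S"
    using image_inverse_subsemigroup[OF embeddingsD(6) inverse_subsemigroup_carrier[OF inverse_semigroup_sym_inv]] uf h
    by blast+
  have iso: "(\<lambda>x. u (f x)) \<in> isos (sym_inv n) (S\<lparr>carrier := ?T1\<rparr>)" "h \<in> isos (sym_inv n) (S\<lparr>carrier := ?T2\<rparr>)"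
    using isos_image[OF uf] isos_image[OF h] by auto
  obtain p where p: "p \<in> isos (S\<lparr>carrier := ?T1\<rparr>) (sym_inv n)" "\<forall>x\<in>carrier (sym_inv n). p (u (f x)) = x"
    using isos_sym[OF inverse_semigroup_sym_inv inverse_semigroup_substructure[OF inv sub(1)] iso(1)] by blast
  obtain b' where b': "b' \<in> isos B (sym_inv n)"
    using isos_sym[OF inverse_semigroup_sym_inv _ B(2)] B(1) by (metis finite_inverse_semigroup_def)
  have "amalgamation_base B" using amalgamation_base_iso[OF amalgamation_base_sym_inv B(2)] .
  then have hom: "acts_homogeneously S B" using S by (simp add: maximally_homogeneous_def)
  have copies: "S\<lparr>carrier := ?T1\<rparr> \<simeq> B" "B \<simeq> S\<lparr>carrier := ?T2\<rparr>"
    using isos_comp[OF p(1) B(2)] isos_comp[OF b' iso(2)] by (auto simp: isomorphic_def)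
  obtain \<alpha> where \<alpha>: "\<alpha> \<in> isos S S" "\<forall>x\<in>?T1. \<alpha> x = h (p x)"
    using hom[unfolded acts_homogeneously_def, rule_format, OF sub copies isos_comp[OF p(1) iso(2)]] by (elim bexE)
  show "\<exists>h'\<in>embeddings (sym_inv m) S. \<forall>x\<in>carrier (sym_inv n). h' (f x) = h x"
    using embeddings_comp[OF u isos_embeddings[OF \<alpha>(1)]] \<alpha>(2) p(2) by (intro bexI[of _ "\<lambda>x. \<alpha> (u x)"]) auto
qed

theorem maximally_homogeneous_unique:
  assumes S: "symmetric_inverse_limit S" "maximally_homogeneous S"
    and T: "symmetric_inverse_limit T" "maximally_homogeneous T"
  shows "S \<simeq> T"
proof -
  obtain i \<kappa> where \<kappa>: "exhaustion S i \<kappa>" using symmetric_inverse_limit_exhaustion[OF S(1)] .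
  obtain j \<theta> where \<theta>: "exhaustion T j \<theta>" using symmetric_inverse_limit_exhaustion[OF T(1)] .
  \<comment> \<open>Any embedding of the first stage of \<open>S\<close> can start the
    back-and-forth.\<close>
  obtain u where "u \<in> embeddings (sym_inv (i 0)) T"
    using universal_sym_inv T(2) by (metis maximally_homogeneous_def)
  then show ?thesis
    using back_and_forth[OF \<kappa> maximally_homogeneous_extends_embeddings[OF S(2)] \<theta> maximally_homogeneous_extends_embeddings[OF T(2)]]
    by (metis empty_iff isomorphic_def)
qed

section \<open>Construction of the maximally homogeneous limit\<close>

definition solves ::
    "nat \<Rightarrow> nat \<Rightarrow> ((nat \<times> nat) set \<Rightarrow> (nat \<times> nat) set) \<Rightarrow> (nat \<times> nat) set set \<Rightarrow> ((nat \<times> nat) set \<Rightarrow> (nat \<times> nat) set) \<Rightarrow> bool"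
  where "solves n m g T \<phi> \<longleftrightarrow> (\<exists>\<psi>\<in>embeddings (sym_inv n) (sym_inv m). \<forall>x\<in>T. \<psi> x = g (\<phi> x))"

text \<open>\<open>\<phi>\<close> is a partial self-embedding of a stage, defined on a base. A
  solution extends it to the whole stage, with values in the next stage, where \<open>\<phi>\<close>
  is read through the connecting map.\<close>

definition extension_problem :: "nat \<Rightarrow> (nat \<times> nat) set set \<Rightarrow> ((nat \<times> nat) set \<Rightarrow> (nat \<times> nat) set) \<Rightarrow> bool" where
  "extension_problem n T \<phi> \<longleftrightarrow> inverse_subsemigroup T (sym_inv n) \<and>
     amalgamation_base (sym_inv n\<lparr>carrier := T\<rparr>) \<and> \<phi> \<in> embeddings (sym_inv n\<lparr>carrier := T\<rparr>) (sym_inv n)"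

text \<open>One problem is solved by amalgamating \<open>sym_inv n\<close> and the stage
  \<open>sym_inv m\<close> over \<open>T\<close>. Problems solved earlier stay solved, since their
  solutions and the connecting map are both composed with \<open>g'\<close>.\<close>

lemma solve_finitely_many:
  assumes "finite X"
  shows "\<exists>m>n. \<exists>g\<in>embeddings (sym_inv n) (sym_inv m). \<forall>(T, \<phi>)\<in>X. extension_problem n T \<phi> \<longrightarrow> solves n m g T \<phi>"
  using assms
proof (induction X)
  case empty
  have "(\<lambda>x. x) \<in> embeddings (sym_inv n) (sym_inv (Suc n))"
    by (rule embeddings_sym_inv_mono[of _ _ n]) (auto simp: embeddings_def homs_def)
  then show ?case by auto
next
  case (insert p X)
  then obtain m g where m: "m > n" and g: "g \<in> embeddings (sym_inv n) (sym_inv m)"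
    and X: "\<forall>(T, \<phi>)\<in>X. extension_problem n T \<phi> \<longrightarrow> solves n m g T \<phi>" by blast
  obtain T \<phi> where p: "p = (T, \<phi>)" by (cases p)
  show ?case
  proof (cases "extension_problem n T \<phi>")
    case False
    then show ?thesis using m g X p by auto
  next
    case True
    then have T: "T \<subseteq> carrier (sym_inv n)" and base: "amalgamation_base (sym_inv n\<lparr>carrier := T\<rparr>)"
      and \<phi>: "\<phi> \<in> embeddings (sym_inv n\<lparr>carrier := T\<rparr>) (sym_inv n)"
      by (auto simp: extension_problem_def inverse_subsemigroup_def)
    have "(\<lambda>x. x) \<in> embeddings (sym_inv n\<lparr>carrier := T\<rparr>) (sym_inv n)"
      using T by (auto simp: embeddings_def homs_def)
    from amalgamation_base_sym_invD[OF base this embeddings_comp[OF \<phi> g]]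
    obtain M \<psi> g' where M: "\<psi> \<in> embeddings (sym_inv n) (sym_inv M)" "g' \<in> embeddings (sym_inv m) (sym_inv M)"
      "\<forall>x\<in>carrier (sym_inv n\<lparr>carrier := T\<rparr>). \<psi> x = g' (g (\<phi> x))"
      by (elim exE bexE)
    let ?M = "max M m"
    have \<psi>: "\<psi> \<in> embeddings (sym_inv n) (sym_inv ?M)" and g': "g' \<in> embeddings (sym_inv m) (sym_inv ?M)"
      using embeddings_sym_inv_mono[OF M(1)] embeddings_sym_inv_mono[OF M(2)] by auto
    have "solves n ?M (\<lambda>x. g' (g x)) T \<phi>" using \<psi> M(3) by (auto simp: solves_def)
    moreover have "solves n ?M (\<lambda>x. g' (g x)) U \<chi>" if sol: "solves n m g U \<chi>" for U \<chi>
    proof -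
      obtain \<rho> where "\<rho> \<in> embeddings (sym_inv n) (sym_inv m)" "\<forall>x\<in>U. \<rho> x = g (\<chi> x)"
        using sol by (auto simp: solves_def)
      then show ?thesis
        unfolding solves_def using embeddings_comp[OF _ g'] by (intro bexI[of _ "\<lambda>x. g' (\<rho> x)"]) auto
    qed
    ultimately have "\<forall>(U, \<chi>)\<in>insert p X. extension_problem n U \<chi> \<longrightarrow> solves n ?M (\<lambda>x. g' (g x)) U \<chi>"
      using X p by auto
    moreover have "(\<lambda>x. g' (g x)) \<in> embeddings (sym_inv n) (sym_inv ?M)" using embeddings_comp[OF g g'] .
    moreover have "?M > n" using m by simp
    ultimately show ?thesis by blast
  qed
qed

lemma solve_all:
  "\<exists>m>n. \<exists>g\<in>embeddings (sym_inv n) (sym_inv m). \<forall>T \<phi>. extension_problem n T \<phi> \<longrightarrow> solves n m g T \<phi>"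
proof -
  \<comment> \<open>Only the values of \<open>\<phi>\<close> on \<open>T\<close> matter; extensional
    functions represent them and are finite in number.\<close>
  let ?X = "SIGMA T:Pow (carrier (sym_inv n)). PiE T (\<lambda>_. carrier (sym_inv n))"
  have "finite ?X" by (intro finite_SigmaI finite_PiE) (auto intro: finite_subset)
  from solve_finitely_many[OF this, of n] obtain m g where m: "m > n" and g: "g \<in> embeddings (sym_inv n) (sym_inv m)"
    and X: "\<forall>(T, \<phi>)\<in>?X. extension_problem n T \<phi> \<longrightarrow> solves n m g T \<phi>" by blast
  have "solves n m g T \<phi>" if P: "extension_problem n T \<phi>" for T \<phi>
  proof -
    have "T \<subseteq> carrier (sym_inv n)" using P by (auto simp: extension_problem_def inverse_subsemigroup_def)
    moreover have \<phi>: "\<phi> \<in> embeddings (sym_inv n\<lparr>carrier := T\<rparr>) (sym_inv n)" using P by (simp add: extension_problem_def)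
    then have "restrict \<phi> T \<in> PiE T (\<lambda>_. carrier (sym_inv n))" using embeddingsD(1)[OF \<phi>] by auto
    moreover have "inverse_semigroup (sym_inv n\<lparr>carrier := T\<rparr>)"
      using P inverse_semigroup_substructure[OF inverse_semigroup_sym_inv] by (simp add: extension_problem_def)
    then have "extension_problem n T (restrict \<phi> T)"
      using P embeddings_cong[OF _ \<phi>, of "restrict \<phi> T"] by (simp add: extension_problem_def)
    ultimately have "solves n m g T (restrict \<phi> T)" using X by auto
    then show ?thesis by (auto simp: solves_def)
  qed
  then show ?thesis using m g by blast
qed

theorem maximally_homogeneous_exists:
  "\<exists>S :: nat inv_alg. symmetric_inverse_limit S \<and> maximally_homogeneous S"
proof -
  obtain nxt gg where nxt: "\<And>n. nxt n > n" and gg: "\<And>n. gg n \<in> embeddings (sym_inv n) (sym_inv (nxt n))"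
    and solves: "\<And>n T \<phi>. extension_problem n T \<phi> \<Longrightarrow> solves n (nxt n) (gg n) T \<phi>"
    using solve_all by metis
  define i where "i k = (nxt ^^ k) 1" for k
  define e where "e k = gg (i k)" for k
  have i_Suc: "i (Suc k) = nxt (i k)" for k by (simp add: i_def)
  have e: "e k \<in> embeddings (sym_inv (i k)) (sym_inv (i (Suc k)))" for k using gg by (simp add: e_def i_Suc)
  have i: "strict_mono i" "1 \<le> i 0" using nxt by (auto simp: strict_mono_Suc_iff i_Suc i_def)
  let ?L = "direct_limit (\<lambda>k. sym_inv (i k)) e"
  have "(\<lambda>x. x) \<in> isos ?L ?L" by (auto simp: isos_def homs_def bij_betw_def)
  from exhaustion_direct_limit(1)[where i = i and e = e, OF e this] have L: "exhaustion ?L i (\<lambda>k x. limit_rel (\<lambda>k. sym_inv (i k)) e `` {(k, x)})" .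
  have invL: "inverse_semigroup ?L" using inverse_semigroup_exhaustion[OF L] .
  \<comment> \<open>A countable union of finite images. This permits a copy of the limit on the
    natural numbers.\<close>
  have "countable (carrier ?L)"
    using L by (simp add: exhaustion_def countable_finite)
  then have inj: "inj_on (to_nat_on (carrier ?L)) (carrier ?L)" by (rule inj_on_to_nat_on)
  obtain S :: "nat inv_alg" where h: "to_nat_on (carrier ?L) \<in> isos ?L S" and inv: "inverse_semigroup S"
    using transport[OF invL inj] by blast
  define \<kappa> where "\<kappa> = (\<lambda>k x. to_nat_on (carrier ?L) (limit_rel (\<lambda>k. sym_inv (i k)) e `` {(k, x)}))"
  have S: "exhaustion S i \<kappa>" and \<kappa>_Suc: "\<And>k x. x \<in> carrier (sym_inv (i k)) \<Longrightarrow> \<kappa> (Suc k) (e k x) = \<kappa> k x"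
    using exhaustion_direct_limit[where i = i and e = e, OF e h] by (simp_all add: \<kappa>_def)
  have \<kappa>: "\<kappa> k \<in> embeddings (sym_inv (i k)) S" for k using S by (simp add: exhaustion_def)
  have limit: "symmetric_inverse_limit S"
    unfolding symmetric_inverse_limit_def isomorphic_def using inv i e isos_sym[OF invL inv h] by blast
  have into_S: "\<exists>u. u \<in> embeddings (sym_inv m) S" for m
  proof -
    have "(\<lambda>x. x) \<in> embeddings (sym_inv m) (sym_inv (i m))"
      by (rule embeddings_sym_inv_mono[OF _ strict_mono_imp_increasing[OF i(1)]]) (auto simp: embeddings_def homs_def)
    then show ?thesis using embeddings_comp[OF _ \<kappa>] by blast
  qed
  have univ: "universal S"
    unfolding universal_def
  proof (intro allI impI)
    fix T :: "nat inv_alg" assume "finite_inverse_semigroup T"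
    then obtain m w where "w \<in> embeddings T (sym_inv m)" using Wagner_Preston by blast
    then show "embeddings T S \<noteq> {}" using into_S embeddings_comp by blast
  qed
  have image_sub: "inverse_subsemigroup (\<kappa> k ` carrier (sym_inv (i k))) S" for k
    using image_inverse_subsemigroup[OF embeddingsD(6)[OF \<kappa>] inverse_subsemigroup_carrier[OF inverse_semigroup_sym_inv]] .
  have lf: "locally_finite S"
    unfolding locally_finite_def
  proof (intro allI impI)
    fix X assume "X \<noteq> {} \<and> finite X \<and> X \<subseteq> carrier S"
    then obtain k where "X \<subseteq> \<kappa> k ` carrier (sym_inv (i k))" using exhaustion_finite_subset[OF S, of X 0] by blast
    then have "generated S X \<subseteq> \<kappa> k ` carrier (sym_inv (i k))"
      using image_sub by (auto simp: generated_def)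
    then show "finite (generated S X)" by (rule finite_subset) simp
  qed
  \<comment> \<open>The solution at stage \<open>Suc k\<close> is followed by
    \<open>\<kappa> (Suc k)\<close>, which absorbs the connecting map \<open>e k\<close>.\<close>
  have extend: "\<exists>\<psi>\<in>embeddings (sym_inv (i k)) S. \<forall>x\<in>T. \<psi> x = \<kappa> k (\<phi> x)"
    if P: "extension_problem (i k) T \<phi>" for k T \<phi>
  proof -
    obtain \<psi> where \<psi>: "\<psi> \<in> embeddings (sym_inv (i k)) (sym_inv (i (Suc k)))" "\<forall>x\<in>T. \<psi> x = e k (\<phi> x)"
      using solves[OF P] by (auto simp: solves_def e_def i_Suc)
    have "\<phi> x \<in> carrier (sym_inv (i k))" if "x \<in> T" for x
      using P that embeddingsD(1)[of \<phi> "sym_inv (i k)\<lparr>carrier := T\<rparr>"] by (simp add: extension_problem_def)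
    then show ?thesis
      using embeddings_comp[OF \<psi>(1) \<kappa>] \<psi>(2) \<kappa>_Suc by (intro bexI[of _ "\<lambda>x. \<kappa> (Suc k) (\<psi> x)"]) auto
  qed
  \<comment> \<open>A copy \<open>u\<close> of \<open>sym_inv m\<close> and the map \<open>h\<close>
    are pulled into one stage \<open>k\<close>. There the passage from the copy \<open>?T\<close> of
    \<open>sym_inv n\<close> to the one given by \<open>h'\<close> is an extension problem, and its
    solution corrects \<open>u'\<close>.\<close>
  have ext: "extends_embeddings S"
    unfolding extends_embeddings_def
  proof (intro allI ballI)
    fix n m f h
    assume f: "f \<in> embeddings (sym_inv n) (sym_inv m)" and h: "h \<in> embeddings (sym_inv n) S"
    obtain u where u: "u \<in> embeddings (sym_inv m) S" using into_S by blast
    obtain k1 h1 where h1: "h1 \<in> embeddings (sym_inv n) (sym_inv (i k1))" "\<And>x. x \<in> carrier (sym_inv n) \<Longrightarrow> \<kappa> k1 (h1 x) = h x"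
      using exhaustion_factor[OF S finite_inverse_semigroup_sym_inv h] by metis
    obtain k u' where k: "k \<ge> k1" and u': "u' \<in> embeddings (sym_inv m) (sym_inv (i k))" "\<And>x. x \<in> carrier (sym_inv m) \<Longrightarrow> \<kappa> k (u' x) = u x"
      using exhaustion_factor[OF S finite_inverse_semigroup_sym_inv u, of k1] by metis
    have "h ` carrier (sym_inv n) \<subseteq> \<kappa> k ` carrier (sym_inv (i k))"
      using exhaustion_mono[OF S k] h1(2) embeddingsD(1)[OF h1(1)] by force
    then obtain h' where h': "h' \<in> embeddings (sym_inv n) (sym_inv (i k))" "\<And>x. x \<in> carrier (sym_inv n) \<Longrightarrow> \<kappa> k (h' x) = h x"
      using embeddings_factor[OF inverse_semigroup_sym_inv inverse_semigroup_sym_inv h \<kappa>] by metis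
    let ?T = "(\<lambda>x. u' (f x)) ` carrier (sym_inv n)"
    have uf: "(\<lambda>x. u' (f x)) \<in> embeddings (sym_inv n) (sym_inv (i k))" using embeddings_comp[OF f u'(1)] .
    have sub: "inverse_subsemigroup ?T (sym_inv (i k))"
      using image_inverse_subsemigroup[OF embeddingsD(6)[OF uf] inverse_subsemigroup_carrier[OF inverse_semigroup_sym_inv]] .
    have iso: "(\<lambda>x. u' (f x)) \<in> isos (sym_inv n) (sym_inv (i k)\<lparr>carrier := ?T\<rparr>)" using isos_image[OF uf] .
    obtain p where p: "p \<in> isos (sym_inv (i k)\<lparr>carrier := ?T\<rparr>) (sym_inv n)" "\<forall>x\<in>carrier (sym_inv n). p (u' (f x)) = x"
      using isos_sym[OF inverse_semigroup_sym_inv inverse_semigroup_substructure[OF inverse_semigroup_sym_inv sub] iso] by blast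
    have "extension_problem (i k) ?T (\<lambda>x. h' (p x))"
      unfolding extension_problem_def
      using sub amalgamation_base_iso[OF amalgamation_base_sym_inv iso] embeddings_comp[OF isos_embeddings[OF p(1)] h'(1)] by blast
    from extend[OF this] obtain \<psi> where \<psi>: "\<psi> \<in> embeddings (sym_inv (i k)) S" "\<forall>x\<in>?T. \<psi> x = \<kappa> k (h' (p x))" by blast
    show "\<exists>h'\<in>embeddings (sym_inv m) S. \<forall>x\<in>carrier (sym_inv n). h' (f x) = h x"
      using embeddings_comp[OF u'(1) \<psi>(1)] \<psi>(2) p(2) h'(2) by (intro bexI[of _ "\<lambda>x. \<psi> (u' x)"]) auto
  qed
  \<comment> \<open>\<open>T1\<close>, \<open>T2\<close> and \<open>\<phi>\<close> are pulled into
    one stage, where \<open>\<phi>\<close> becomes an extension problem. Its solution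
    \<open>\<psi>\<close> maps the whole stage into \<open>S\<close>, and back-and-forth of
    \<open>S\<close> with itself extends \<open>\<psi>\<close> to an automorphism.\<close>
  have "acts_homogeneously S T" if T: "amalgamation_base T" for T :: "nat inv_alg"
    unfolding acts_homogeneously_def
  proof (intro allI impI ballI)
    fix T1 T2 \<phi>
    assume sub: "inverse_subsemigroup T1 S" "inverse_subsemigroup T2 S" and iso: "S\<lparr>carrier := T1\<rparr> \<simeq> T" "T \<simeq> S\<lparr>carrier := T2\<rparr>"
      and \<phi>: "\<phi> \<in> isos (S\<lparr>carrier := T1\<rparr>) (S\<lparr>carrier := T2\<rparr>)"
    have T_fin: "finite_inverse_semigroup T" using T by (simp add: amalgamation_base_def)
    have inv1: "inverse_semigroup (S\<lparr>carrier := T1\<rparr>)" using inverse_semigroup_substructure[OF inv sub(1)] .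
    have sub': "T1 \<subseteq> carrier S" "T2 \<subseteq> carrier S" using sub by (auto simp: inverse_subsemigroup_def)
    obtain t where "t \<in> isos (S\<lparr>carrier := T1\<rparr>) T" using iso(1) by (auto simp: isomorphic_def)
    then obtain t' where t': "t' \<in> isos T (S\<lparr>carrier := T1\<rparr>)"
      using isos_sym[OF inv1] T_fin by (metis finite_inverse_semigroup_def)
    have base1: "amalgamation_base (S\<lparr>carrier := T1\<rparr>)" using amalgamation_base_iso[OF T t'] .
    have "finite T1"
      using base1 by (simp add: amalgamation_base_def finite_inverse_semigroup_def)
    moreover have "T2 = \<phi> ` T1" using isos_surj[OF \<phi>] by simp
    ultimately obtain k where k: "T1 \<union> T2 \<subseteq> \<kappa> k ` carrier (sym_inv (i k))"
      using exhaustion_finite_subset[OF S, of "T1 \<union> T2" 0] sub' by auto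
    have "(\<lambda>x. x) \<in> embeddings (S\<lparr>carrier := T1\<rparr>) S" using sub' by (auto simp: embeddings_def homs_def)
    then obtain q where q: "q \<in> embeddings (S\<lparr>carrier := T1\<rparr>) (sym_inv (i k))" "\<forall>x\<in>T1. \<kappa> k (q x) = x"
      using embeddings_factor[OF inv1 inverse_semigroup_sym_inv _ \<kappa>, of "\<lambda>x. x" k] k by auto
    have "\<phi> \<in> embeddings (S\<lparr>carrier := T1\<rparr>) S"
      using embeddings_substructure[OF isos_embeddings[OF \<phi>] sub'(2)] .
    then obtain r where r: "r \<in> embeddings (S\<lparr>carrier := T1\<rparr>) (sym_inv (i k))" "\<forall>x\<in>T1. \<kappa> k (r x) = \<phi> x"
      using embeddings_factor[OF inv1 inverse_semigroup_sym_inv _ \<kappa>, of \<phi> k] k isos_surj[OF \<phi>] by auto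
    let ?U = "q ` T1"
    have isoq: "q \<in> isos (S\<lparr>carrier := T1\<rparr>) (sym_inv (i k)\<lparr>carrier := ?U\<rparr>)" using isos_image[OF q(1)] by simp
    have subU: "inverse_subsemigroup ?U (sym_inv (i k))"
      using image_inverse_subsemigroup[OF embeddingsD(6)[OF q(1)] inverse_subsemigroup_carrier[OF inv1]] by simp
    obtain q' where q': "q' \<in> isos (sym_inv (i k)\<lparr>carrier := ?U\<rparr>) (S\<lparr>carrier := T1\<rparr>)" "\<forall>x\<in>T1. q' (q x) = x"
      using isos_sym[OF inv1 inverse_semigroup_substructure[OF inverse_semigroup_sym_inv subU] isoq] by auto
    have "extension_problem (i k) ?U (\<lambda>x. r (q' x))"
      unfolding extension_problem_def
      using subU amalgamation_base_iso[OF base1 isoq] embeddings_comp[OF isos_embeddings[OF q'(1)] r(1)] by blast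
    from extend[OF this] obtain \<psi> where \<psi>: "\<psi> \<in> embeddings (sym_inv (i k)) S" "\<forall>x\<in>?U. \<psi> x = \<kappa> k (r (q' x))" by blast
    obtain \<alpha> where \<alpha>: "\<alpha> \<in> isos S S" "\<And>x. x \<in> carrier (sym_inv (i k)) \<Longrightarrow> \<alpha> (\<kappa> k x) = \<psi> x"
      using back_and_forth[OF S ext S ext \<psi>(1)] by blast
    have "\<alpha> x = \<phi> x" if x: "x \<in> T1" for x
    proof -
      have "\<alpha> x = \<alpha> (\<kappa> k (q x))" using q(2) x by simp
      also have "\<dots> = \<psi> (q x)" using \<alpha>(2) embeddingsD(1)[OF q(1)] x by simp
      also have "\<dots> = \<phi> x" using \<psi>(2) q'(2) r(2) x by simp
      finally show ?thesis .
    qed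
    then show "\<exists>\<alpha>\<in>isos S S. \<forall>x\<in>T1. \<alpha> x = \<phi> x" using \<alpha>(1) by blast
  qed
  then have "maximally_homogeneous S" using inv univ lf by (simp add: maximally_homogeneous_def)
  then show ?thesis using limit by blast
qed

theorem theorem3p4:
  shows "(\<exists>S :: nat inv_alg. symmetric_inverse_limit S \<and> maximally_homogeneous S) \<and>
    (\<forall>(S :: 'a inv_alg) (T :: 'b inv_alg).
       symmetric_inverse_limit S \<and> maximally_homogeneous S \<and>
       symmetric_inverse_limit T \<and> maximally_homogeneous T \<longrightarrow> S \<simeq> T)"
  using maximally_homogeneous_exists maximally_homogeneous_unique by blast

end
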